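(* Let $q\ge 3$ be a squarefree odd integer, let $\chi$ be a primitive non-principal Dirichlet character modulo $q$, and assume GRH for $L(s,\chi)$. Then for every real $K>0$ there exist a constant $C_K=C_{K,q,\chi}>0$ and a threshold $T_0=T_0(K,q,\chi)\ge 3$, depending only on $K,q,\chi$, such that for every real $T\ge T_0$ and every integer $k$ with $1\le k\le K L_T$, $$\frac1T\int_T^{2T}|X_\chi(t)|^{2k}\,dt\;\le\;(C_K\,k\,L_T)^k,$$ where $L_T=\log\log(qT)$ and $X_\chi(t)=\operatorname{Im}\log L(\tfrac12+it,\chi)$.
   Context: GRH for $L(s,\chi)$ means that every nontrivial zero of $L(s,\chi)$ (zero with $0<\operatorname{Re}s<1$) satisfies $\operatorname{Re}s=\tfrac12$. For real $t$ with $L(\tfrac12+it,\chi)\neq 0$, $X_\chi(t):=\operatorname{Im}\log L(\tfrac12+it,\chi)$, where $\log L(s,\chi)$ is obtained by starting from the principal branch at $\operatorname{Re}s=+\infty$ (so $\log L\to 0$ as $\operatorname{Re}s\to+\infty$) and continuing analytically along the horizontal line $\operatorname{Im}s=t$ down to $\operatorname{Re}s=\tfrac12$. Equivalently $X_\chi(t)=-\int_{1/2}^\infty \operatorname{Im}\frac{L'}{L}(\sigma+it,\chi)\,d\sigma$. The values of $X_\chi$ at the countably many $t$ with $L(\tfrac12+it,\chi)=0$ may be assigned arbitrarily. $L_T:=\log\log(qT)$. *)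

theory Defs
  imports
    "HOL-Complex_Analysis.Complex_Analysis"
    "HOL-Computational_Algebra.Squarefree"
begin

definition dirichlet_character :: "nat \<Rightarrow> (nat \<Rightarrow> complex) \<Rightarrow> bool" where
  "dirichlet_character q chi \<longleftrightarrow>
     q > 0 \<and>
     (\<forall>n. chi (n + q) = chi n) \<and>
     (\<forall>m n. chi (m * n) = chi m * chi n) \<and>
     (\<forall>n. chi n \<noteq> 0 \<longleftrightarrow> coprime n q)"

definition principal_character :: "nat \<Rightarrow> nat \<Rightarrow> complex" where
  "principal_character q = (\<lambda>n. if coprime n q then 1 else 0)"

text \<open>
  A character is primitive if it is not induced by a character modulo a proper divisor of \<open>q\<close>.
\<close>
definition primitive_character :: "nat \<Rightarrow> (nat \<Rightarrow> complex) \<Rightarrow> bool" where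
  "primitive_character q chi \<longleftrightarrow>
     dirichlet_character q chi \<and>
     \<not> (\<exists>d psi. d dvd q \<and> d < q \<and> dirichlet_character d psi \<and>
            (\<forall>n. coprime n q \<longrightarrow> chi n = psi n))"

text \<open>
  The value at \<open>s\<close> of the analytic continuation of \<open>\<Sum>n\<ge>1. chi(n) / n\<^sup>s\<close> from \<open>Re s > 1\<close> to a
  half-plane \<open>Re z > c\<close> containing \<open>s\<close>. By the identity theorem it does not depend on \<open>c\<close>. For
  non-principal \<open>chi\<close> such a continuation exists for every \<open>s\<close> and this is the entire function
  \<open>L(s, chi)\<close>; for principal \<open>chi\<close> the value is unspecified when \<open>Re s \<le> 1\<close>, because of the pole
  at 1.
\<close>
definition dirichlet_L :: "(nat \<Rightarrow> complex) \<Rightarrow> complex \<Rightarrow> complex" where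
  "dirichlet_L chi s =
     (THE w. \<exists>c f. c \<le> 1 \<and> c < Re s \<and> f holomorphic_on {z. Re z > c} \<and>
        (\<forall>z. Re z > 1 \<longrightarrow> (\<lambda>n. chi (Suc n) / of_nat (Suc n) powr z) sums f z) \<and>
        w = f s)"

definition GRH :: "(nat \<Rightarrow> complex) \<Rightarrow> bool" where
  "GRH chi \<longleftrightarrow>
     (\<forall>s. 0 < Re s \<and> Re s < 1 \<and> dirichlet_L chi s = 0 \<longrightarrow> Re s = 1 / 2)"

text \<open>
  \<open>log L(1/2 + it, chi)\<close>: here \<open>h\<close> is a holomorphic branch of \<open>log L\<close> on a neighbourhood \<open>U\<close> of the
  ray \<open>{\<sigma> + it | \<sigma> \<ge> 1/2}\<close> which tends to 0 along the ray as \<open>\<sigma> \<rightarrow> \<infinity>\<close>. If \<open>L\<close> has no zero on the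
  ray, such a branch exists and its values on the ray are unique; otherwise there is none and the
  value is unspecified.
\<close>
definition log_L_half :: "(nat \<Rightarrow> complex) \<Rightarrow> real \<Rightarrow> complex" where
  "log_L_half chi t =
     (THE w. \<exists>U h. open U \<and> (\<forall>\<sigma>\<ge>1/2. Complex \<sigma> t \<in> U) \<and> h holomorphic_on U \<and>
        (\<forall>z\<in>U. exp (h z) = dirichlet_L chi z) \<and>
        ((\<lambda>\<sigma>. h (Complex \<sigma> t)) \<longlongrightarrow> 0) at_top \<and>
        w = h (Complex (1/2) t))"

definition X_arg :: "(nat \<Rightarrow> complex) \<Rightarrow> real \<Rightarrow> real" where
  "X_arg chi t = Im (log_L_half chi t)"

definition loglog :: "nat \<Rightarrow> real \<Rightarrow> real" where
  "loglog q T = ln (ln (real q * T))"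

lemma dirichlet_L_eqI:
  assumes f: "f holomorphic_on {z. Re z > c}" and c: "c \<le> 1" "c < Re s"
    and sums: "\<And>z. Re z > 1 \<Longrightarrow> (\<lambda>n. chi (Suc n) / of_nat (Suc n) powr z) sums f z"
  shows "dirichlet_L chi s = f s"
  unfolding dirichlet_L_def
proof (rule the_equality)
  show "\<exists>c f'. c \<le> 1 \<and> c < Re s \<and> f' holomorphic_on {z. Re z > c} \<and>
        (\<forall>z. Re z > 1 \<longrightarrow> (\<lambda>n. chi (Suc n) / of_nat (Suc n) powr z) sums f' z) \<and> f s = f' s"
    using assms by blast
next
  fix w
  assume "\<exists>c g. c \<le> 1 \<and> c < Re s \<and> g holomorphic_on {z. Re z > c} \<and>
        (\<forall>z. Re z > 1 \<longrightarrow> (\<lambda>n. chi (Suc n) / of_nat (Suc n) powr z) sums g z) \<and> w = g s"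
  then obtain b g where b: "b \<le> 1" "b < Re s" and g: "g holomorphic_on {z. Re z > b}"
    and gs: "\<And>z. Re z > 1 \<Longrightarrow> (\<lambda>n. chi (Suc n) / of_nat (Suc n) powr z) sums g z"
    and w: "w = g s"
    by blast
  define m where "m = max b c"
  have "g s = f s"
  proof (rule analytic_continuation_open[of "{z. Re z > 1}" "{z. Re z > m}" g f])
    show "g holomorphic_on {z. Re z > m}" "f holomorphic_on {z. Re z > m}"
      by (rule holomorphic_on_subset[OF g] holomorphic_on_subset[OF f]; auto simp: m_def)+
    show "connected {z. Re z > m}"
      by (intro convex_connected convex_halfspace_Re_gt)
    show "{z. Re z > 1} \<noteq> {}"
      by (auto intro: exI[of _ 2])
    show "open {z. Re z > 1}" "open {z. Re z > m}"
      by (rule open_halfspace_Re_gt)+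
    show "g z = f z" if "z \<in> {z. Re z > 1}" for z
      using that gs sums sums_unique2 by blast
  qed (use b c in \<open>auto simp: m_def\<close>)
  with w show "w = f s" by simp
qed

lemma log_L_half_eqI:
  assumes U: "open U" "\<And>\<sigma>. \<sigma> \<ge> 1/2 \<Longrightarrow> Complex \<sigma> t \<in> U" and h: "h holomorphic_on U"
    and exp: "\<And>z. z \<in> U \<Longrightarrow> exp (h z) = dirichlet_L chi z"
    and lim: "((\<lambda>\<sigma>. h (Complex \<sigma> t)) \<longlongrightarrow> 0) at_top"
  shows "log_L_half chi t = h (Complex (1/2) t)"
  unfolding log_L_half_def
proof (rule the_equality)
  show "\<exists>U k. open U \<and> (\<forall>\<sigma>\<ge>1/2. Complex \<sigma> t \<in> U) \<and> k holomorphic_on U \<and>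
        (\<forall>z\<in>U. exp (k z) = dirichlet_L chi z) \<and> ((\<lambda>\<sigma>. k (Complex \<sigma> t)) \<longlongrightarrow> 0) at_top \<and>
        h (Complex (1/2) t) = k (Complex (1/2) t)"
    using assms by blast
next
  fix w
  assume "\<exists>U k. open U \<and> (\<forall>\<sigma>\<ge>1/2. Complex \<sigma> t \<in> U) \<and> k holomorphic_on U \<and>
        (\<forall>z\<in>U. exp (k z) = dirichlet_L chi z) \<and> ((\<lambda>\<sigma>. k (Complex \<sigma> t)) \<longlongrightarrow> 0) at_top \<and>
        w = k (Complex (1/2) t)"
  then obtain V k where V: "open V" "\<And>\<sigma>. \<sigma> \<ge> 1/2 \<Longrightarrow> Complex \<sigma> t \<in> V" "k holomorphic_on V"
    and kexp: "\<And>z. z \<in> V \<Longrightarrow> exp (k z) = dirichlet_L chi z"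
    and klim: "((\<lambda>\<sigma>. k (Complex \<sigma> t)) \<longlongrightarrow> 0) at_top"
    and w: "w = k (Complex (1/2) t)"
    by blast
  define d where "d = (\<lambda>\<sigma>. k (Complex \<sigma> t) - h (Complex \<sigma> t))"
  have "continuous_on {1/2..} (\<lambda>\<sigma>. Complex \<sigma> t)"
    unfolding complex_eq by (intro continuous_intros)
  then have cont: "continuous_on {1/2..} d"
    unfolding d_def
    by (intro continuous_on_diff
        continuous_on_compose2[OF holomorphic_on_imp_continuous_on[OF V(3)]]
        continuous_on_compose2[OF holomorphic_on_imp_continuous_on[OF h]])
       (use U V in auto)
  have "exp (d \<sigma>) = 1" if "\<sigma> \<ge> 1/2" for \<sigma>
  proof -
    have "exp (k (Complex \<sigma> t)) = exp (h (Complex \<sigma> t))"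
      using that exp kexp U(2) V(2) by simp
    then show ?thesis by (simp add: d_def exp_diff)
  qed
  then have ints: "\<exists>n::int. d \<sigma> = of_int (2 * n) * pi * \<i>" if "\<sigma> \<ge> 1/2" for \<sigma>
    using that exp_eq_1[of "d \<sigma>"] complex_eq_iff[of "d \<sigma>"] by fastforce
  have sep: "1 \<le> norm (d x - d y)" if xy: "x \<ge> 1/2" "y \<ge> 1/2" "d x \<noteq> d y" for x y
  proof -
    obtain m n :: int where mn: "d x = of_int (2 * m) * pi * \<i>" "d y = of_int (2 * n) * pi * \<i>"
      using ints[OF xy(1)] ints[OF xy(2)] by blast
    then have "d x - d y = of_real (2 * real_of_int (m - n) * pi) * \<i>"
      by (simp add: algebra_simps)
    then have eq: "norm (d x - d y) = 2 * \<bar>real_of_int (m - n)\<bar> * pi"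
      by (simp only: norm_mult norm_of_real abs_mult) simp
    have "m \<noteq> n" using mn xy(3) by auto
    then have "1 \<le> \<bar>real_of_int (m - n)\<bar>" by linarith
    moreover have "1 \<le> 2 * pi" using pi_gt3 by linarith
    ultimately have "1 * 1 \<le> \<bar>real_of_int (m - n)\<bar> * (2 * pi)" by (intro mult_mono) auto
    then show ?thesis using eq by (simp add: mult_ac)
  qed
  have "d constant_on {1/2..}"
  proof (rule continuous_discrete_range_constant[OF _ cont])
    show "connected {1/2::real..}" by simp
    show "\<exists>e>0. \<forall>y. y \<in> {1/2..} \<and> d y \<noteq> d x \<longrightarrow> e \<le> norm (d y - d x)"
      if "x \<in> {1/2..}" for x
      using sep that by (intro exI[of _ 1]) auto
  qed
  then obtain a where a: "\<And>\<sigma>. \<sigma> \<ge> 1/2 \<Longrightarrow> d \<sigma> = a"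
    by (auto simp: constant_on_def)
  have "(d \<longlongrightarrow> 0 - 0) at_top"
    unfolding d_def by (intro tendsto_diff klim lim)
  moreover have "(d \<longlongrightarrow> a) at_top"
    by (rule tendsto_eventually, rule eventually_mono[OF eventually_ge_at_top[of "1/2"]]) (rule a)
  ultimately have "a = 0"
    using tendsto_unique trivial_limit_at_top_linorder by fastforce
  then show "w = h (Complex (1/2) t)"
    using a[of "1/2"] w by (simp add: d_def)
qed

end

theory Submission
  imports
    Defs
    "HOL-Combinatorics.Multiset_Permutations"
    "HOL-Number_Theory.Number_Theory"
    "HOL-Real_Asymp.Real_Asymp"
begin

text \<open>
The argument is Selberg's method of moments, with the zeros treated through a one-sided bound.

Away from the real axis \<open>L\<close> has no zero with real part greater than \<open>1/2\<close>: this is GRH inside the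
critical strip, the inequality \<open>3 + 4 cos \<theta> + cos (2 \<theta>) \<ge> 0\<close> on the line \<open>Re s = 1\<close>
(\<open>L_nonzero_on_one_line\<close>) and the Euler product to the right of it. So a branch \<open>logL\<close> of \<open>log L\<close>
exists on \<open>Re s > 1/2\<close>, \<open>Im s > 0\<close>, and it is the continuation of the Dirichlet series of \<open>log L\<close> over
the prime powers. The theorem is first proved for \<open>Y t = Im (logL (Complex \<sigma> t))\<close> with
\<open>1/2 < \<sigma> \<le> 1\<close> and constants that do not depend on \<open>\<sigma>\<close>; then \<open>\<sigma>\<close> tends to \<open>1/2\<close>.

\<^item> Let \<open>T \<le> t \<le> 2 T\<close>. Near height \<open>t\<close> the logarithmic derivative of \<open>L\<close> is \<open>\<Sum> 1 / (s - a)\<close>, over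
  \<open>O(log T)\<close> zeros \<open>a\<close>, up to an error \<open>O(log T)\<close> (\<open>log_derivative_local\<close>). All these zeros lie on or to
  the left of the critical line, so every summand has positive real part when \<open>Re s > 1/2\<close>, and
  \<open>Y' = Re (L'/L) \<ge> - M\<close> with \<open>M = O(log T)\<close>: the function \<open>Y\<close> cannot fall quickly, however close the
  zeros are. Integrating from \<open>Re s = 2\<close> gives \<open>\<bar>Y\<bar> \<le> M\<close> as well (\<open>logL_bounds\<close>).

\<^item> Integrate \<open>logL\<close> along a vertical segment against a Fejer kernel of width \<open>1/\<Delta>\<close> and move the
  contour to the right. The kernel grows like \<open>exp (2 \<Delta> x)\<close> while the part of the Dirichlet series
  with \<open>p\<^sup>m > X = exp (2 \<Delta>)\<close> decays like \<open>X powr (-x)\<close>, so that this part contributes only a small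
  error: the smoothed logarithm is a Dirichlet polynomial of length \<open>X\<close> (\<open>smoothed_log_approximation\<close>).

\<^item> By the lower bound for \<open>Y'\<close>, the value \<open>Y t\<close> is bounded above by the smoothed value at \<open>t + h\<close> and below
  by the one at \<open>t - h\<close>, where \<open>h = 16/\<Delta>\<close>, up to \<open>O(M/\<Delta>)\<close> and up to averages of \<open>\<bar>Y\<bar>\<close> against the
  tails of the kernel (\<open>quasi_monotone_abs_bound\<close>). The tails have so little mass that, by Jensen's
  inequality, the moments of these averages are at most a fixed fraction of the moment of \<open>Y\<close> itself and
  can be absorbed (\<open>moment_from_pointwise_bound\<close>).

\<^item> The \<open>k\<close>-th power of a polynomial over the primes up to \<open>X\<close> is a Dirichlet polynomial of length \<open>X\<^sup>k\<close>,
  and by unique factorization its coefficients come from at most \<open>k!\<close> products each. With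
  \<open>\<Delta> = log T / (8 k)\<close> this length is \<open>T\<close> to the power \<open>1/4\<close>, the mean value theorem is dominated by the
  diagonal, and the \<open>2k\<close>-th moment is at most a constant times \<open>T k! (C \<Sum> 1/p)\<^sup>k\<close>, where the sum of the
  reciprocals of the primes up to \<open>X\<close> is \<open>O(log log T)\<close> (\<open>prime_polynomial_moment\<close>,
  \<open>prime_reciprocal_sum_le\<close>).

\<^item> With this choice of \<open>\<Delta>\<close> the error \<open>O(M/\<Delta>)\<close> is \<open>O(k)\<close>. Its \<open>2k\<close>-th power is acceptable exactly
  because of the restriction on \<open>k\<close>: if \<open>k \<le> K L\<close> with \<open>L = log log (q T)\<close>, then \<open>k\<^sup>2 \<le> K k L\<close>
  (\<open>moment_right_of_critical_line\<close>).

Finally \<open>Y t\<close> tends to \<open>X_arg chi t\<close> as \<open>\<sigma>\<close> decreases to \<open>1/2\<close>, except at the finitely many \<open>t\<close> in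
\<open>[T, 2 T]\<close> with \<open>L(1/2 + it) = 0\<close>, and the bound \<open>\<bar>Y\<bar> \<le> M\<close> allows dominated convergence
(\<open>moment_on_critical_line\<close>).
\<close>

section \<open>Dirichlet series whose coefficients have bounded partial sums\<close>

lemma summation_by_parts:
  fixes a f :: "nat \<Rightarrow> complex"
  shows "(\<Sum>i<N. a i * f i) = (\<Sum>i<N. a i) * f N + (\<Sum>n<N. (\<Sum>i<Suc n. a i) * (f n - f (Suc n)))"
  by (induction N) (simp_all add: algebra_simps)

lemma norm_nat_powr: "norm (of_nat (Suc n) powr s) = real (Suc n) powr Re s"
proof -
  have "norm (complex_of_real (real (Suc n)) powr s) = real (Suc n) powr Re s"
    by (subst norm_powr_real_powr) auto
  then show ?thesis by simp
qed

lemma closed_segment_of_realE: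
  assumes "z \<in> closed_segment (of_real a :: complex) (of_real b)" "a \<le> b"
  obtains x where "z = of_real x" "a \<le> x" "x \<le> b"
proof -
  from assms obtain u where u: "0 \<le> u" "u \<le> 1" "z = (1 - u) *\<^sub>R of_real a + u *\<^sub>R of_real b"
    by (auto simp: in_segment)
  have "z = of_real (a + u * (b - a))"
    using u(3) by (simp add: scaleR_conv_of_real algebra_simps)
  moreover have "u * (b - a) \<le> 1 * (b - a)" using u assms by (intro mult_right_mono) auto
  ultimately show ?thesis using that[of "a + u * (b - a)"] u assms by auto
qed

text \<open>
  The derivative \<open>- s z powr (- s - 1)\<close> is at most \<open>norm s * a powr (- Re s - 1)\<close> in norm to the right of \<open>a\<close>.
\<close>
lemma powr_neg_diff_bound:
  assumes "0 < a" "a \<le> b" "Re s > -1"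
  shows "norm (of_real a powr (-s) - of_real b powr (-s)) \<le> norm s * a powr (- Re s - 1) * (b - a)"
proof -
  define S where "S = closed_segment (of_real a :: complex) (of_real b)"
  have S: "\<exists>x. z = of_real x \<and> x \<ge> a" if "z \<in> S" for z
    using that assms unfolding S_def by (metis closed_segment_of_realE)
  have "norm ((of_real a :: complex) powr (-s) - of_real b powr (-s))
     \<le> (norm s * a powr (- Re s - 1)) * norm ((of_real a :: complex) - of_real b)"
  proof (rule field_differentiable_bound[of S _ "\<lambda>z. -s * z powr (-s - 1)"])
    show "convex S" by (simp add: S_def)
  next
    fix z assume "z \<in> S"
    then obtain x where x: "z = of_real x" "x \<ge> a" using S by blast
    then have "z \<notin> \<real>\<^sub>\<le>\<^sub>0" using assms by auto
    then show "((\<lambda>w. w powr (-s)) has_field_derivative -s * z powr (-s - 1)) (at z within S)"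
      by (rule has_field_derivative_at_within[OF has_field_derivative_powr])
    have "norm (z powr (-s - 1)) = x powr (- Re s - 1)"
      using x assms by (subst x(1), subst norm_powr_real_powr) auto
    also have "\<dots> \<le> a powr (- Re s - 1)"
      using x assms by (intro powr_mono2') auto
    finally show "norm (-s * z powr (-s - 1)) \<le> norm s * a powr (- Re s - 1)"
      by (simp add: norm_mult mult_left_mono)
  qed (auto simp: S_def)
  moreover have "norm ((of_real a :: complex) - of_real b) = b - a"
    using assms by (simp add: norm_minus_commute[of "of_real a"] flip: of_real_diff)
  ultimately show ?thesis by simp
qed

lemma norm_powr_diff_le:
  assumes "Re s > -1"
  shows "norm (of_nat (Suc n) powr (-s) - of_nat (Suc (Suc n)) powr (-s))
           \<le> norm s * real (Suc n) powr (- Re s - 1)"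
  using powr_neg_diff_bound[of "real (Suc n)" "real (Suc (Suc n))" s] assms by simp

text \<open>
  The series \<open>\<Sum> a n / (n + 1) powr s\<close> after summation by parts. If the partial sums of \<open>a\<close> are bounded, this
  form converges absolutely, and locally uniformly, on the whole half-plane \<open>Re s > 0\<close>, so it is there the
  analytic continuation of the Dirichlet series.
\<close>
definition abel_series :: "(nat \<Rightarrow> complex) \<Rightarrow> complex \<Rightarrow> complex" where
  "abel_series a s = (\<Sum>n. (\<Sum>i<Suc n. a i) *
     (of_nat (Suc n) powr (-s) - of_nat (Suc (Suc n)) powr (-s)))"

lemma summable_Suc_powr: "x > 1 \<Longrightarrow> summable (\<lambda>n. real (Suc n) powr (-x))"
  using summable_Suc_iff[of "\<lambda>n. real n powr (-x)"] summable_real_powr_iff[of "-x"] by simp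

lemma abel_term_bound:
  assumes Q: "\<And>N. norm (\<Sum>i<N. a i) \<le> Q" and s: "Re s \<ge> d" "d > 0"
  shows "norm ((\<Sum>i<Suc n. a i) * (of_nat (Suc n) powr (-s) - of_nat (Suc (Suc n)) powr (-s)))
           \<le> Q * norm s * real (Suc n) powr (-(d + 1))"
proof -
  have "0 \<le> Q" using Q[of 0] by simp
  have "norm ((\<Sum>i<Suc n. a i) * (of_nat (Suc n) powr (-s) - of_nat (Suc (Suc n)) powr (-s)))
     \<le> Q * (norm s * real (Suc n) powr (- Re s - 1))"
    unfolding norm_mult using s \<open>0 \<le> Q\<close> by (intro mult_mono Q norm_powr_diff_le) auto
  also have "\<dots> \<le> Q * (norm s * real (Suc n) powr (-(d + 1)))"
    using s \<open>0 \<le> Q\<close> by (intro mult_left_mono powr_mono) auto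
  finally show ?thesis by (simp add: mult.assoc)
qed

lemma abel_series_bound:
  assumes Q: "\<And>N. norm (\<Sum>i<N. a i) \<le> Q" and s: "Re s \<ge> d" "d > 0"
  shows "norm (abel_series a s) \<le> Q * (\<Sum>n. real (Suc n) powr (-(d + 1))) * norm s"
proof -
  let ?f = "\<lambda>n. (\<Sum>i<Suc n. a i) * (of_nat (Suc n) powr (-s) - of_nat (Suc (Suc n)) powr (-s))"
  let ?g = "\<lambda>n. Q * norm s * real (Suc n) powr (-(d + 1))"
  have sm: "summable (\<lambda>n. real (Suc n) powr (-(d + 1)))"
    by (rule summable_Suc_powr) (use s in auto)
  have "norm (suminf ?f) \<le> suminf ?g"
    by (rule norm_suminf_le[OF _ summable_mult[OF sm]]) (rule abel_term_bound[OF assms])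
  also have "\<dots> = Q * norm s * (\<Sum>n. real (Suc n) powr (-(d + 1)))"
    by (rule suminf_mult[OF sm])
  finally show ?thesis by (simp add: abel_series_def mult_ac)
qed

lemma abel_series_holomorphic:
  assumes Q: "\<And>N. norm (\<Sum>i<N. a i) \<le> Q"
  shows "abel_series a holomorphic_on {s. Re s > 0}"
proof (rule holomorphic_uniform_sequence[where f = "\<lambda>N s. \<Sum>n<N. (\<Sum>i<Suc n. a i) *
     (of_nat (Suc n) powr (-s) - of_nat (Suc (Suc n)) powr (-s))"])
  show "open {s. Re s > 0}" by (rule open_halfspace_Re_gt)
next
  fix N
  show "(\<lambda>s. \<Sum>n<N. (\<Sum>i<Suc n. a i) *
     (of_nat (Suc n) powr (-s) - of_nat (Suc (Suc n)) powr (-s))) holomorphic_on {s. Re s > 0}"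
    by (intro holomorphic_intros) (auto simp del: of_nat_Suc)
next
  fix z assume "z \<in> {s. Re s > 0}"
  then have z: "Re z > 0" by simp
  define d where "d = Re z / 2"
  have d: "d > 0" using z by (simp add: d_def)
  have sub: "Re w \<ge> d \<and> norm w \<le> norm z + d" if "w \<in> cball z d" for w
  proof -
    have "norm (w - z) \<le> d" using that by (simp add: dist_norm norm_minus_commute)
    then show ?thesis
      using abs_Re_le_cmod[of "w - z"] norm_triangle_ineq2[of w z] by (auto simp: d_def)
  qed
  have "0 \<le> Q" using Q[of 0] by simp
  have "uniform_limit (cball z d) (\<lambda>N s. \<Sum>n<N. (\<Sum>i<Suc n. a i) *
     (of_nat (Suc n) powr (-s) - of_nat (Suc (Suc n)) powr (-s))) (abel_series a) sequentially"
    unfolding abel_series_def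
  proof (rule Weierstrass_m_test[where M = "\<lambda>n. Q * (norm z + d) * real (Suc n) powr (-(d + 1))"])
    fix n w assume w: "w \<in> cball z d"
    have "norm ((\<Sum>i<Suc n. a i) * (of_nat (Suc n) powr (-w) - of_nat (Suc (Suc n)) powr (-w)))
           \<le> Q * norm w * real (Suc n) powr (-(d + 1))"
      by (rule abel_term_bound[OF Q]) (use sub[OF w] d in auto)
    also have "\<dots> \<le> Q * (norm z + d) * real (Suc n) powr (-(d + 1))"
      using sub[OF w] \<open>0 \<le> Q\<close> by (intro mult_right_mono mult_left_mono) auto
    finally show "norm ((\<Sum>i<Suc n. a i) * (of_nat (Suc n) powr (-w) - of_nat (Suc (Suc n)) powr (-w)))
           \<le> Q * (norm z + d) * real (Suc n) powr (-(d + 1))" .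
  next
    show "summable (\<lambda>n. Q * (norm z + d) * real (Suc n) powr (-(d + 1)))"
      by (intro summable_mult summable_Suc_powr) (use d in auto)
  qed
  moreover have "cball z d \<subseteq> {s. Re s > 0}" using sub d by fastforce
  ultimately show "\<exists>d>0. cball z d \<subseteq> {s. Re s > 0} \<and>
     uniform_limit (cball z d) (\<lambda>N s. \<Sum>n<N. (\<Sum>i<Suc n. a i) *
     (of_nat (Suc n) powr (-s) - of_nat (Suc (Suc n)) powr (-s))) (abel_series a) sequentially"
    using d by blast
qed

lemma abel_series_sums:
  assumes Q: "\<And>N. norm (\<Sum>i<N. a i) \<le> Q" and s: "Re s > 0"
  shows "(\<lambda>n. a n * of_nat (Suc n) powr (-s)) sums abel_series a s"
proof -
  let ?f = "\<lambda>n. (\<Sum>i<Suc n. a i) * (of_nat (Suc n) powr (-s) - of_nat (Suc (Suc n)) powr (-s))"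
  have "0 \<le> Q" using Q[of 0] by simp
  have "summable ?f"
  proof (rule summable_comparison_test'[where N = 0])
    show "summable (\<lambda>n. Q * norm s * real (Suc n) powr (-(Re s + 1)))"
      by (intro summable_mult summable_Suc_powr) (use s in auto)
    show "norm (?f n) \<le> Q * norm s * real (Suc n) powr (-(Re s + 1))" for n
      by (rule abel_term_bound[OF Q]) (use s in auto)
  qed
  then have 1: "(\<lambda>N. \<Sum>n<N. ?f n) \<longlonglongrightarrow> abel_series a s"
    unfolding abel_series_def using summable_LIMSEQ by blast
  have 2: "(\<lambda>N. (\<Sum>i<N. a i) * of_nat (Suc N) powr (-s)) \<longlonglongrightarrow> 0"
  proof (rule Lim_null_comparison)
    show "\<forall>\<^sub>F N in sequentially. norm ((\<Sum>i<N. a i) * of_nat (Suc N) powr (-s))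
            \<le> Q * real (Suc N) powr (- Re s)"
    proof (rule always_eventually, rule allI)
      fix N
      show "norm ((\<Sum>i<N. a i) * of_nat (Suc N) powr (-s)) \<le> Q * real (Suc N) powr (- Re s)"
        unfolding norm_mult norm_nat_powr using Q by (simp add: mult_right_mono)
    qed
    have "(\<lambda>N. real (Suc N) powr (- Re s)) \<longlonglongrightarrow> 0"
      by (rule tendsto_neg_powr[OF _ filterlim_compose[OF filterlim_real_sequentially filterlim_Suc]])
         (use s in auto)
    then show "(\<lambda>N. Q * real (Suc N) powr (- Re s)) \<longlonglongrightarrow> 0"
      using tendsto_mult_right_zero by blast
  qed
  have "(\<lambda>N. \<Sum>n<N. a n * of_nat (Suc n) powr (-s)) \<longlonglongrightarrow> 0 + abel_series a s"
    unfolding summation_by_parts[of a "\<lambda>n. of_nat (Suc n) powr (-s)"]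
    by (intro tendsto_add 1 2)
  then show ?thesis by (simp add: sums_def)
qed

text \<open>
  A sum over a full period vanishes, so every partial sum is equal to one over less than a period.
\<close>
lemma periodic_partial_sums_bounded:
  fixes a :: "nat \<Rightarrow> complex"
  assumes per: "\<And>n. a (n + q) = a n" and zero: "(\<Sum>i<q. a i) = 0" and q: "q > 0"
  shows "norm (\<Sum>i<N. a i) \<le> (\<Sum>i<q. norm (a i))"
proof (induction N rule: less_induct)
  case (less N)
  show ?case
  proof (cases "N < q")
    case True
    have "norm (\<Sum>i<N. a i) \<le> (\<Sum>i<N. norm (a i))" by (rule norm_sum)
    also have "\<dots> \<le> (\<Sum>i<q. norm (a i))" using True by (intro sum_mono2) auto
    finally show ?thesis .
  next
    case False
    then obtain m where m: "N = m + q" using le_Suc_ex by (metis add.commute linorder_not_less)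
    have "(\<Sum>i<m + q. a i) = (\<Sum>i<q. a i) + (\<Sum>i<m. a (i + q))"
      by (induction m) (simp_all add: zero)
    then have "(\<Sum>i<N. a i) = (\<Sum>i<m. a i)" by (simp add: m per zero)
    then show ?thesis using less[of m] m q by simp
  qed
qed

section \<open>The logarithm of an Euler product\<close>

lemma norm_summable_on_comparison:
  fixes f :: "'a \<Rightarrow> complex"
  assumes "g summable_on A" and "\<And>x. x \<in> A \<Longrightarrow> norm (f x) \<le> (g x :: real)"
  shows "(\<lambda>x. norm (f x)) summable_on A"
proof (rule Infinite_Sum.abs_summable_on_comparison_test)
  show "(\<lambda>x. norm (g x)) summable_on A"
    by (rule iffD1[OF summable_on_iff_abs_summable_on_real assms(1)])
  show "norm (f x) \<le> norm (g x)" if "x \<in> A" for x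
    using assms(2)[OF that] by simp
qed

text \<open>
  Pairs \<open>(p, m)\<close> instead of the prime powers \<open>p\<^sup>m\<close> themselves: the terms of \<open>log L\<close> depend on \<open>m\<close>.
\<close>
definition prime_power_index :: "(nat \<times> nat) set" where
  "prime_power_index = {p. prime p} \<times> {1..}"

definition log_euler :: "(nat \<Rightarrow> complex) \<Rightarrow> complex" where
  "log_euler f = (\<Sum>\<^sub>\<infinity>(p, m)\<in>prime_power_index. f p ^ m / of_nat m)"

lemma inj_on_prime_power: "inj_on (\<lambda>(p, m). p ^ m) prime_power_index"
proof (rule inj_onI, clarify)
  fix p m r n assume "(p, m) \<in> prime_power_index" "(r, n) \<in> prime_power_index" and eq: "p ^ m = r ^ n"
  then have "prime p" "prime r" "m \<ge> 1" "n \<ge> 1" by (auto simp: prime_power_index_def)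
  then have "p dvd r ^ n" by (metis eq dvd_power less_eq_Suc_le One_nat_def)
  then have "p = r" using \<open>prime p\<close> \<open>prime r\<close> prime_dvd_power primes_dvd_imp_eq by blast
  moreover have "m = n"
    using eq \<open>p = r\<close> \<open>prime p\<close> prime_gt_1_nat power_inject_exp by blast
  ultimately show "p = r \<and> m = n" by simp
qed

lemma summable_on_powr: "x > 1 \<Longrightarrow> (\<lambda>n. real n powr (-x)) summable_on {1..}"
proof -
  assume "x > 1"
  then have "summable (\<lambda>n. real n powr (-x))" by (simp add: summable_real_powr_iff)
  then have "(\<lambda>n. real n powr (-x)) summable_on UNIV"
    by (intro summable_nonneg_imp_summable_on) auto
  then show ?thesis by (rule summable_on_subset_banach) auto
qed

lemma summable_on_prime_powers:
  assumes "x > 1"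
  shows "(\<lambda>(p, m). real (p ^ m) powr (-x)) summable_on prime_power_index"
proof -
  have "(\<lambda>n. real n powr (-x)) summable_on ((\<lambda>(p, m). p ^ m) ` prime_power_index)"
    by (rule summable_on_subset_banach[OF summable_on_powr[OF assms]])
       (auto simp: prime_power_index_def Suc_le_eq prime_gt_0_nat)
  then have "((\<lambda>n. real n powr (-x)) \<circ> (\<lambda>(p, m). p ^ m)) summable_on prime_power_index"
    using summable_on_reindex[OF inj_on_prime_power] by blast
  then show ?thesis by (simp add: o_def case_prod_unfold)
qed

text \<open>
  The numbers that survive sieving by the primes below \<open>N\<close>. Removing the multiples of one more prime \<open>p\<close>
  multiplies the sum of a completely multiplicative function over the survivors by \<open>1 - f p\<close>, and in the
  limit only the number 1 survives; this is the Euler product.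
\<close>
definition rough :: "nat \<Rightarrow> nat set" where
  "rough N = {n. n \<ge> 1 \<and> (\<forall>p<N. prime p \<longrightarrow> \<not> p dvd n)}"

lemma rough_Suc_prime:
  assumes "prime N"
  shows "rough N = rough (Suc N) \<union> (*) N ` rough N" "rough (Suc N) \<inter> (*) N ` rough N = {}"
proof -
  have N: "N \<ge> 1" using assms prime_gt_0_nat by (simp add: Suc_le_eq)
  show "rough N = rough (Suc N) \<union> (*) N ` rough N"
  proof (intro equalityI subsetI)
    fix n assume n: "n \<in> rough N"
    show "n \<in> rough (Suc N) \<union> (*) N ` rough N"
    proof (cases "N dvd n")
      case True
      then obtain m where m: "n = N * m" by auto
      then have "m \<in> rough N" using n by (auto simp: rough_def Suc_le_eq)
      then show ?thesis using m by auto
    next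
      case False
      then show ?thesis using n by (auto simp: rough_def less_Suc_eq)
    qed
  next
    fix n assume "n \<in> rough (Suc N) \<union> (*) N ` rough N"
    then show "n \<in> rough N"
    proof
      assume "n \<in> (*) N ` rough N"
      then obtain m where m: "n = N * m" "m \<in> rough N" by auto
      have "\<not> p dvd n" if "p < N" "prime p" for p
      proof
        assume "p dvd n"
        then have "p dvd N \<or> p dvd m" using that(2) m(1) by (simp add: prime_dvd_mult_iff)
        moreover have "\<not> p dvd m" using m(2) that by (simp add: rough_def)
        moreover have "\<not> p dvd N" using primes_dvd_imp_eq[OF that(2) assms] that(1) by blast
        ultimately show False by blast
      qed
      then show ?thesis using m N by (auto simp: rough_def)
    qed (auto simp: rough_def)
  qed
  show "rough (Suc N) \<inter> (*) N ` rough N = {}" using assms by (auto simp: rough_def)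
qed

lemma rough_Suc_not_prime: "\<not> prime N \<Longrightarrow> rough (Suc N) = rough N"
  by (auto simp: rough_def less_Suc_eq)

lemma rough_subset: "rough N \<subseteq> insert 1 {N..}"
proof
  fix n assume n: "n \<in> rough N"
  show "n \<in> insert 1 {N..}"
  proof (cases "n = 1")
    case False
    then obtain p where p: "prime p" "p dvd n" using prime_factor_nat by blast
    then have "p \<ge> N" using n by (auto simp: rough_def not_less[symmetric])
    moreover have "p \<le> n" using p n by (intro dvd_imp_le) (auto simp: rough_def)
    ultimately show ?thesis by auto
  qed auto
qed

locale completely_multiplicative =
  fixes f :: "nat \<Rightarrow> complex" and x :: real
  assumes one: "f 1 = 1" and mult: "f (m * n) = f m * f n"
    and bound: "n \<ge> 1 \<Longrightarrow> norm (f n) \<le> real n powr (-x)" and x: "x > 1"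
begin

lemma abs_summable: "(\<lambda>n. norm (f n)) summable_on {1..}"
  by (rule norm_summable_on_comparison[OF summable_on_powr[OF x]]) (use bound in auto)

lemma summable: "A \<subseteq> {1..} \<Longrightarrow> f summable_on A"
  by (rule summable_on_subset_banach[OF abs_summable_summable[OF abs_summable]])

lemma power: "f (n ^ m) = f n ^ m"
  by (induction m) (simp_all add: mult one[unfolded One_nat_def])

lemma norm_prime: "prime p \<Longrightarrow> norm (f p) < 1"
proof -
  assume p: "prime p"
  have "norm (f p) \<le> real p powr (-x)" using p prime_gt_0_nat by (intro bound) (auto simp: Suc_le_eq)
  also have "\<dots> < real p powr 0" using p prime_gt_1_nat[OF p] x by (intro powr_less_mono) auto
  finally show ?thesis using p prime_gt_0_nat by simp
qed

lemma infsum_rough: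
  "infsum f (rough N) = infsum f {1..} * (\<Prod>p<N. if prime p then 1 - f p else 1)"
proof (induction N)
  case 0
  show ?case by (simp add: rough_def atLeast_def)
next
  case (Suc N)
  show ?case
  proof (cases "prime N")
    case True
    have sub: "rough M \<subseteq> {1..}" for M by (auto simp: rough_def)
    have im: "(*) N ` rough N \<subseteq> {1..}"
      using True prime_gt_0_nat by (auto simp: rough_def Suc_le_eq)
    have "infsum f (rough N) = infsum f (rough (Suc N)) + infsum f ((*) N ` rough N)"
      using rough_Suc_prime[OF True] infsum_Un_disjoint[OF summable[OF sub] summable[OF im]] by metis
    also have "infsum f ((*) N ` rough N) = infsum (f \<circ> (*) N) (rough N)"
      by (rule infsum_reindex) (use True prime_gt_0_nat in \<open>auto simp: inj_on_def\<close>)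
    also have "\<dots> = f N * infsum f (rough N)"
      by (simp add: o_def mult infsum_cmult_right')
    finally have eq: "infsum f (rough N) = infsum f (rough (Suc N)) + f N * infsum f (rough N)" .
    have "a = b * (1 - c)" if "b = a + c * b" for a b c :: complex
      using that by (simp add: algebra_simps)
    from this[OF eq] show ?thesis by (simp add: Suc True)
  next
    case False
    then show ?thesis using Suc rough_Suc_not_prime by simp
  qed
qed

lemma infsum_rough_tendsto: "(\<lambda>N. infsum f (rough N)) \<longlonglongrightarrow> 1"
proof -
  define g where "g n = (if n = 0 then 0 else norm (f n))" for n
  have "(g has_sum infsum (\<lambda>n. norm (f n)) {1..}) UNIV"
    using abs_summable by (subst has_sum_cong_neutral[where g = "\<lambda>n. norm (f n)" and T = "{1..}"])
      (auto simp: g_def)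
  then have gs: "g sums infsum (\<lambda>n. norm (f n)) {1..}" by (rule has_sum_imp_sums)
  then have gsm: "summable g" by (rule sums_summable)
  have le: "norm (infsum f (rough N) - 1) \<le> (\<Sum>n. g (n + N))" if N: "N \<ge> 2" for N
  proof -
    have 1: "rough N = {1} \<union> (rough N - {1})" using N
      by (auto simp: rough_def dest: prime_gt_1_nat)
    have "infsum f (rough N) = infsum f {1} + infsum f (rough N - {1})"
      by (subst 1, rule infsum_Un_disjoint) (auto intro!: summable simp: rough_def)
    then have "infsum f (rough N) - 1 = infsum f (rough N - {1})" using one by simp
    also have "norm \<dots> \<le> infsum (\<lambda>n. norm (f n)) (rough N - {1})"
      by (rule norm_infsum_bound, rule summable_on_subset_banach[OF abs_summable]) (auto simp: rough_def)
    also have "\<dots> \<le> infsum (\<lambda>n. norm (f n)) {N..}"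
    proof (rule infsum_mono2)
      show "(\<lambda>n. norm (f n)) summable_on rough N - {1}"
        by (rule summable_on_subset_banach[OF abs_summable]) (auto simp: rough_def)
      show "(\<lambda>n. norm (f n)) summable_on {N..}"
        by (rule summable_on_subset_banach[OF abs_summable]) (use N in auto)
    qed (use rough_subset in auto)
    also have "{N..} = (\<lambda>n. n + N) ` UNIV"
    proof (intro equalityI subsetI)
      fix n assume "n \<in> {N..}"
      then show "n \<in> (\<lambda>n. n + N) ` UNIV" by (intro image_eqI[of _ _ "n - N"]) auto
    qed auto
    also have "infsum (\<lambda>n. norm (f n)) ((\<lambda>n. n + N) ` UNIV) = infsum ((\<lambda>n. norm (f n)) \<circ> (\<lambda>n. n + N)) UNIV"
      by (rule infsum_reindex) auto
    also have "\<dots> = infsum (\<lambda>n. g (n + N)) UNIV"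
      by (rule infsum_cong) (use N in \<open>auto simp: g_def\<close>)
    also have "\<dots> = (\<Sum>n. g (n + N))"
    proof -
      have "summable (\<lambda>n. g (n + N))" using gsm by (simp add: summable_iff_shift)
      then have "((\<lambda>n. g (n + N)) has_sum (\<Sum>n. g (n + N))) UNIV"
        by (intro sums_nonneg_imp_has_sum) (auto simp: g_def summable_sums)
      then show ?thesis by (rule infsumI)
    qed
    finally show ?thesis .
  qed
  have "(\<lambda>N. infsum f (rough N) - 1) \<longlonglongrightarrow> 0"
  proof (rule Lim_null_comparison)
    show "\<forall>\<^sub>F N in sequentially. norm (infsum f (rough N) - 1) \<le> (\<Sum>n. g (n + N))"
      using eventually_ge_at_top[of 2] by eventually_elim (rule le)
    show "(\<lambda>N. \<Sum>n. g (n + N)) \<longlonglongrightarrow> 0" by (rule suminf_exist_split2[OF gsm])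
  qed
  then show ?thesis by (rule LIM_zero_cancel)
qed

lemma log_euler_term_bound:
  assumes "(p, m) \<in> prime_power_index"
  shows "norm (f p ^ m / of_nat m) \<le> real (p ^ m) powr (-x)"
proof -
  have "m \<ge> 1" "p ^ m \<ge> 1" using assms by (auto simp: prime_power_index_def Suc_le_eq prime_gt_0_nat)
  have "norm (f p ^ m / of_nat m) = norm (f (p ^ m)) / real m" by (simp add: power norm_divide)
  also have "\<dots> \<le> norm (f (p ^ m)) / 1" using \<open>m \<ge> 1\<close> by (intro divide_left_mono) auto
  also have "\<dots> \<le> real (p ^ m) powr (-x)" using bound[OF \<open>p ^ m \<ge> 1\<close>] by simp
  finally show ?thesis .
qed

lemma log_euler_abs_summable:
  "(\<lambda>i. norm (case i of (p, m) \<Rightarrow> f p ^ m / of_nat m)) summable_on prime_power_index"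
  by (rule norm_summable_on_comparison[OF summable_on_prime_powers[OF x]])
     (use log_euler_term_bound in auto)

text \<open>
  For each prime the inner sum over \<open>m\<close> is \<open>- Ln (1 - f p)\<close>. Hence \<open>exp (- log_euler f)\<close> is the limit of the
  products of \<open>1 - f p\<close> over \<open>p < N\<close>, and by the sieve these products times the full sum tend to 1.
\<close>
theorem exp_log_euler: "exp (log_euler f) = infsum f {1..}"
proof -
  have inner: "infsum (\<lambda>m. f p ^ m / of_nat m) {1..} = - Ln (1 - f p)" if p: "prime p" for p
  proof -
    let ?z = "f p"
    have "(\<lambda>n. (-1) ^ Suc n / of_nat n * (-?z) ^ n) sums Ln (1 + (-?z))"
      by (rule Ln_series) (use norm_prime[OF p] in simp)
    then have "(\<lambda>n. - ((-1) ^ Suc n / of_nat n * (-?z) ^ n)) sums - Ln (1 - ?z)"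
      using sums_minus by fastforce
    moreover have "- ((-1) ^ Suc n / of_nat n * (-?z) ^ n) = ?z ^ n / of_nat n" for n
    proof -
      have "(-?z) ^ n = (-1) ^ n * ?z ^ n" by (rule power_minus)
      then show ?thesis by (simp add: power_mult_distrib[symmetric] mult.assoc[symmetric])
    qed
    ultimately have s: "(\<lambda>n. ?z ^ n / of_nat n) sums - Ln (1 - ?z)" by (simp only:)
    have "summable (\<lambda>n. norm (?z ^ n / of_nat n))"
    proof (rule summable_comparison_test'[where N = 1])
      show "summable (\<lambda>n. norm ?z ^ n)" using norm_prime[OF p] by (intro summable_geometric) auto
      show "norm (norm (?z ^ n / of_nat n)) \<le> norm ?z ^ n" if "n \<ge> 1" for n
      proof -
        have "norm ?z ^ n / real n \<le> norm ?z ^ n / 1" using that by (intro divide_left_mono) auto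
        then show ?thesis by (simp add: norm_divide norm_power)
      qed
    qed
    then have "((\<lambda>n. ?z ^ n / of_nat n) has_sum - Ln (1 - ?z)) UNIV"
      using s by (rule norm_summable_imp_has_sum)
    then have "((\<lambda>n. ?z ^ n / of_nat n) has_sum - Ln (1 - ?z)) {1..}"
      by (subst has_sum_cong_neutral[where T = UNIV and g = "\<lambda>n. ?z ^ n / of_nat n"]) auto
    then show ?thesis by (rule infsumI)
  qed
  have sm: "(\<lambda>(p, m). f p ^ m / of_nat m) summable_on ({p. prime p} \<times> {1..})"
    using abs_summable_summable[OF log_euler_abs_summable] by (simp add: prime_power_index_def)
  have "log_euler f = (\<Sum>\<^sub>\<infinity>p\<in>{p. prime p}. \<Sum>\<^sub>\<infinity>m\<in>{1..}. f p ^ m / of_nat m)"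
    unfolding log_euler_def prime_power_index_def
    by (rule infsum_Sigma'_banach[OF sm, symmetric])
  also have "\<dots> = (\<Sum>\<^sub>\<infinity>p\<in>{p. prime p}. - Ln (1 - f p))"
    by (rule infsum_cong) (simp add: inner del: One_nat_def)
  finally have ell: "log_euler f = (\<Sum>\<^sub>\<infinity>p\<in>{p. prime p}. - Ln (1 - f p))" .
  have "(\<lambda>p. \<Sum>\<^sub>\<infinity>m\<in>{1..}. f p ^ m / of_nat m) summable_on {p. prime p}"
    by (rule summable_on_Sigma_banach[OF sm])
  then have "(\<lambda>p. - Ln (1 - f p)) summable_on {p. prime p}"
    by (subst summable_on_cong[where g = "\<lambda>p. \<Sum>\<^sub>\<infinity>m\<in>{1..}. f p ^ m / of_nat m"]) (simp_all add: inner del: One_nat_def)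
  then have "((\<lambda>p. - Ln (1 - f p)) has_sum log_euler f) {p. prime p}"
    using ell by simp
  then have "((\<lambda>p. if prime p then - Ln (1 - f p) else 0) has_sum log_euler f) UNIV"
    by (subst has_sum_cong_neutral[where T = "{p. prime p}" and g = "\<lambda>p. - Ln (1 - f p)"]) auto
  then have lim: "(\<lambda>N. \<Sum>p<N. if prime p then - Ln (1 - f p) else 0) \<longlonglongrightarrow> log_euler f"
    unfolding sums_def[symmetric] by (rule has_sum_imp_sums)
  have eq: "exp (- (\<Sum>p<N. if prime p then - Ln (1 - f p) else 0)) = (\<Prod>p<N. if prime p then 1 - f p else 1)" for N
  proof -
    have "exp (- (\<Sum>p<N. if prime p then - Ln (1 - f p) else 0)) = (\<Prod>p<N. exp (if prime p then Ln (1 - f p) else 0))"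
      by (subst exp_sum[symmetric])
         (auto simp: sum_negf[symmetric] intro!: sum.cong arg_cong[where f = exp])
    also have "\<dots> = (\<Prod>p<N. if prime p then 1 - f p else 1)"
    proof (rule prod.cong)
      fix p
      show "exp (if prime p then Ln (1 - f p) else 0) = (if prime p then 1 - f p else 1)"
      proof (cases "prime p")
        case True
        then have "f p \<noteq> 1" using norm_prime[of p] by auto
        then show ?thesis by simp
      qed auto
    qed simp
    finally show ?thesis .
  qed
  have "(\<lambda>N. infsum f {1..} * exp (- (\<Sum>p<N. if prime p then - Ln (1 - f p) else 0)))
     \<longlonglongrightarrow> infsum f {1..} * exp (- log_euler f)"
    by (intro tendsto_intros lim)
  moreover have "(\<lambda>N. infsum f {1..} * exp (- (\<Sum>p<N. if prime p then - Ln (1 - f p) else 0))) \<longlonglongrightarrow> 1"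
    using infsum_rough_tendsto by (simp only: eq infsum_rough)
  ultimately have "infsum f {1..} * exp (- log_euler f) = 1" by (rule LIMSEQ_unique)
  then show ?thesis by (simp add: exp_minus field_simps)
qed

lemma sums_infsum: "(\<lambda>n. f (Suc n)) sums infsum f {1..}"
proof -
  have "(f has_sum infsum f {1..}) {1..}" using summable[of "{1..}"] by simp
  moreover have "{1..} = Suc ` UNIV" by (auto simp: image_iff Suc_le_eq gr0_conv_Suc)
  ultimately have "(f has_sum infsum f {1..}) (Suc ` UNIV)" by simp
  then have "((f \<circ> Suc) has_sum infsum f {1..}) UNIV"
    by (subst (asm) has_sum_reindex) auto
  then show ?thesis unfolding o_def by (rule has_sum_imp_sums)
qed

end

section \<open>Non-principal characters\<close>

text \<open>
  The quotient is the integral of \<open>z powr (-s)\<close> over \<open>[n, n + 1]\<close>; its integrand differs from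
  \<open>n powr (-s)\<close> by \<open>powr_neg_diff_bound\<close>. The proof applies the mean value inequality to an antiderivative
  of the difference.
\<close>
lemma zeta_term_bound:
  assumes n: "n \<ge> 1" and s: "Re s > 0" "s \<noteq> 1"
  shows "norm (of_real n powr (-s) - (of_real n powr (1 - s) - of_real (n + 1) powr (1 - s)) / (s - 1))
           \<le> norm s * n powr (- Re s - 1)"
proof -
  define S where "S = closed_segment (of_real n :: complex) (of_real (n + 1))"
  define G where "G z = z * of_real n powr (-s) - z powr (1 - s) / (1 - s)" for z :: complex
  have S: "\<exists>x. z = of_real x \<and> x \<ge> n \<and> x \<le> n + 1" if "z \<in> S" for z
    using that closed_segment_of_realE[of z n "n + 1"] unfolding S_def by (metis less_add_one less_imp_le)
  have "norm (G (of_real (n + 1)) - G (of_real n))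
     \<le> (norm s * n powr (- Re s - 1)) * norm ((of_real (n + 1) :: complex) - of_real n)"
  proof (rule field_differentiable_bound[of S G "\<lambda>z. of_real n powr (-s) - z powr (-s)"])
    show "convex S" by (simp add: S_def)
  next
    fix z assume "z \<in> S"
    then obtain x where x: "z = of_real x" "x \<ge> n" "x \<le> n + 1" using S by blast
    then have nz: "z \<notin> \<real>\<^sub>\<le>\<^sub>0" using n by auto
    have s1: "1 - s \<noteq> 0" using s by auto
    have s2: "1 - s - 1 = -s" by simp
    have "((\<lambda>z. z * of_real n powr (-s) - z powr (1 - s) / (1 - s)) has_field_derivative
       1 * of_real n powr (-s) - ((1 - s) * z powr (1 - s - 1)) / (1 - s)) (at z within S)"
      by (rule DERIV_diff[OF DERIV_cmult_right[OF DERIV_ident]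
            DERIV_cdivide[OF has_field_derivative_at_within[OF has_field_derivative_powr[OF nz]]]])
    then show "(G has_field_derivative of_real n powr (-s) - z powr (-s)) (at z within S)"
      unfolding G_def mult_1 nonzero_mult_div_cancel_left[OF s1] s2 .
    have "norm (of_real n powr (-s) - z powr (-s)) \<le> norm s * n powr (- Re s - 1) * (x - n)"
      unfolding x(1) by (rule powr_neg_diff_bound) (use x n s in auto)
    also have "\<dots> \<le> norm s * n powr (- Re s - 1) * 1" using x by (intro mult_left_mono) auto
    finally show "norm (of_real n powr (-s) - z powr (-s)) \<le> norm s * n powr (- Re s - 1)" by simp
  qed (auto simp: S_def)
  moreover have "(of_real (n + 1) :: complex) - of_real n = 1" by simp
  moreover have "G (of_real (n + 1)) - G (of_real n)
    = of_real n powr (-s) - (of_real n powr (1 - s) - of_real (n + 1) powr (1 - s)) / (s - 1)"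
  proof -
    have "A * (1 + n') - B / (1 - s) - (n' * A - C / (1 - s)) = A - (C - B) / (s - 1)" for A B C n' :: complex
    proof -
      have "1 - s \<noteq> 0" "s - 1 \<noteq> 0" using s by auto
      then show ?thesis by (simp add: divide_simps) (simp add: algebra_simps)
    qed
    from this[of "of_real n powr (-s)" "of_real n"] show ?thesis unfolding G_def by (simp add: mult_ac add_ac)
  qed
  ultimately show ?thesis by simp
qed

text \<open>
  The Riemann zeta function on its half-plane of convergence \<open>Re s > 1\<close>, which is the only region where it
  is considered.
\<close>
definition zeta :: "complex \<Rightarrow> complex" where
  "zeta s = (\<Sum>n. of_nat (Suc n) powr (-s))"

lemma zeta_sums:
  assumes "Re s > 1"
  shows "(\<lambda>n. of_nat (Suc n) powr (-s)) sums zeta s"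
  unfolding zeta_def
proof (rule summable_sums, rule summable_comparison_test'[where N = 0])
  show "summable (\<lambda>n. real (Suc n) powr (- Re s))" by (rule summable_Suc_powr[OF assms])
  show "norm (of_nat (Suc n) powr (-s)) \<le> real (Suc n) powr (- Re s)" for n
    unfolding norm_nat_powr by simp
qed

text \<open>
  Comparison of the sum with the integral from 1 to \<open>\<infinity>\<close>, whose value is \<open>1 / (s - 1)\<close>.
\<close>
lemma zeta_pole_bound:
  assumes s: "Re s > 1"
  shows "norm (zeta s - 1 / (s - 1)) \<le> norm s * (\<Sum>n. real (Suc n) powr (-2))"
proof -
  have s1: "s \<noteq> 1" using s by auto
  define g where "g n = (of_nat (Suc n) powr (1 - s) :: complex)" for n
  have "(\<lambda>n. g n) \<longlonglongrightarrow> 0"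
  proof (rule Lim_null_comparison)
    show "\<forall>\<^sub>F n in sequentially. norm (g n) \<le> real (Suc n) powr (1 - Re s)"
      unfolding g_def norm_nat_powr by simp
    show "(\<lambda>n. real (Suc n) powr (1 - Re s)) \<longlonglongrightarrow> 0"
      by (rule tendsto_neg_powr[OF _ filterlim_compose[OF filterlim_real_sequentially filterlim_Suc]])
         (use s in auto)
  qed
  then have "(\<lambda>n. g n - g (Suc n)) sums (g 0 - 0)" by (rule telescope_sums')
  then have "(\<lambda>n. (g n - g (Suc n)) / (s - 1)) sums (1 / (s - 1))"
    using sums_divide[of _ "1" "s - 1"] by (simp add: g_def)
  with zeta_sums[OF s] have sums: "(\<lambda>n. of_nat (Suc n) powr (-s) - (g n - g (Suc n)) / (s - 1)) sums
      (zeta s - 1 / (s - 1))"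
    by (rule sums_diff)
  have sm: "summable (\<lambda>n. real (Suc n) powr (-2))" by (rule summable_Suc_powr) auto
  have "norm (\<Sum>n. of_nat (Suc n) powr (-s) - (g n - g (Suc n)) / (s - 1))
      \<le> (\<Sum>n. norm s * real (Suc n) powr (-2))"
  proof (rule norm_suminf_le)
    fix n
    have "norm (of_real (real (Suc n)) powr (-s) - (of_real (real (Suc n)) powr (1 - s)
             - of_real (real (Suc n) + 1) powr (1 - s)) / (s - 1)) \<le> norm s * real (Suc n) powr (- Re s - 1)"
      by (rule zeta_term_bound) (use s s1 in auto)
    also have "\<dots> \<le> norm s * real (Suc n) powr (-2)"
      using s by (intro mult_left_mono powr_mono) auto
    finally show "norm (of_nat (Suc n) powr (-s) - (g n - g (Suc n)) / (s - 1)) \<le> norm s * real (Suc n) powr (-2)"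
      by (simp add: g_def add_ac)
  next
    show "summable (\<lambda>n. norm s * real (Suc n) powr (-2))" by (rule summable_mult[OF sm])
  qed
  also have "\<dots> = norm s * (\<Sum>n. real (Suc n) powr (-2))" by (rule suminf_mult[OF sm])
  finally show ?thesis using sums_unique[OF sums] by simp
qed

lemma completely_multiplicative_twist:
  assumes "\<psi> 1 = 1" "\<And>m n. \<psi> (m * n) = \<psi> m * \<psi> n" "\<And>n. norm (\<psi> n) \<le> 1" "Re s > 1"
  shows "completely_multiplicative (\<lambda>n. \<psi> n * of_nat n powr (-s)) (Re s)"
proof
  fix m n :: nat
  have "(of_nat (m * n) :: complex) powr (-s) = of_nat m powr (-s) * of_nat n powr (-s)"
    by (simp add: powr_times_real)
  then show "\<psi> (m * n) * of_nat (m * n) powr (-s) = \<psi> m * of_nat m powr (-s) * (\<psi> n * of_nat n powr (-s))"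
    by (simp add: assms(2) mult_ac)
next
  fix n :: nat assume "n \<ge> 1"
  then obtain k where k: "n = Suc k" by (cases n) auto
  have "norm (\<psi> n * of_nat n powr (-s)) = norm (\<psi> n) * real n powr (- Re s)"
    unfolding norm_mult k norm_nat_powr by simp
  also have "\<dots> \<le> 1 * real n powr (- Re s)" using assms(3) by (intro mult_right_mono) auto
  finally show "norm (\<psi> n * of_nat n powr (-s)) \<le> real n powr (- Re s)" by simp
qed (use assms in auto)

text \<open>
  The inequality \<open>3 + 4 cos \<theta> + cos (2 \<theta>) = 2 (1 + cos \<theta>)\<^sup>2 \<ge> 0\<close>. The case \<open>w = 0\<close> is that of a prime
  dividing the modulus.
\<close>
lemma trig_nonneg:
  assumes "norm w = 1 \<or> w = 0"
  shows "Re (3 + 4 * w + w\<^sup>2) \<ge> 0"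
proof (cases "w = 0")
  case False
  then have "(Re w)\<^sup>2 + (Im w)\<^sup>2 = 1" using assms by (simp add: cmod_power2[symmetric])
  then have "Re (3 + 4 * w + w\<^sup>2) = 2 * (1 + Re w)\<^sup>2"
    by (simp add: power2_eq_square algebra_simps)
  then show ?thesis by simp
qed auto

locale nonprincipal_character =
  fixes q :: nat and chi :: "nat \<Rightarrow> complex"
  assumes character: "dirichlet_character q chi" and nonprincipal: "chi \<noteq> principal_character q"
begin

lemma q_pos: "q > 0" using character by (simp add: dirichlet_character_def)
lemma chi_mult: "chi (m * n) = chi m * chi n" using character by (simp add: dirichlet_character_def)
lemma chi_nz: "chi n \<noteq> 0 \<longleftrightarrow> coprime n q" using character by (simp add: dirichlet_character_def)
lemma chi_periodic: "chi (n + q) = chi n" using character by (simp add: dirichlet_character_def)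

lemma chi_one: "chi 1 = 1"
  using chi_mult[of 1 1] chi_nz[of 1] by auto

lemma chi_power: "chi (n ^ k) = chi n ^ k"
  by (induction k) (use chi_one in \<open>auto simp: chi_mult\<close>)

lemma chi_mod: "chi (n mod q) = chi n"
proof -
  have "chi (a + b * q) = chi a" for a b
  proof (induction b)
    case (Suc b)
    have "a + Suc b * q = (a + b * q) + q" by simp
    then show ?case using Suc chi_periodic by metis
  qed auto
  from this[of "n mod q" "n div q"] show ?thesis by simp
qed

lemma norm_chi: "norm (chi n) = 1 \<or> chi n = 0"
proof (cases "coprime n q")
  case True
  then have "[n ^ totient q = 1] (mod q)" by (rule euler_theorem)
  then have "chi (n ^ totient q) = chi 1" using chi_mod unfolding cong_def by metis
  then have "norm (chi n) ^ totient q = 1" by (simp add: chi_power chi_one[unfolded One_nat_def] flip: norm_power)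
  moreover have "totient q > 0" using q_pos by simp
  ultimately have "norm (chi n) = 1"
    using power_eq_imp_eq_base[of "norm (chi n)" "totient q" 1] by auto
  then show ?thesis ..
qed (use chi_nz in auto)

lemma norm_chi_le: "norm (chi n) \<le> 1" using norm_chi[of n] by auto

text \<open>
  Multiplication by a residue \<open>b\<close> with \<open>chi b \<noteq> 1\<close> permutes the residues and multiplies the sum by \<open>chi b\<close>.
\<close>
lemma sum_period: "(\<Sum>n<q. chi n) = 0"
proof -
  obtain b where b: "chi b \<noteq> principal_character q b" using nonprincipal by auto
  then have cop: "coprime b q" using chi_nz by (auto simp: principal_character_def split: if_splits)
  then have b1: "chi b \<noteq> 1" using b by (simp add: principal_character_def)
  have "bij_betw (\<lambda>n. b * n mod q) {..<q} {..<q}"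
    unfolding bij_betw_def
  proof
    show inj: "inj_on (\<lambda>n. b * n mod q) {..<q}"
    proof (rule inj_onI)
      fix m n assume mn: "m \<in> {..<q}" "n \<in> {..<q}" "b * m mod q = b * n mod q"
      then have "[b * m = b * n] (mod q)" by (simp add: cong_def)
      then have "[m = n] (mod q)" using cop by (simp add: cong_mult_lcancel_nat coprime_commute)
      then show "m = n" using mn by (simp add: cong_def)
    qed
    show "(\<lambda>n. b * n mod q) ` {..<q} = {..<q}"
      by (rule endo_inj_surj) (use inj q_pos in auto)
  qed
  then have "(\<Sum>n<q. chi n) = (\<Sum>n<q. chi (b * n mod q))"
    by (rule sum.reindex_bij_betw[symmetric])
  also have "\<dots> = chi b * (\<Sum>n<q. chi n)" by (simp add: chi_mod chi_mult sum_distrib_left)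
  finally show ?thesis using b1 by simp
qed

lemma partial_sums_bounded: "norm (\<Sum>i<N. chi (Suc i)) \<le> real q"
proof -
  have "(\<Sum>i<q. chi (Suc i)) = (\<Sum>i<Suc q. chi i) - chi 0"
    by (simp only: sum.lessThan_Suc_shift) simp
  also have "\<dots> = 0" using chi_periodic[of 0] by (simp add: sum_period)
  finally have "norm (\<Sum>i<N. chi (Suc i)) \<le> (\<Sum>i<q. norm (chi (Suc i)))"
    using chi_periodic[of "Suc _"] by (intro periodic_partial_sums_bounded) (auto simp: q_pos)
  also have "\<dots> \<le> (\<Sum>i<q. 1)" by (intro sum_mono norm_chi_le)
  finally show ?thesis by simp
qed

text \<open>
  A form of \<open>L(s, chi)\<close> that is defined by a convergent series for \<open>Re s > 0\<close>.
\<close>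
definition L :: "complex \<Rightarrow> complex" where "L = abel_series (\<lambda>n. chi (Suc n))"

lemma L_holomorphic: "L holomorphic_on {s. Re s > 0}"
  unfolding L_def by (rule abel_series_holomorphic[OF partial_sums_bounded])

lemma L_sums: "Re s > 0 \<Longrightarrow> (\<lambda>n. chi (Suc n) * of_nat (Suc n) powr (-s)) sums L s"
  unfolding L_def by (rule abel_series_sums[OF partial_sums_bounded])

lemma dirichlet_L_eq: "Re s > 0 \<Longrightarrow> dirichlet_L chi s = L s"
proof (rule dirichlet_L_eqI[where c = 0])
  show "L holomorphic_on {z. Re z > 0}" by (rule L_holomorphic)
  show "(\<lambda>n. chi (Suc n) / of_nat (Suc n) powr z) sums L z" if "Re z > 1" for z
    using L_sums[of z] that by (simp add: powr_minus divide_inverse)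
qed auto

text \<open>
  The abscissa \<open>1/20\<close> lies between 0 and the leftmost point of the circle of radius \<open>19/10\<close> about
  \<open>2 + it\<close>, on which the bound is applied.
\<close>
lemma L_bound:
  obtains B where "B > 0" "\<And>s. Re s \<ge> 1/20 \<Longrightarrow> norm (L s) \<le> B * norm s"
proof -
  have S: "0 \<le> (\<Sum>n. real (Suc n) powr (-(1/20 + 1)))"
    by (intro suminf_nonneg summable_Suc_powr) auto
  define B where "B = real q * (\<Sum>n. real (Suc n) powr (-(1/20 + 1))) + 1"
  have "norm (L s) \<le> B * norm s" if "Re s \<ge> 1/20" for s
  proof -
    have "norm (L s) \<le> real q * (\<Sum>n. real (Suc n) powr (-(1/20 + 1))) * norm s"
      unfolding L_def by (rule abel_series_bound[OF partial_sums_bounded that]) auto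
    also have "\<dots> \<le> B * norm s" unfolding B_def by (intro mult_right_mono) auto
    finally show ?thesis .
  qed
  moreover have "B > 0" unfolding B_def using S by (intro add_nonneg_pos mult_nonneg_nonneg) auto
  ultimately show ?thesis using that by blast
qed

definition log_series :: "complex \<Rightarrow> complex" where
  "log_series s = log_euler (\<lambda>n. chi n * of_nat n powr (-s))"

lemma twisted: "Re s > 1 \<Longrightarrow> completely_multiplicative (\<lambda>n. chi n * of_nat n powr (-s)) (Re s)"
  by (rule completely_multiplicative_twist[OF chi_one chi_mult norm_chi_le])

lemma exp_log_series: "Re s > 1 \<Longrightarrow> exp (log_series s) = L s"
proof -
  assume s: "Re s > 1"
  interpret cm: completely_multiplicative "\<lambda>n. chi n * of_nat n powr (-s)" "Re s"
    by (rule twisted[OF s])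
  have "L s = infsum (\<lambda>n. chi n * of_nat n powr (-s)) {1..}"
    by (rule sums_unique2[OF L_sums cm.sums_infsum]) (use s in auto)
  then show ?thesis unfolding log_series_def cm.exp_log_euler ..
qed

text \<open>
  The logarithm of the right hand side is the sum over the prime powers of the real parts of
  \<open>3 + 4 w + w\<^sup>2\<close> with positive weights, where \<open>w = (chi p / p powr (it))\<^sup>m\<close>.
\<close>
lemma three_four_one:
  assumes "\<sigma> > 1"
  shows "1 \<le> norm (zeta (of_real \<sigma>)) ^ 3 * norm (L (Complex \<sigma> t)) ^ 4
     * norm (\<Sum>n. chi (Suc n) ^ 2 * of_nat (Suc n) powr (- Complex \<sigma> (2 * t)))"
proof -
  \<comment> \<open>The coefficients of zeta at \<open>\<sigma>\<close>, of \<open>L(s, chi)\<close> at \<open>\<sigma> + it\<close> and of \<open>L(s, chi\<^sup>2)\<close> at \<open>\<sigma> + 2it\<close>.\<close>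
  define f0 where "f0 n = 1 * of_nat n powr (- complex_of_real \<sigma>)" for n :: nat
  define f1 where "f1 n = chi n * of_nat n powr (- Complex \<sigma> t)" for n :: nat
  define f2 where "f2 n = chi n ^ 2 * of_nat n powr (- Complex \<sigma> (2 * t))" for n :: nat
  have "completely_multiplicative f0 (Re (of_real \<sigma>))" unfolding f0_def
    by (rule completely_multiplicative_twist[of "\<lambda>_. 1"]) (use assms in auto)
  then interpret c0: completely_multiplicative f0 \<sigma> by simp
  have "completely_multiplicative f1 (Re (Complex \<sigma> t))" unfolding f1_def
    by (rule twisted) (use assms in auto)
  then interpret c1: completely_multiplicative f1 \<sigma> by simp
  have "completely_multiplicative f2 (Re (Complex \<sigma> (2 * t)))" unfolding f2_def
    by (rule completely_multiplicative_twist)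
       (use assms chi_one norm_chi_le in \<open>auto simp: chi_mult power_mult_distrib norm_power power_le_one\<close>)
  then interpret c2: completely_multiplicative f2 \<sigma> by simp
  let ?t = "\<lambda>f (p, m). f p ^ m / of_nat m :: complex"
  have h: "((\<lambda>i. Re (?t f i)) has_sum Re (log_euler f)) prime_power_index"
    if "completely_multiplicative f \<sigma>" for f
  proof -
    interpret completely_multiplicative f \<sigma> by fact
    have "(?t f has_sum log_euler f) prime_power_index"
      unfolding log_euler_def using abs_summable_summable[OF log_euler_abs_summable] by simp
    then show ?thesis by (rule has_sum_Re)
  qed
  have hs: "((\<lambda>i. 3 * Re (?t f0 i) + 4 * Re (?t f1 i) + Re (?t f2 i)) has_sum
      (3 * Re (log_euler f0) + 4 * Re (log_euler f1) + Re (log_euler f2))) prime_power_index"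
    by (intro has_sum_add has_sum_cmult_right h c0.completely_multiplicative_axioms
        c1.completely_multiplicative_axioms c2.completely_multiplicative_axioms)
  have pos: "3 * Re (?t f0 i) + 4 * Re (?t f1 i) + Re (?t f2 i) \<ge> 0"
    if "i \<in> prime_power_index" for i
  proof -
    obtain p m where i: "i = (p, m)" by force
    have p: "prime p" "m \<ge> 1" using that by (auto simp: i prime_power_index_def)
    define r where "r = real p powr (- \<sigma>)"
    define z where "z = chi p * of_nat p powr (- (\<i> * t))"
    have p0: "of_nat p \<noteq> (0::complex)" using p by auto
    have f0: "f0 p = of_real r"
      using powr_of_real[of "real p" "-\<sigma>"] by (simp add: f0_def r_def)
    have e1: "- Complex \<sigma> t = - of_real \<sigma> + (- (\<i> * t))" by (simp add: complex_eq_iff)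
    have e2: "- Complex \<sigma> (2 * t) = - of_real \<sigma> + ((- (\<i> * t)) + (- (\<i> * t)))" by (simp add: complex_eq_iff)
    have f1: "f1 p = of_real r * z"
      using f0 unfolding f1_def f0_def z_def e1 powr_add by simp
    have f2: "f2 p = of_real r * z ^ 2"
      using f0 unfolding f2_def f0_def z_def e2 powr_add by (simp add: power2_eq_square)
    have "norm ((of_nat p :: complex) powr (- (\<i> * t))) = 1"
      using p prime_gt_0_nat[of p] norm_nat_powr[of "p - 1" "- (\<i> * t)"] by simp
    then have z: "norm z = 1 \<or> z = 0" using norm_chi[of p] by (auto simp: z_def norm_mult)
    then have w: "norm (z ^ m) = 1 \<or> z ^ m = 0" using p(2) by (auto simp: norm_power)
    have Re_of_real_times: "Re (of_real x * y) = x * Re y" for x y by simp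
    have "3 * Re (?t f0 i) + 4 * Re (?t f1 i) + Re (?t f2 i)
        = Re (3 * (?t f0 i) + 4 * (?t f1 i) + (?t f2 i))" by simp
    also have "3 * (?t f0 i) + 4 * (?t f1 i) + (?t f2 i)
        = of_real (r ^ m / m) * (3 + 4 * z ^ m + (z ^ m)\<^sup>2)"
      by (simp add: i f0 f1 f2 power_mult_distrib add_divide_distrib distrib_left mult_ac flip: power_mult)
    also have "Re \<dots> = (r ^ m / m) * Re (3 + 4 * z ^ m + (z ^ m)\<^sup>2)"
      by (rule Re_of_real_times)
    also have "\<dots> \<ge> 0" using trig_nonneg[OF w] by (intro mult_nonneg_nonneg) (auto simp: r_def)
    finally show ?thesis .
  qed
  have nn: "3 * Re (log_euler f0) + 4 * Re (log_euler f1) + Re (log_euler f2) \<ge> 0"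
    by (rule has_sum_nonneg[OF hs pos])
  have "1 \<le> exp (3 * Re (log_euler f0) + 4 * Re (log_euler f1) + Re (log_euler f2))"
    using nn by simp
  also have "\<dots> = norm (exp (log_euler f0)) ^ 3 * norm (exp (log_euler f1)) ^ 4 * norm (exp (log_euler f2))"
    unfolding exp_add norm_exp_eq_Re
    using exp_of_nat_mult[of 3 "Re (log_euler f0)"] exp_of_nat_mult[of 4 "Re (log_euler f1)"] by simp
  also have "exp (log_euler f0) = zeta (of_real \<sigma>)"
    unfolding c0.exp_log_euler
    by (rule sums_unique2[OF c0.sums_infsum]) (use zeta_sums[of "of_real \<sigma>"] assms in \<open>simp add: f0_def\<close>)
  also have "exp (log_euler f1) = L (Complex \<sigma> t)"
    unfolding c1.exp_log_euler
    by (rule sums_unique2[OF c1.sums_infsum]) (use L_sums[of "Complex \<sigma> t"] assms in \<open>simp add: f1_def\<close>)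
  also have "exp (log_euler f2) = (\<Sum>n. chi (Suc n) ^ 2 * of_nat (Suc n) powr (- Complex \<sigma> (2 * t)))"
    using sums_unique[OF c2.sums_infsum] unfolding c2.exp_log_euler by (simp add: f2_def)
  finally show ?thesis .
qed

text \<open>
  If \<open>L\<close> vanishes at \<open>1 + it\<close>, then at \<open>\<sigma> = 1 + \<epsilon>\<close> the three factors of \<open>three_four_one\<close> are
  \<open>O(\<epsilon> powr (-3))\<close>, \<open>O(\<epsilon>\<^sup>4)\<close> and \<open>O(1)\<close>, and their product tends to 0.
\<close>
lemma L_nonzero_on_one_line:
  assumes t: "t \<noteq> 0"
  shows "L (Complex 1 t) \<noteq> 0"
proof
  assume zero: "L (Complex 1 t) = 0"
  \<comment> \<open>The square of \<open>chi\<close> may be principal. Subtracting its mean \<open>\<mu>\<close> leaves bounded partial sums, and the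
    remaining \<open>\<mu> * zeta\<close> is bounded near \<open>1 + 2it\<close> since \<open>t \<noteq> 0\<close>.\<close>
  define \<mu> where "\<mu> = (\<Sum>n<q. chi (Suc n) ^ 2) / of_nat q"
  define a where "a n = chi (Suc n) ^ 2 - \<mu>" for n
  define A where "A = (\<Sum>i<q. norm (a i))"
  have "(\<Sum>n<q. a n) = 0" using q_pos by (simp add: a_def sum_subtractf \<mu>_def)
  then have A: "norm (\<Sum>i<N. a i) \<le> A" for N
    unfolding A_def using chi_periodic[of "Suc _"]
    by (intro periodic_partial_sums_bounded) (auto simp: a_def q_pos)
  have "A \<ge> 0" unfolding A_def by (intro sum_nonneg) auto
  define Z where "Z = (\<Sum>n. real (Suc n) powr (-2))"
  have Z: "Z \<ge> 0" unfolding Z_def by (intro suminf_nonneg summable_Suc_powr) auto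
  define C2 where "C2 = A * Z * (2 + 2 * \<bar>t\<bar>) + norm \<mu> * (1 / (2 * \<bar>t\<bar>) + (2 + 2 * \<bar>t\<bar>) * Z)"
  have L2: "norm (\<Sum>n. chi (Suc n) ^ 2 * of_nat (Suc n) powr (- Complex \<sigma> (2 * t))) \<le> C2"
    if \<sigma>: "\<sigma> > 1" "\<sigma> \<le> 2" for \<sigma>
  proof -
    let ?s = "Complex \<sigma> (2 * t)"
    have ns: "norm ?s \<le> 2 + 2 * \<bar>t\<bar>" using cmod_le[of ?s] \<sigma> by simp
    have "(\<lambda>n. a n * of_nat (Suc n) powr (-?s) + \<mu> * of_nat (Suc n) powr (-?s)) sums
        (abel_series a ?s + \<mu> * zeta ?s)"
      by (intro sums_add sums_mult abel_series_sums[OF A] zeta_sums) (use \<sigma> in auto)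
    then have "(\<lambda>n. chi (Suc n) ^ 2 * of_nat (Suc n) powr (-?s)) sums (abel_series a ?s + \<mu> * zeta ?s)"
      by (simp add: a_def algebra_simps)
    then have "(\<Sum>n. chi (Suc n) ^ 2 * of_nat (Suc n) powr (-?s)) = abel_series a ?s + \<mu> * zeta ?s"
      by (rule sums_unique[symmetric])
    moreover have "norm (abel_series a ?s) \<le> A * Z * (2 + 2 * \<bar>t\<bar>)"
    proof -
      have "norm (abel_series a ?s) \<le> A * (\<Sum>n. real (Suc n) powr (-(1 + 1))) * norm ?s"
        by (rule abel_series_bound[OF A]) (use \<sigma> in auto)
      also have "\<dots> \<le> A * Z * (2 + 2 * \<bar>t\<bar>)"
        unfolding Z_def[symmetric] using ns \<open>A \<ge> 0\<close> Z by (simp add: Z_def mult_left_mono)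
      finally show ?thesis .
    qed
    moreover have "norm (zeta ?s) \<le> 1 / (2 * \<bar>t\<bar>) + (2 + 2 * \<bar>t\<bar>) * Z"
    proof -
      have "norm (zeta ?s) \<le> norm (1 / (?s - 1)) + norm (zeta ?s - 1 / (?s - 1))"
        by (rule norm_triangle_sub)
      also have "norm (zeta ?s - 1 / (?s - 1)) \<le> norm ?s * Z"
        unfolding Z_def by (rule zeta_pole_bound) (use \<sigma> in auto)
      also have "norm ?s * Z \<le> (2 + 2 * \<bar>t\<bar>) * Z" using ns Z by (intro mult_right_mono)
      also have "norm (1 / (?s - 1)) \<le> 1 / (2 * \<bar>t\<bar>)"
      proof -
        have "2 * \<bar>t\<bar> \<le> norm (?s - 1)" using abs_Im_le_cmod[of "?s - 1"] by (simp add: abs_mult)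
        then show ?thesis using t by (simp add: norm_divide frac_le)
      qed
      finally show ?thesis by simp
    qed
    moreover have "norm (x + \<mu> * y) \<le> X + norm \<mu> * Y" if "norm x \<le> X" "norm y \<le> Y" for x y X Y
      using that by (intro norm_triangle_le add_mono) (auto simp: norm_mult mult_left_mono)
    ultimately show ?thesis unfolding C2_def by presburger
  qed
  define D where "D = deriv L (Complex 1 t)"
  have "(L has_field_derivative D) (at (Complex 1 t))"
    unfolding D_def by (rule holomorphic_derivI[OF L_holomorphic open_halfspace_Re_gt]) auto
  then have "((\<lambda>h. (L (Complex 1 t + h) - L (Complex 1 t)) / h) \<longlongrightarrow> D) (at 0)"
    by (simp add: DERIV_def)
  then have "\<forall>\<^sub>F h in at 0. norm ((L (Complex 1 t + h) - L (Complex 1 t)) / h) < norm D + 1"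
    by (intro order_tendstoD(2)[OF tendsto_norm]) auto
  then obtain d where d: "d > 0" "\<And>h. h \<noteq> 0 \<Longrightarrow> norm h < d \<Longrightarrow> norm (L (Complex 1 t + h) / h) < norm D + 1"
    unfolding eventually_at by (auto simp: zero dist_norm)
  define F where "F \<epsilon> = (1 + 2 * Z * \<epsilon>) ^ 3 * (norm D + 1) ^ 4 * C2 * \<epsilon>" for \<epsilon> :: real
  have F: "1 \<le> F \<epsilon>" if \<epsilon>: "0 < \<epsilon>" "\<epsilon> < d" "\<epsilon> \<le> 1" for \<epsilon>
  proof -
    have eq: "Complex (1 + \<epsilon>) t = Complex 1 t + of_real \<epsilon>" by (simp add: complex_eq_iff)
    have "norm (L (Complex (1 + \<epsilon>) t) / of_real \<epsilon>) < norm D + 1"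
      unfolding eq by (rule d(2)) (use \<epsilon> in auto)
    then have l: "norm (L (Complex (1 + \<epsilon>) t)) \<le> (norm D + 1) * \<epsilon>"
      using \<epsilon> by (simp add: norm_divide field_simps)
    have z: "norm (zeta (of_real (1 + \<epsilon>))) \<le> (1 + 2 * Z * \<epsilon>) / \<epsilon>"
    proof -
      let ?s = "of_real (1 + \<epsilon>) :: complex"
      have "norm (zeta ?s) \<le> norm (1 / (?s - 1)) + norm (zeta ?s - 1 / (?s - 1))"
        by (rule norm_triangle_sub)
      also have "norm (zeta ?s - 1 / (?s - 1)) \<le> norm ?s * Z"
        unfolding Z_def by (rule zeta_pole_bound) (use \<epsilon> in auto)
      also have "norm ?s * Z \<le> 2 * Z" using \<epsilon> Z by (intro mult_right_mono) (auto simp del: of_real_add)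
      also have "norm (1 / (?s - 1)) = 1 / \<epsilon>" using \<epsilon> by (simp add: norm_divide)
      finally show ?thesis using \<epsilon> by (simp add: field_simps)
    qed
    have "1 \<le> norm (zeta (of_real (1 + \<epsilon>))) ^ 3 * norm (L (Complex (1 + \<epsilon>) t)) ^ 4
     * norm (\<Sum>n. chi (Suc n) ^ 2 * of_nat (Suc n) powr (- Complex (1 + \<epsilon>) (2 * t)))"
      by (rule three_four_one) (use \<epsilon> in auto)
    also have "\<dots> \<le> ((1 + 2 * Z * \<epsilon>) / \<epsilon>) ^ 3 * ((norm D + 1) * \<epsilon>) ^ 4 * C2"
      using \<epsilon> Z by (intro mult_mono power_mono z l L2) auto
    also have "\<dots> = F \<epsilon>"
    proof -
      have "(x / \<epsilon>) ^ 3 * (y * \<epsilon>) ^ 4 * c = x ^ 3 * y ^ 4 * c * \<epsilon>" for x y c :: real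
        using \<epsilon> by (simp add: field_simps eval_nat_numeral)
      then show ?thesis by (simp add: F_def)
    qed
    finally show ?thesis .
  qed
  have "(F \<longlongrightarrow> F 0) (at_right 0)"
    unfolding F_def by (intro tendsto_intros)
  moreover have "\<forall>\<^sub>F \<epsilon> in at_right 0. 1 \<le> F \<epsilon>"
    unfolding eventually_at_right_field using d(1) F
    by (intro exI[of _ "min d 1"]) auto
  ultimately have "1 \<le> F 0"
    by (rule tendsto_lowerbound) auto
  then show False by (simp add: F_def)
qed

end

section \<open>The logarithmic derivative near a point at which the function is not small\<close>

text \<open>
  The Blaschke factor \<open>R (z - a) / (R\<^sup>2 - cnj a * z)\<close> vanishes at \<open>a\<close> and has norm 1 on the circle of radius
  \<open>R\<close>. The conclusion is written without division, so that it holds at the zero and the pole of the factor.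
\<close>
lemma divide_by_blaschke_factor:
  assumes f: "f holomorphic_on ball 0 S" and R: "0 < R" "R < S" and a: "f a = 0" "norm a < R"
    and M: "\<And>z. norm z = R \<Longrightarrow> norm (f z) \<le> M"
  obtains g where "g holomorphic_on ball 0 S" "\<And>z. norm z = R \<Longrightarrow> norm (g z) \<le> M"
    "\<And>z. f z * (of_real (R\<^sup>2) - cnj a * z) = g z * (of_real R * (z - a))"
proof
  define g where "g z = (if z = a then deriv f a else (f z - f a) / (z - a)) * ((of_real (R\<^sup>2) - cnj a * z) / of_real R)" for z
  show "g holomorphic_on ball 0 S"
    unfolding g_def by (intro holomorphic_intros pole_lemma_open[OF f]) (use R in auto)
  show eq: "f z * (of_real (R\<^sup>2) - cnj a * z) = g z * (of_real R * (z - a))" for z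
    using R a by (simp add: g_def)
  show "norm (g z) \<le> M" if z: "norm z = R" for z
  proof -
    have "of_real (R\<^sup>2) = z * cnj z" using z complex_norm_square[of z] by simp
    then have "norm (of_real (R\<^sup>2) - cnj a * z) = norm (z * cnj (z - a))" by (simp add: algebra_simps)
    also have "\<dots> = R * norm (z - a)" using z by (simp only: norm_mult complex_mod_cnj)
    finally have "norm (of_real (R\<^sup>2) - cnj a * z) = R * norm (z - a)" .
    then have "norm (f z) * (R * norm (z - a)) = norm (g z) * (R * norm (z - a))"
      using arg_cong[OF eq[of z], of norm] R by (simp only: norm_mult) simp
    moreover have "R * norm (z - a) \<noteq> 0" using R a z by auto
    ultimately show ?thesis using M[OF z] by simp
  qed
qed

lemma norm_le_on_ball:
  assumes f: "f holomorphic_on ball 0 S" and R: "0 < R" "R < S"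
    and M: "\<And>z. norm z = R \<Longrightarrow> norm (f z) \<le> M" and z: "norm z \<le> R"
  shows "norm (f z) \<le> M"
proof (rule maximum_modulus_frontier[of f "cball 0 R"])
  show "f holomorphic_on interior (cball 0 R)"
    by (rule holomorphic_on_subset[OF f]) (use R in auto)
  show "continuous_on (closure (cball 0 R)) f"
    by (rule holomorphic_on_imp_continuous_on[OF holomorphic_on_subset[OF f]]) (use R in auto)
qed (use M z in auto)

text \<open>
  A quantitative form of Jensen's inequality. Dividing out a zero \<open>a\<close> keeps the bound \<open>M\<close> on the circle and
  multiplies the norm at 0 by \<open>R / norm a \<ge> R / R'\<close>. Since the norm at 0 never exceeds \<open>M\<close>, the process
  stops after at most \<open>n\<close> steps. The list \<open>as\<close> counts zeros with multiplicity.
\<close>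
lemma blaschke_factorization:
  assumes "f holomorphic_on ball 0 S" and R: "0 < R" "R < S" and R': "0 < R'" "R' < R"
    and "\<And>z. norm z = R \<Longrightarrow> norm (f z) \<le> M"
    and "M * (R' / R) ^ n < norm (f 0)"
  shows "\<exists>as g. length as \<le> n \<and> (\<forall>a\<in>set as. norm a \<le> R' \<and> f a = 0) \<and> g holomorphic_on ball 0 S \<and>
     (\<forall>z. norm z \<le> R' \<longrightarrow> g z \<noteq> 0) \<and> (\<forall>z. norm z \<le> R \<longrightarrow> norm (g z) \<le> M) \<and> norm (f 0) \<le> norm (g 0) \<and>
     (\<forall>z. f z * (\<Prod>a\<leftarrow>as. of_real (R\<^sup>2) - cnj a * z) = g z * (\<Prod>a\<leftarrow>as. of_real R * (z - a)))"
  using assms(1,6,7)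
proof (induction n arbitrary: f)
  case 0
  have "norm (f 0) \<le> M"
    by (rule norm_le_on_ball[OF 0(1) R]) (use 0(2) R in auto)
  then show ?case using 0 by simp
next
  case (Suc n)
  have fM: "norm (f z) \<le> M" if "norm z \<le> R" for z
    by (rule norm_le_on_ball[OF Suc.prems(1) R _ that]) (rule Suc.prems(2))
  show ?case
  proof (cases "\<exists>a. norm a \<le> R' \<and> f a = 0")
    case False
    then show ?thesis using Suc.prems fM
      by (intro exI[of _ "[]"] exI[of _ f]) auto
  next
    case True
    then obtain a where a: "norm a \<le> R'" "f a = 0" by blast
    have "norm a < R" using a R' by simp
    obtain g where g: "g holomorphic_on ball 0 S" "\<And>z. norm z = R \<Longrightarrow> norm (g z) \<le> M"
      "\<And>z. f z * (of_real (R\<^sup>2) - cnj a * z) = g z * (of_real R * (z - a))"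
      using divide_by_blaschke_factor[OF Suc.prems(1) R a(2) \<open>norm a < R\<close> Suc.prems(2)] by blast
    have "M \<ge> 0" using fM[of 0] R norm_ge_zero[of "f 0"] by (simp del: norm_ge_zero)
    have "norm (f 0) > 0"
      using Suc.prems(3) \<open>M \<ge> 0\<close> R R' by (intro order.strict_trans1[OF _ Suc.prems(3)]) auto
    have "norm (f 0) * R\<^sup>2 = norm (g 0) * (R * norm a)"
      using arg_cong[OF g(3)[of 0], of norm] R by (simp add: norm_mult norm_power)
    then have e: "norm (f 0) * R = norm (g 0) * norm a" using R by (simp add: power2_eq_square)
    have le: "norm (f 0) * R \<le> norm (g 0) * R'" unfolding e using a by (intro mult_left_mono) auto
    have "norm (f 0) * R \<le> norm (g 0) * R" using le R' by (meson order.trans mult_left_mono less_imp_le norm_ge_zero)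
    then have fg: "norm (f 0) \<le> norm (g 0)" using R by simp
    have "M * (R' / R) ^ n * R' < norm (f 0) * R"
      using Suc.prems(3) R by (simp add: field_simps)
    also note le
    finally have "M * (R' / R) ^ n < norm (g 0)" using R' by simp
    from Suc.IH[OF g(1,2) this] obtain as h where ih: "length as \<le> n"
      "\<forall>a\<in>set as. norm a \<le> R' \<and> g a = 0" "h holomorphic_on ball 0 S"
      "\<forall>z. norm z \<le> R' \<longrightarrow> h z \<noteq> 0" "\<forall>z. norm z \<le> R \<longrightarrow> norm (h z) \<le> M" "norm (g 0) \<le> norm (h 0)"
      "\<forall>z. g z * (\<Prod>a\<leftarrow>as. of_real (R\<^sup>2) - cnj a * z) = h z * (\<Prod>a\<leftarrow>as. of_real R * (z - a))"
      by blast
    have fz: "f b = 0" if "norm b \<le> R'" "g b = 0" for b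
    proof -
      have "norm (cnj a * b) < R\<^sup>2"
        unfolding norm_mult power2_eq_square using that a R R'
        by (intro mult_strict_mono') auto
      then have "of_real (R\<^sup>2) - cnj a * b \<noteq> 0" by auto (metis norm_of_real abs_power2 less_irrefl of_real_power)
      then show ?thesis using g(3)[of b] that by auto
    qed
    have "f z * (\<Prod>a\<leftarrow>a # as. of_real (R\<^sup>2) - cnj a * z) = h z * (\<Prod>a\<leftarrow>a # as. of_real R * (z - a))" for z
    proof -
      have "f z * (\<Prod>a\<leftarrow>a # as. of_real (R\<^sup>2) - cnj a * z)
         = (f z * (of_real (R\<^sup>2) - cnj a * z)) * (\<Prod>a\<leftarrow>as. of_real (R\<^sup>2) - cnj a * z)"
        by (simp only: list.map prod_list.Cons mult.assoc)
      also have "\<dots> = (of_real R * (z - a)) * (g z * (\<Prod>a\<leftarrow>as. of_real (R\<^sup>2) - cnj a * z))"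
        unfolding g(3) by (simp only: mult_ac)
      also have "\<dots> = h z * (\<Prod>a\<leftarrow>a # as. of_real R * (z - a))"
        using ih(7) by (simp only: list.map prod_list.Cons mult_ac)
      finally show ?thesis .
    qed
    then show ?thesis using ih fg fz a
      by (intro exI[of _ "a # as"] exI[of _ h]) auto
  qed
qed

text \<open>
  Schwarz's lemma for \<open>f / (2 A - f)\<close>: the map \<open>u \<mapsto> u / (2 A - u)\<close> sends the half-plane \<open>Re u < A\<close> to the
  unit disc and fixes 0.
\<close>
lemma borel_caratheodory:
  assumes f: "f holomorphic_on ball 0 R" and f0: "f 0 = 0" and R: "0 < R"
    and Re: "\<And>z. norm z < R \<Longrightarrow> Re (f z) < A" and z: "norm z < R"
  shows "norm (f z) * (R - norm z) \<le> 2 * A * norm z"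
proof -
  have A: "A > 0" using Re[of 0] R f0 by simp
  have ne: "2 * of_real A - f w \<noteq> 0" if "norm w < R" for w
  proof
    assume "2 * of_real A - f w = 0"
    then have "Re (f w) = 2 * A" by (simp add: complex_eq_iff)
    then show False using Re[OF that] A by simp
  qed
  define \<phi> where "\<phi> w = f (of_real R * w) / (2 * of_real A - f (of_real R * w))" for w
  have in_ball: "norm (of_real R * w) < R" if "norm w < 1" for w :: complex
    using that R by (simp add: norm_mult)
  have sub: "(\<lambda>w. of_real R * w) ` ball 0 1 \<subseteq> ball (0 :: complex) R" using in_ball by (auto simp: dist_norm)
  have fR: "(\<lambda>w. f (of_real R * w)) holomorphic_on ball 0 1"
    using holomorphic_on_compose_gen[OF _ f sub] by (simp add: o_def holomorphic_intros)
  have "\<phi> holomorphic_on ball 0 1"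
    unfolding \<phi>_def by (intro holomorphic_intros fR) (use ne in_ball in auto)
  moreover have "\<phi> 0 = 0" by (simp add: \<phi>_def f0)
  moreover have "norm (\<phi> w) < 1" if w: "norm w < 1" for w
  proof -
    define u where "u = f (of_real R * w)"
    have u: "Re u < A" unfolding u_def by (rule Re[OF in_ball[OF w]])
    have "(norm u)\<^sup>2 < (norm (2 * of_real A - u))\<^sup>2"
    proof -
      have "(norm (2 * of_real A - u))\<^sup>2 = (norm u)\<^sup>2 + 4 * A * (A - Re u)"
        unfolding cmod_power2 by (simp add: power2_eq_square algebra_simps)
      moreover have "4 * A * (A - Re u) > 0" using A u by simp
      ultimately show ?thesis by linarith
    qed
    then have "norm u < norm (2 * of_real A - u)" by (rule power2_less_imp_less) simp
    then show ?thesis unfolding \<phi>_def u_def[symmetric] norm_divide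
      using ne[OF in_ball[OF w]] by (simp add: u_def)
  qed
  ultimately have le: "norm (\<phi> (z / of_real R)) \<le> norm (z / of_real R)"
    by (intro Schwarz_Lemma) (use z R in \<open>auto simp: norm_divide\<close>)
  define u where "u = f z"
  have "\<phi> (z / of_real R) = u / (2 * of_real A - u)" using R by (simp add: \<phi>_def u_def)
  with le have "norm u / norm (2 * of_real A - u) \<le> norm z / R" using R by (simp add: norm_divide)
  then have "norm u * R \<le> norm z * norm (2 * of_real A - u)"
    using ne[OF z] R by (simp add: u_def field_simps)
  also have "\<dots> \<le> norm z * (2 * A + norm u)"
    using norm_triangle_ineq4[of "2 * of_real A" u] A by (intro mult_left_mono) (auto simp: norm_mult)
  finally show ?thesis by (simp add: u_def algebra_simps)
qed

lemma has_field_derivative_prod_list: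
  fixes B :: "'b \<Rightarrow> complex \<Rightarrow> complex"
  assumes "\<And>a. a \<in> set as \<Longrightarrow> (B a has_field_derivative B a z * d a) (at z)"
  shows "((\<lambda>w. \<Prod>a\<leftarrow>as. B a w) has_field_derivative (\<Prod>a\<leftarrow>as. B a z) * (\<Sum>a\<leftarrow>as. d a)) (at z)"
  using assms
proof (induction as)
  case (Cons a as)
  have "((\<lambda>w. B a w * (\<Prod>a\<leftarrow>as. B a w)) has_field_derivative
     (B a z * d a) * (\<Prod>a\<leftarrow>as. B a z) + ((\<Prod>a\<leftarrow>as. B a z) * (\<Sum>a\<leftarrow>as. d a)) * B a z) (at z)"
    by (intro DERIV_mult Cons) (use Cons.prems in auto)
  then show ?case by (simp add: algebra_simps)
qed auto

text \<open>
  After the zeros in the disc of radius \<open>18/10\<close> have been divided out there is a holomorphic logarithm on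
  that disc whose real part exceeds its value at 0 by less than \<open>A\<close>. Borel--Caratheodory bounds it on the
  disc of radius \<open>175/100\<close> and Cauchy's estimate bounds its derivative for \<open>norm z < 17/10\<close>; the
  denominators of the Blaschke factors contribute \<open>O(1)\<close> for each zero. The radii are chosen for the centre
  \<open>2 + it\<close>: the inner disc reaches the points \<open>1/2 + it\<close> at distance \<open>3/2\<close>, and the outer one stays in
  \<open>Re s > 0\<close>.
\<close>
lemma log_derivative_near_zeros_at_0:
  assumes f: "f holomorphic_on ball 0 2" and M: "\<And>z. norm z = 19/10 \<Longrightarrow> norm (f z) \<le> M"
    and A: "A \<ge> 1" "M < exp A * norm (f 0)"
  shows "\<exists>as. real (length as) \<le> 20 * A \<and> (\<forall>a\<in>set as. norm a \<le> 18/10 \<and> f a = 0) \<and>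
     (\<forall>z. norm z < 17/10 \<and> f z \<noteq> 0 \<longrightarrow> norm (deriv f z / f z - (\<Sum>a\<leftarrow>as. 1 / (z - a))) \<le> 2000 * A)"
proof -
  define R :: real where "R = 19/10"
  \<comment> \<open>Since \<open>(18/19) ^ 19 \<le> 1/e\<close>, this many zeros in the disc of radius \<open>18/10\<close> would contradict the
    lower bound at 0.\<close>
  define n where "n = nat \<lceil>19 * A\<rceil>"
  have M0: "M \<ge> 0" using order.trans[OF norm_ge_zero M[of "19/10"]] by simp
  have n: "19 * A \<le> real n" "real n \<le> 20 * A"
  proof -
    have "real n = of_int \<lceil>19 * A\<rceil>" using A by (simp add: n_def)
    then show "19 * A \<le> real n" "real n \<le> 20 * A"
      using le_of_int_ceiling[of "19 * A"] of_int_ceiling_le_add_one[of "19 * A"] A by linarith+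
  qed
  have "(18/19::real) ^ n \<le> exp (-A)"
  proof -
    have "(18/19::real) \<le> exp (-(1/19))" using exp_ge_add_one_self[of "-(1/19)"] by simp
    then have "(18/19::real) ^ n \<le> exp (-(1/19)) ^ n" by (intro power_mono) auto
    also have "\<dots> = exp (real n * -(1/19))" by (rule exp_of_nat_mult[symmetric])
    also have "\<dots> \<le> exp (-A)" using n by simp
    finally show ?thesis .
  qed
  then have "M * (18/19) ^ n \<le> M * exp (-A)" using M0 by (intro mult_left_mono)
  also have "\<dots> < norm (f 0)" using A(2) by (simp add: exp_minus field_simps)
  finally have "M * ((18/10) / R) ^ n < norm (f 0)" by (simp add: R_def)
  then obtain as g where as: "length as \<le> n" "\<And>a. a \<in> set as \<Longrightarrow> norm a \<le> 18/10 \<and> f a = 0"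
    and g: "g holomorphic_on ball 0 2" "\<And>z. norm z \<le> 18/10 \<Longrightarrow> g z \<noteq> 0"
      "\<And>z. norm z \<le> R \<Longrightarrow> norm (g z) \<le> M" "norm (f 0) \<le> norm (g 0)"
    and fg: "\<And>z. f z * (\<Prod>a\<leftarrow>as. of_real (R\<^sup>2) - cnj a * z) = g z * (\<Prod>a\<leftarrow>as. of_real R * (z - a))"
    using blaschke_factorization[OF f, of R "18/10" M n] M by (auto simp: R_def)
  have Rz: "of_real (R\<^sup>2) - cnj a * z \<noteq> 0" "norm (cnj a / (of_real (R\<^sup>2) - cnj a * z)) \<le> 4"
    if "a \<in> set as" "norm z < 17/10" for a z
  proof -
    have "norm (cnj a * z) \<le> (18/10) * (17/10)"
      unfolding norm_mult using as(2)[OF that(1)] that(2) by (intro mult_mono) auto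
    then have *: "norm (of_real (R\<^sup>2) - cnj a * z) \<ge> 55/100"
      using norm_triangle_ineq2[of "of_real (R\<^sup>2)" "cnj a * z"] by (simp add: R_def power2_eq_square)
    then show "of_real (R\<^sup>2) - cnj a * z \<noteq> 0" by auto
    have "norm (cnj a / (of_real (R\<^sup>2) - cnj a * z)) \<le> (18/10) / (55/100)"
      unfolding norm_divide using * as(2)[OF that(1)] by (intro frac_le) auto
    then show "norm (cnj a / (of_real (R\<^sup>2) - cnj a * z)) \<le> 4" by simp
  qed
  obtain \<gamma> where \<gamma>: "\<gamma> holomorphic_on ball 0 (18/10)" "\<And>z. z \<in> ball 0 (18/10) \<Longrightarrow> g z = exp (\<gamma> z)"
  proof (rule contractible_imp_holomorphic_log[of g "ball 0 (18/10)"])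
    show "g holomorphic_on ball 0 (18/10)" by (rule holomorphic_on_subset[OF g(1)]) auto
    show "contractible (ball (0::complex) (18/10))" by (simp add: convex_imp_contractible)
  qed (use g(2) in auto)
  \<comment> \<open>The logarithm of \<open>g z / g 0\<close>.\<close>
  define \<psi> where "\<psi> z = \<gamma> z - \<gamma> 0" for z
  have \<psi>: "\<psi> holomorphic_on ball 0 (18/10)" unfolding \<psi>_def by (intro holomorphic_intros \<gamma>)
  have Re\<psi>: "Re (\<psi> z) < A" if "norm z < 18/10" for z
  proof -
    have "exp (Re (\<psi> z)) = norm (g z) / norm (g 0)"
      using \<gamma>(2)[of z] \<gamma>(2)[of 0] that by (simp add: \<psi>_def exp_diff)
    also have "\<dots> \<le> M / norm (g 0)" using g(3)[of z] that by (intro divide_right_mono) (auto simp: R_def)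
    also have "\<dots> < exp A"
    proof -
      have "M < exp A * norm (g 0)" using A(2) g(4) by (meson order.strict_trans2 mult_left_mono exp_ge_zero)
      then show ?thesis using g(2)[of 0] by (simp add: field_simps)
    qed
    finally show ?thesis by simp
  qed
  have \<psi>_bound: "norm (\<psi> z) \<le> 70 * A" if "norm z < 175/100" for z
  proof -
    have "norm (\<psi> z) * (5/100) \<le> norm (\<psi> z) * (18/10 - norm z)" using that by (intro mult_left_mono) auto
    also have "\<dots> \<le> 2 * A * norm z"
      using that by (intro borel_caratheodory[OF \<psi> _ _ Re\<psi>]) (auto simp: \<psi>_def)
    also have "\<dots> \<le> 2 * A * (175/100)" using that A by (intro mult_left_mono) auto
    finally show ?thesis by simp
  qed
  have \<psi>': "norm (deriv \<psi> z) \<le> 1800 * A" if z: "norm z < 17/10" for z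
  proof -
    have sub: "cball z (4/100) \<subseteq> ball 0 (175/100)"
    proof
      fix w assume "w \<in> cball z (4/100)"
      then show "w \<in> ball 0 (175/100)" using z norm_triangle_sub[of w z] by (simp add: dist_norm norm_minus_commute)
    qed
    have sub2: "cball z (4/100) \<subseteq> ball 0 (18/10)"
      by (rule order_trans[OF sub]) (simp add: subset_ball)
    have "norm ((deriv ^^ 1) \<psi> z) \<le> fact 1 * (71 * A) / (4/100) ^ 1"
    proof (rule Cauchy_higher_deriv_bound[where y = 0])
      show "\<psi> holomorphic_on ball z (4/100)"
        by (rule holomorphic_on_subset[OF \<psi> order_trans[OF ball_subset_cball sub2]])
      show "continuous_on (cball z (4/100)) \<psi>"
        by (rule holomorphic_on_imp_continuous_on[OF holomorphic_on_subset[OF \<psi> sub2]])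
      show "\<psi> w \<in> ball 0 (71 * A)" if "w \<in> ball z (4/100)" for w
        using \<psi>_bound[of w] that sub A by force
    qed auto
    then show ?thesis using A by simp
  qed
  have "norm (deriv f z / f z - (\<Sum>a\<leftarrow>as. 1 / (z - a))) \<le> 2000 * A" if z: "norm z < 17/10" "f z \<noteq> 0" for z
  proof -
    define F where "F w = exp (\<gamma> w) * (\<Prod>a\<leftarrow>as. of_real R * (w - a) / (of_real (R\<^sup>2) - cnj a * w))" for w
    have pl: "(\<Prod>a\<leftarrow>as. u a / v a) = (\<Prod>a\<leftarrow>as. u a) / (\<Prod>a\<leftarrow>as. v a)" for u v :: "complex \<Rightarrow> complex"
      by (induction as) auto
    have fF: "f w = F w" if w: "norm w < 17/10" for w
    proof -
      have "(\<Prod>a\<leftarrow>as. of_real (R\<^sup>2) - cnj a * w) \<noteq> 0"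
        using Rz(1)[OF _ w] by (auto simp: prod_list_zero_iff)
      then show ?thesis using fg[of w] \<gamma>(2)[of w] w unfolding F_def pl by (simp add: field_simps)
    qed
    define d where "d a = 1 / (z - a) + cnj a / (of_real (R\<^sup>2) - cnj a * z)" for a
    have za: "z \<noteq> a" if "a \<in> set as" for a using as(2)[OF that] z by auto
    have 1: "((\<lambda>w. \<Prod>a\<leftarrow>as. of_real R * (w - a) / (of_real (R\<^sup>2) - cnj a * w)) has_field_derivative
        (\<Prod>a\<leftarrow>as. of_real R * (z - a) / (of_real (R\<^sup>2) - cnj a * z)) * (\<Sum>a\<leftarrow>as. d a)) (at z)"
    proof (rule has_field_derivative_prod_list)
      fix a assume a: "a \<in> set as"
      define Q where "Q = of_real (R\<^sup>2) - cnj a * z"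
      have Q: "Q \<noteq> 0" unfolding Q_def by (rule Rz(1)[OF a z(1)])
      have "((\<lambda>w. of_real R * (w - a) / (of_real (R\<^sup>2) - cnj a * w)) has_field_derivative
         (of_real R * Q - of_real R * (z - a) * (- cnj a)) / (Q * Q)) (at z)"
        unfolding Q_def using Q[unfolded Q_def] by (auto intro!: derivative_eq_intros)
      moreover have "(of_real R * Q - of_real R * (z - a) * (- cnj a)) / (Q * Q) = of_real R * (z - a) / Q * (1 / (z - a) + cnj a / Q)"
        using Q za[OF a] by (simp add: divide_simps) (simp add: algebra_simps)
      ultimately show "((\<lambda>w. of_real R * (w - a) / (of_real (R\<^sup>2) - cnj a * w)) has_field_derivative
         of_real R * (z - a) / (of_real (R\<^sup>2) - cnj a * z) * d a) (at z)"
        by (simp add: d_def Q_def)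
    qed
    have 2: "(\<gamma> has_field_derivative deriv \<gamma> z) (at z)"
      by (rule holomorphic_derivI[OF \<gamma>(1)]) (use z in auto)
    have "((\<lambda>w. exp (\<gamma> w)) has_field_derivative exp (\<gamma> z) * deriv \<gamma> z) (at z)"
      by (rule DERIV_chain2[OF DERIV_exp 2])
    from DERIV_mult[OF this 1] have "(F has_field_derivative F z * (deriv \<gamma> z + (\<Sum>a\<leftarrow>as. d a))) (at z)"
      unfolding F_def by (simp add: algebra_simps)
    then have "(f has_field_derivative F z * (deriv \<gamma> z + (\<Sum>a\<leftarrow>as. d a))) (at z)"
      by (rule has_field_derivative_transform_within_open[where S = "ball 0 (17/10)"]) (use z fF in auto)
    then have "deriv f z = f z * (deriv \<gamma> z + (\<Sum>a\<leftarrow>as. d a))"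
      using fF[OF z(1)] DERIV_imp_deriv by fastforce
    then have e: "deriv f z / f z - (\<Sum>a\<leftarrow>as. 1 / (z - a)) = deriv \<gamma> z + (\<Sum>a\<leftarrow>as. cnj a / (of_real (R\<^sup>2) - cnj a * z))"
      using z(2) by (simp add: d_def sum_list_addf)
    have d\<psi>: "deriv \<psi> z = deriv \<gamma> z"
    proof -
      have "(\<psi> has_field_derivative deriv \<gamma> z - 0) (at z)"
        unfolding \<psi>_def by (intro DERIV_diff 2 DERIV_const)
      then show ?thesis using DERIV_imp_deriv by fastforce
    qed
    have "norm (\<Sum>a\<leftarrow>as. cnj a / (of_real (R\<^sup>2) - cnj a * z)) \<le> real (length as) * 4"
    proof -
      have "norm (\<Sum>a\<leftarrow>bs. cnj a / (of_real (R\<^sup>2) - cnj a * z)) \<le> real (length bs) * 4"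
        if "set bs \<subseteq> set as" for bs
        using that
      proof (induction bs)
        case (Cons b bs)
        then show ?case using Rz(2)[of b z] z
          by (auto intro!: norm_triangle_le simp: algebra_simps)
      qed auto
      then show ?thesis by blast
    qed
    also have "\<dots> \<le> 80 * A" using as(1) n by simp
    finally show ?thesis unfolding e
      using \<psi>'[OF z(1)] A d\<psi> by (intro norm_triangle_le) auto
  qed
  moreover have "real (length as) \<le> 20 * A" using as(1) n by simp
  ultimately show ?thesis using as(2) by blast
qed

lemma log_derivative_near_zeros:
  assumes f: "f holomorphic_on ball c 2" and M: "\<And>z. dist c z = 19/10 \<Longrightarrow> norm (f z) \<le> M"
    and A: "A \<ge> 1" "M < exp A * norm (f c)"
  obtains as where "real (length as) \<le> 20 * A" "\<And>a. a \<in> set as \<Longrightarrow> dist c a \<le> 18/10 \<and> f a = 0"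
     "\<And>z. dist c z < 17/10 \<Longrightarrow> f z \<noteq> 0 \<Longrightarrow> norm (deriv f z / f z - (\<Sum>a\<leftarrow>as. 1 / (z - a))) \<le> 2000 * A"
proof -
  define F where "F z = f (c + z)" for z
  have "(\<lambda>z. c + z) ` ball 0 2 \<subseteq> ball c 2" by (auto simp: dist_norm)
  then have "F holomorphic_on ball 0 2"
    unfolding F_def using holomorphic_on_compose_gen[of "\<lambda>z. c + z" "ball 0 2" f "ball c 2"] f
    by (simp add: o_def holomorphic_intros)
  then obtain as where as: "real (length as) \<le> 20 * A" "\<And>a. a \<in> set as \<Longrightarrow> norm a \<le> 18/10 \<and> F a = 0"
     "\<And>z. norm z < 17/10 \<Longrightarrow> F z \<noteq> 0 \<Longrightarrow> norm (deriv F z / F z - (\<Sum>a\<leftarrow>as. 1 / (z - a))) \<le> 2000 * A"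
    using log_derivative_near_zeros_at_0[of F M A] M A by (auto simp: F_def dist_norm)
  show ?thesis
  proof (rule that[of "map (\<lambda>a. c + a) as"])
    fix z assume z: "dist c z < 17/10" "f z \<noteq> 0"
    have "(f has_field_derivative deriv f z) (at (c + (z - c)))"
      using holomorphic_derivI[OF f, of z] z by simp
    then have "(F has_field_derivative deriv f z) (at (z - c))"
      unfolding F_def using DERIV_shift[of f "deriv f z" "z - c" c] by (simp add: add.commute)
    then have "deriv F (z - c) = deriv f z" by (rule DERIV_imp_deriv)
    then show "norm (deriv f z / f z - (\<Sum>a\<leftarrow>map (\<lambda>a. c + a) as. 1 / (z - a))) \<le> 2000 * A"
      using as(3)[of "z - c"] z by (simp add: F_def dist_norm norm_minus_commute o_def diff_diff_eq)
  qed (use as in \<open>auto simp: F_def dist_norm\<close>)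
qed

section \<open>The logarithm to the right of the critical line\<close>

text \<open>
  The difference is a continuous function into the discrete set of logarithms of 1.
\<close>
lemma log_branches_differ_by_constant:
  assumes S: "connected S" "S \<noteq> {}" and g: "continuous_on S g" and h: "continuous_on S h"
    and eq: "\<And>z. z \<in> S \<Longrightarrow> exp (g z) = exp (h z :: complex)"
  shows "\<exists>\<kappa>. exp \<kappa> = 1 \<and> (\<forall>z\<in>S. g z = h z + \<kappa>)"
proof -
  define d where "d z = g z - h z" for z
  have d1: "exp (d z) = 1" if "z \<in> S" for z
    using eq[OF that] by (simp add: d_def exp_diff)
  have sep: "1 \<le> norm (d x - d y)" if xy: "x \<in> S" "y \<in> S" "d x \<noteq> d y" for x y
  proof -
    obtain m n :: int where mn: "Re (d x) = 0" "Im (d x) = of_int (2 * m) * pi"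
      "Re (d y) = 0" "Im (d y) = of_int (2 * n) * pi"
      using d1[OF xy(1)] d1[OF xy(2)] unfolding exp_eq_1 by blast
    then have "m \<noteq> n" using xy(3) by (auto simp: complex_eq_iff)
    then have "1 \<le> \<bar>real_of_int (m - n)\<bar>" by linarith
    moreover have "1 \<le> 2 * pi" using pi_gt3 by linarith
    ultimately have "1 * 1 \<le> \<bar>real_of_int (m - n)\<bar> * (2 * pi)" by (intro mult_mono) auto
    also have "\<dots> = \<bar>real_of_int (m - n) * (2 * pi)\<bar>" using pi_gt_zero by (simp add: abs_mult)
    also have "\<dots> = \<bar>Im (d x - d y)\<bar>" using mn by (simp add: algebra_simps)
    also have "\<dots> \<le> norm (d x - d y)" by (rule abs_Im_le_cmod)
    finally show ?thesis by simp
  qed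
  have "d constant_on S"
  proof (rule continuous_discrete_range_constant[OF S(1)])
    show "continuous_on S d" unfolding d_def by (intro continuous_intros g h)
    show "\<exists>e>0. \<forall>y. y \<in> S \<and> d y \<noteq> d x \<longrightarrow> e \<le> norm (d y - d x)" if "x \<in> S" for x
      using sep that by (intro exI[of _ 1]) auto
  qed
  then obtain \<kappa> where \<kappa>: "\<And>z. z \<in> S \<Longrightarrow> d z = \<kappa>" by (auto simp: constant_on_def)
  show ?thesis
  proof (intro exI[of _ \<kappa>] conjI ballI)
    show "exp \<kappa> = 1" using S(2) d1 \<kappa> by (metis ex_in_conv)
    show "g z = h z + \<kappa>" if "z \<in> S" for z using \<kappa>[OF that] by (simp add: d_def algebra_simps)
  qed
qed

definition prime_power_sum :: real where
  "prime_power_sum = (\<Sum>\<^sub>\<infinity>(p, m)\<in>prime_power_index. real (p ^ m) powr (-2))"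

lemma prime_power_sum_nonneg: "prime_power_sum \<ge> 0"
  unfolding prime_power_sum_def by (intro infsum_nonneg) auto

lemma prime_power_ge_2: "(p, m) \<in> prime_power_index \<Longrightarrow> p ^ m \<ge> 2"
proof -
  assume "(p, m) \<in> prime_power_index"
  then have p: "p \<ge> 2" "m \<ge> 1" by (auto simp: prime_power_index_def prime_ge_2_nat)
  then have "p ^ 1 \<le> p ^ m" by (intro power_increasing) auto
  then show ?thesis using p by simp
qed

context nonprincipal_character
begin

definition log_term :: "complex \<Rightarrow> nat \<times> nat \<Rightarrow> complex" where
  "log_term s = (\<lambda>(p, m). (chi p * of_nat p powr (-s)) ^ m / of_nat m)"

lemma log_series_eq: "log_series s = infsum (log_term s) prime_power_index"
  by (simp add: log_series_def log_euler_def log_term_def)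

lemma norm_log_term:
  assumes "(p, m) \<in> prime_power_index"
  shows "norm (log_term s (p, m)) \<le> real (p ^ m) powr (- Re s)"
proof -
  have p: "p > 0" "m \<ge> 1" using assms prime_gt_0_nat by (auto simp: prime_power_index_def)
  have "norm (of_nat p powr (-s)) = real p powr (- Re s)" using norm_nat_powr[of "p - 1"] p by simp
  then have "norm (chi p * of_nat p powr (-s)) \<le> real p powr (- Re s)"
    using norm_chi_le[of p] by (simp add: norm_mult mult_left_le_one_le)
  then have "norm (chi p * of_nat p powr (-s)) ^ m \<le> (real p powr (- Re s)) ^ m"
    by (intro power_mono) auto
  also have "\<dots> = real (p ^ m) powr (- Re s)" using p by (simp add: powr_power powr_powr mult.commute flip: powr_realpow)
  finally have "norm (chi p * of_nat p powr (-s)) ^ m / real m \<le> real (p ^ m) powr (- Re s) / 1"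
    using p by (intro frac_le) auto
  then show ?thesis by (simp add: log_term_def norm_divide norm_power)
qed

lemma log_term_holomorphic: "i \<in> prime_power_index \<Longrightarrow> (\<lambda>s. log_term s i) holomorphic_on A"
  by (cases i) (auto simp: log_term_def prime_power_index_def intro!: holomorphic_intros)

lemma log_term_summable:
  assumes "Re s > 1" "J \<subseteq> prime_power_index"
  shows "(\<lambda>i. norm (log_term s i)) summable_on J"
proof (rule norm_summable_on_comparison)
  show "(\<lambda>(p, m). real (p ^ m) powr (- Re s)) summable_on J"
    by (rule summable_on_subset_banach[OF summable_on_prime_powers]) (use assms in auto)
  show "norm (log_term s i) \<le> (case i of (p, m) \<Rightarrow> real (p ^ m) powr (- Re s))" if "i \<in> J" for i
    using norm_log_term[of "fst i" "snd i" s] that assms(2) by (auto simp: case_prod_unfold)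
qed

text \<open>
  Each term carries a factor \<open>p\<^sup>m powr (2 - Re s) \<le> X powr (2 - Re s)\<close>, and the remaining exponent 2 ensures
  convergence.
\<close>
lemma log_term_tail_bound:
  assumes s: "Re s \<ge> 2" and J: "J \<subseteq> prime_power_index"
    and X: "X > 0" "\<And>p m. (p, m) \<in> J \<Longrightarrow> real (p ^ m) \<ge> X"
  shows "norm (infsum (log_term s) J) \<le> X powr (2 - Re s) * prime_power_sum"
proof -
  let ?g = "\<lambda>(p, m). real (p ^ m) powr (-2)"
  have sm: "?g summable_on prime_power_index" by (rule summable_on_prime_powers) auto
  have "norm (infsum (log_term s) J) \<le> infsum (\<lambda>i. norm (log_term s i)) J"
    by (rule norm_infsum_bound[OF log_term_summable]) (use s J in auto)
  also have "\<dots> \<le> infsum (\<lambda>i. X powr (2 - Re s) * ?g i) J"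
  proof (rule infsum_mono)
    show "(\<lambda>i. norm (log_term s i)) summable_on J" by (rule log_term_summable) (use s J in auto)
    show "(\<lambda>i. X powr (2 - Re s) * ?g i) summable_on J"
      by (intro summable_on_cmult_right summable_on_subset_banach[OF sm J])
  next
    fix i assume i: "i \<in> J"
    obtain p m where pm: "i = (p, m)" by force
    have "norm (log_term s i) \<le> real (p ^ m) powr (- Re s)" using norm_log_term i J pm by auto
    also have "\<dots> = real (p ^ m) powr (2 - Re s) * real (p ^ m) powr (-2)"
      using X(1) X(2)[of p m] i pm by (simp flip: powr_add)
    also have "\<dots> \<le> X powr (2 - Re s) * real (p ^ m) powr (-2)"
      using X(1) X(2)[of p m] i pm s by (intro mult_right_mono powr_mono2') auto
    finally show "norm (log_term s i) \<le> X powr (2 - Re s) * ?g i" by (simp add: pm)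
  qed
  also have "\<dots> = X powr (2 - Re s) * infsum ?g J"
    by (rule infsum_cmult_right) (use summable_on_subset_banach[OF sm J] in auto)
  also have "\<dots> \<le> X powr (2 - Re s) * prime_power_sum"
    unfolding prime_power_sum_def
    by (intro mult_left_mono infsum_mono2 sm summable_on_subset_banach[OF sm J] J) auto
  finally show ?thesis .
qed

lemma norm_log_series:
  assumes "Re s \<ge> 2"
  shows "norm (log_series s) \<le> 2 powr (2 - Re s) * prime_power_sum"
  unfolding log_series_eq
proof (rule log_term_tail_bound)
  fix p m assume "(p, m) \<in> prime_power_index"
  then have "2 \<le> p ^ m" by (rule prime_power_ge_2)
  then show "2 \<le> real (p ^ m)" by (metis of_nat_le_iff of_nat_numeral)
qed (use assms in auto)

lemma norm_log_series_le: "Re s \<ge> 2 \<Longrightarrow> norm (log_series s) \<le> prime_power_sum"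
proof -
  assume s: "Re s \<ge> 2"
  have "2 powr (2 - Re s) \<le> (2::real) powr 0" using s by (intro powr_mono) auto
  then have "2 powr (2 - Re s) * prime_power_sum \<le> 1 * prime_power_sum"
    using prime_power_sum_nonneg by (intro mult_right_mono) auto
  then show ?thesis using norm_log_series[OF s] by simp
qed

lemma continuous_on_log_series: "continuous_on {s. Re s > 1} log_series"
proof -
  have "isCont log_series z" if z: "Re z > 1" for z
  proof -
    define d where "d = (Re z + 1) / 2"
    have d: "d > 1" "d < Re z" using z by (auto simp: d_def)
    have "uniform_limit {s. Re s > d} (\<lambda>F s. \<Sum>i\<in>F. log_term s i) (\<lambda>s. infsum (log_term s) prime_power_index)
        (finite_subsets_at_top prime_power_index)"
    proof (rule Weierstrass_m_test_general[where M = "\<lambda>(p, m). real (p ^ m) powr (- d)"])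
      fix i s assume i: "i \<in> prime_power_index" and s: "s \<in> {s. Re s > d}"
      obtain p m where pm: "i = (p, m)" by force
      have "norm (log_term s i) \<le> real (p ^ m) powr (- Re s)" using norm_log_term i pm by auto
      also have "\<dots> \<le> real (p ^ m) powr (- d)"
        using s i prime_power_ge_2[of p m] pm by (intro powr_mono) (auto simp flip: of_nat_power)
      finally show "norm (log_term s i) \<le> (case i of (p, m) \<Rightarrow> real (p ^ m) powr (- d))" by (simp add: pm)
    qed (rule summable_on_prime_powers[OF d(1)])
    moreover have "\<forall>\<^sub>F F in finite_subsets_at_top prime_power_index.
        continuous_on {s. Re s > d} (\<lambda>s. \<Sum>i\<in>F. log_term s i)"
    proof (rule eventually_finite_subsets_at_top_weakI)
      fix F assume "finite F" "F \<subseteq> prime_power_index"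
      then show "continuous_on {s. Re s > d} (\<lambda>s. \<Sum>i\<in>F. log_term s i)"
        by (intro continuous_on_sum holomorphic_on_imp_continuous_on log_term_holomorphic) auto
    qed
    ultimately have "continuous_on {s. Re s > d} (\<lambda>s. infsum (log_term s) prime_power_index)"
      by (intro uniform_limit_theorem) auto
    then have "continuous_on {s. Re s > d} log_series" by (simp add: log_series_eq)
    then show ?thesis using d open_halfspace_Re_gt[of d] continuous_on_eq_continuous_at by blast
  qed
  then show ?thesis by (intro continuous_at_imp_continuous_on) auto
qed

end

definition upper_right :: "complex set" where
  "upper_right = {s. Re s > 1/2 \<and> Im s > 0}"

lemma upper_right: "open upper_right" "convex upper_right"
proof -
  have e: "upper_right = {s. Re s > 1/2} \<inter> {s. Im s > 0}" by (auto simp: upper_right_def)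
  show "open upper_right" unfolding e by (intro open_Int open_halfspace_Re_gt open_halfspace_Im_gt)
  show "convex upper_right" unfolding e by (intro convex_Int convex_halfspace_Re_gt convex_halfspace_Im_gt)
qed

locale GRH_character = nonprincipal_character +
  assumes GRH: "GRH chi"
begin

text \<open>
  GRH constrains only the zeros with \<open>Re s < 1\<close>. The line \<open>Re s = 1\<close> and the half-plane to its right are
  covered by the nonvanishing theorem and the Euler product.
\<close>
lemma zero_on_left:
  assumes "L s = 0" "Re s > 0" "Im s > 0"
  shows "Re s \<le> 1/2"
proof -
  consider "Re s < 1" | "Re s = 1" | "Re s > 1" by linarith
  then show ?thesis
  proof cases
    case 1
    then show ?thesis using GRH assms dirichlet_L_eq[of s] by (auto simp: GRH_def)
  next
    case 2
    then have "s = Complex 1 (Im s)" by (simp add: complex_eq_iff)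
    then show ?thesis using L_nonzero_on_one_line[of "Im s"] assms by auto
  next
    case 3
    then show ?thesis using exp_log_series[of s] assms exp_not_eq_zero[of "log_series s"] by simp
  qed
qed

lemma L_nonzero: "s \<in> upper_right \<Longrightarrow> L s \<noteq> 0"
  using zero_on_left[of s] by (auto simp: upper_right_def)

lemma log_branch_exists:
  "\<exists>h. h holomorphic_on upper_right \<and> (\<forall>s\<in>upper_right. exp (h s) = L s) \<and>
       (\<forall>s\<in>upper_right. Re s > 1 \<longrightarrow> h s = log_series s)"
proof -
  obtain g where g: "g holomorphic_on upper_right" "\<And>z. z \<in> upper_right \<Longrightarrow> L z = exp (g z)"
  proof (rule contractible_imp_holomorphic_log[of L upper_right])
    show "L holomorphic_on upper_right"
      by (rule holomorphic_on_subset[OF L_holomorphic]) (auto simp: upper_right_def)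
    show "contractible upper_right" by (rule convex_imp_contractible[OF upper_right(2)])
  qed (use L_nonzero in auto)
  define S where "S = upper_right \<inter> {s. Re s > 1}"
  have "connected S" unfolding S_def
    by (intro convex_connected convex_Int upper_right convex_halfspace_Re_gt)
  moreover have "Complex 2 1 \<in> S" by (simp add: S_def upper_right_def)
  then have "S \<noteq> {}" by blast
  moreover have "continuous_on S g" "continuous_on S log_series"
    using holomorphic_on_imp_continuous_on[OF g(1)] continuous_on_log_series
    by (auto simp: S_def elim: continuous_on_subset)
  moreover have "exp (g z) = exp (log_series z)" if "z \<in> S" for z
    using g(2)[of z] exp_log_series[of z] that by (simp add: S_def)
  ultimately have "\<exists>\<kappa>. exp \<kappa> = 1 \<and> (\<forall>z\<in>S. g z = log_series z + \<kappa>)"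
    by (rule log_branches_differ_by_constant)
  then obtain \<kappa> where \<kappa>: "exp \<kappa> = 1" "\<And>z. z \<in> S \<Longrightarrow> g z = log_series z + \<kappa>" by blast
  show ?thesis
    using g \<kappa> by (intro exI[of _ "\<lambda>s. g s - \<kappa>"]) (auto intro!: holomorphic_intros simp: exp_diff S_def)
qed

text \<open>
  The branch of \<open>log L\<close> that is the continuation of the Dirichlet series \<open>log_series\<close>. These properties
  determine it on \<open>upper_right\<close> only, whence the choice.
\<close>
definition logL :: "complex \<Rightarrow> complex" where
  "logL = (SOME h. h holomorphic_on upper_right \<and> (\<forall>s\<in>upper_right. exp (h s) = L s) \<and>
       (\<forall>s\<in>upper_right. Re s > 1 \<longrightarrow> h s = log_series s))"

lemma logL_holomorphic: "logL holomorphic_on upper_right"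
  and exp_logL: "s \<in> upper_right \<Longrightarrow> exp (logL s) = L s"
  and logL_eq: "s \<in> upper_right \<Longrightarrow> Re s > 1 \<Longrightarrow> logL s = log_series s"
  using someI_ex[OF log_branch_exists] unfolding logL_def[symmetric] by auto

lemma logL_derivative: "s \<in> upper_right \<Longrightarrow> (logL has_field_derivative deriv logL s) (at s)"
  by (rule holomorphic_derivI[OF logL_holomorphic upper_right(1)])

lemma deriv_logL: "s \<in> upper_right \<Longrightarrow> deriv logL s = deriv L s / L s"
proof -
  assume s: "s \<in> upper_right"
  have "((\<lambda>w. exp (logL w)) has_field_derivative exp (logL s) * deriv logL s) (at s)"
    by (rule DERIV_chain2[OF DERIV_exp logL_derivative[OF s]])
  then have "(L has_field_derivative exp (logL s) * deriv logL s) (at s)"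
    by (rule has_field_derivative_transform_within_open[OF _ upper_right(1) s]) (rule exp_logL)
  then have "deriv L s = L s * deriv logL s" using exp_logL[OF s] DERIV_imp_deriv by fastforce
  then show ?thesis using L_nonzero[OF s] by simp
qed

text \<open>
  When \<open>1/2 + it\<close> is not a zero, \<open>L\<close> has no zeros in a thin horizontal half-strip around the ray
  \<open>\<sigma> \<ge> 1/2\<close>. The branch of \<open>log L\<close> on that half-strip that agrees with \<open>logL\<close> to the right of the critical
  line tends to 0 along the ray, so it is the one that defines \<open>X_arg\<close>.
\<close>
lemma X_arg_tendsto:
  assumes t: "t > 0" and nz: "L (Complex (1/2) t) \<noteq> 0"
  shows "((\<lambda>\<sigma>. Im (logL (Complex \<sigma> t))) \<longlongrightarrow> X_arg chi t) (at_right (1/2))"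
proof -
  let ?z = "Complex (1/2) t"
  have "isCont L ?z"
    using holomorphic_on_imp_continuous_on[OF L_holomorphic] open_halfspace_Re_gt[of 0]
    by (simp add: continuous_on_eq_continuous_at)
  then have "\<forall>\<^sub>F w in at ?z. L w \<noteq> 0"
    using nz by (intro tendsto_imp_eventually_ne) (auto simp: isCont_def)
  then obtain r0 where r0: "r0 > 0" "\<And>w. w \<noteq> ?z \<Longrightarrow> dist w ?z < r0 \<Longrightarrow> L w \<noteq> 0"
    unfolding eventually_at by auto
  \<comment> \<open>Small enough for the corner of the half-strip, left of the critical line, to lie in the disc around
    \<open>1/2 + it\<close> in which \<open>L\<close> has no zero.\<close>
  define r where "r = min r0 (min (1/2) t) / 2"
  have r: "r > 0" "2 * r \<le> r0" "r \<le> 1/4" "r < t" using r0 t by (auto simp: r_def)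
  define U where "U = {s. Re s > 1/2 - r} \<inter> {s. Im s > t - r} \<inter> {s. Im s < t + r}"
  have U: "open U" "convex U"
    unfolding U_def by (intro open_Int open_halfspace_Re_gt open_halfspace_Im_gt open_halfspace_Im_lt
        convex_Int convex_halfspace_Re_gt convex_halfspace_Im_gt convex_halfspace_Im_lt)+
  have LU: "L s \<noteq> 0" if s: "s \<in> U" for s
  proof (cases "Re s > 1/2")
    case True
    then show ?thesis using L_nonzero[of s] s r by (simp add: U_def upper_right_def)
  next
    case False
    have "norm (s - ?z) \<le> \<bar>Re (s - ?z)\<bar> + \<bar>Im (s - ?z)\<bar>" by (rule cmod_le)
    also have "\<dots> < r + r" using s False by (intro add_strict_mono) (auto simp: U_def)
    finally show ?thesis using r r0(2)[of s] nz by (cases "s = ?z") (auto simp: dist_norm)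
  qed
  obtain g where g: "g holomorphic_on U" "\<And>z. z \<in> U \<Longrightarrow> L z = exp (g z)"
  proof (rule contractible_imp_holomorphic_log[of L U])
    show "L holomorphic_on U"
      by (rule holomorphic_on_subset[OF L_holomorphic]) (use r in \<open>auto simp: U_def\<close>)
    show "contractible U" by (rule convex_imp_contractible[OF U(2)])
  qed (use LU in auto)
  define S where "S = U \<inter> {s. Re s > 1/2}"
  have Sup: "S \<subseteq> upper_right" using r by (auto simp: S_def U_def upper_right_def)
  have "connected S" unfolding S_def
    by (intro convex_connected convex_Int U convex_halfspace_Re_gt)
  moreover have inS: "Complex \<sigma> t \<in> S" if "\<sigma> > 1/2" for \<sigma> using that r by (simp add: S_def U_def)
  then have "S \<noteq> {}" by (metis empty_iff gt_ex)
  moreover have "continuous_on S g" "continuous_on S logL"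
    using continuous_on_subset[OF holomorphic_on_imp_continuous_on[OF g(1)], of S]
       continuous_on_subset[OF holomorphic_on_imp_continuous_on[OF logL_holomorphic] Sup]
    by (auto simp: S_def)
  moreover have "exp (g z) = exp (logL z)" if "z \<in> S" for z
    using g(2)[of z] exp_logL[of z] that Sup by (auto simp: S_def)
  ultimately have "\<exists>\<kappa>. exp \<kappa> = 1 \<and> (\<forall>z\<in>S. g z = logL z + \<kappa>)"
    by (rule log_branches_differ_by_constant)
  then obtain \<kappa> where \<kappa>: "exp \<kappa> = 1" "\<And>z. z \<in> S \<Longrightarrow> g z = logL z + \<kappa>" by blast
  define g' where "g' z = g z - \<kappa>" for z
  have eq: "g' (Complex \<sigma> t) = logL (Complex \<sigma> t)" if "\<sigma> > 1/2" for \<sigma>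
    using \<kappa>(2)[OF inS[OF that]] by (simp add: g'_def)
  have g'_hol: "g' holomorphic_on U" unfolding g'_def by (intro holomorphic_intros g)
  have "log_L_half chi t = g' ?z"
  proof (rule log_L_half_eqI[OF U(1)])
    show "Complex \<sigma> t \<in> U" if "\<sigma> \<ge> 1/2" for \<sigma> using that r by (simp add: U_def)
    show "g' holomorphic_on U" by (rule g'_hol)
    show "exp (g' z) = dirichlet_L chi z" if "z \<in> U" for z
      using g(2)[OF that] \<kappa>(1) dirichlet_L_eq[of z] that r by (simp add: g'_def exp_diff U_def)
    show "((\<lambda>\<sigma>. g' (Complex \<sigma> t)) \<longlongrightarrow> 0) at_top"
    proof (rule Lim_null_comparison)
      show "\<forall>\<^sub>F \<sigma> in at_top. norm (g' (Complex \<sigma> t)) \<le> 2 powr (2 - \<sigma>) * prime_power_sum"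
        using eventually_ge_at_top[of 2]
      proof eventually_elim
        case (elim \<sigma>)
        then show ?case using eq[of \<sigma>] logL_eq[of "Complex \<sigma> t"] norm_log_series[of "Complex \<sigma> t"] t
          by (simp add: upper_right_def)
      qed
      show "((\<lambda>\<sigma>. 2 powr (2 - \<sigma>) * prime_power_sum) \<longlongrightarrow> 0) at_top"
        by real_asymp
    qed
  qed
  then have X: "X_arg chi t = Im (g' ?z)" by (simp add: X_arg_def)
  have "?z \<in> U" using r by (simp add: U_def)
  then have "isCont g' ?z"
    using holomorphic_on_imp_continuous_on[OF g'_hol] U(1) by (simp add: continuous_on_eq_continuous_at)
  then have "((\<lambda>\<sigma>. g' (Complex \<sigma> t)) \<longlongrightarrow> g' ?z) (at_right (1/2))"
  proof (rule isCont_tendsto_compose)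
    show "((\<lambda>\<sigma>. Complex \<sigma> t) \<longlongrightarrow> ?z) (at_right (1/2))"
      unfolding Complex_eq by (intro tendsto_intros)
  qed
  then have "((\<lambda>\<sigma>. Im (g' (Complex \<sigma> t))) \<longlongrightarrow> X_arg chi t) (at_right (1/2))"
    unfolding X by (rule tendsto_Im)
  moreover have "\<forall>\<^sub>F \<sigma> in at_right (1/2). Im (g' (Complex \<sigma> t)) = Im (logL (Complex \<sigma> t))"
    unfolding eventually_at_right_field using eq by (intro exI[of _ 1]) auto
  ultimately show ?thesis by (rule Lim_transform_eventually)
qed

text \<open>
  \<open>log_derivative_near_zeros\<close> at the centre \<open>2 + it\<close>, where \<open>L\<close> is bounded below by the absolutely
  convergent series of its logarithm while its size on the disc is \<open>O(t)\<close>. GRH places all the zeros on or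
  to the left of the critical line.
\<close>
lemma log_derivative_local:
  "\<exists>C\<ge>1. \<forall>t\<ge>2. \<exists>as. real (length as) \<le> C * ln (t + 4) \<and>
     (\<forall>a\<in>set as. Re a \<le> 1/2 \<and> dist (Complex 2 t) a \<le> 18/10) \<and>
     (\<forall>s. dist (Complex 2 t) s < 17/10 \<and> Re s > 1/2 \<longrightarrow>
        norm (deriv logL s - (\<Sum>a\<leftarrow>as. 1 / (s - a))) \<le> C * ln (t + 4))"
proof -
  obtain B where B: "B > 0" "\<And>s. Re s \<ge> 1/20 \<Longrightarrow> norm (L s) \<le> B * norm s" using L_bound by blast
  define C1 where "C1 = \<bar>ln B\<bar> + prime_power_sum + 1"
  have C1: "C1 \<ge> 1" using prime_power_sum_nonneg by (simp add: C1_def)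
  show ?thesis
  proof (intro exI[of _ "2000 * (1 + C1)"] conjI allI impI)
    show "1 \<le> 2000 * (1 + C1)" using C1 by simp
    fix t :: real assume t: "t \<ge> 2"
    define c where "c = Complex 2 t"
    define A where "A = ln (t + 4) + C1"
    have "exp 1 \<le> t + 4" using exp_le t by simp
    then have ln1: "ln (t + 4) \<ge> 1" using t by (subst ln_ge_iff) auto
    have box: "Re c - r \<le> Re s \<and> Im c - r \<le> Im s \<and> Im s \<le> Im c + r" if "dist c s \<le> r" for s r
      using that abs_Re_le_cmod[of "c - s"] abs_Im_le_cmod[of "c - s"] by (auto simp: dist_norm)
    have inball: "Re s > 0 \<and> Im s > 0" if "dist c s < 2" for s
    proof -
      have "\<bar>Re c - Re s\<bar> < 2" "\<bar>Im c - Im s\<bar> < 2"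
        using that abs_Re_le_cmod[of "c - s"] abs_Im_le_cmod[of "c - s"] by (auto simp: dist_norm)
      then show ?thesis using t by (auto simp: c_def)
    qed
    have "L holomorphic_on ball c 2"
      by (rule holomorphic_on_subset[OF L_holomorphic]) (use inball in auto)
    moreover have "norm (L z) \<le> B * (t + 4)" if z: "dist c z = 19/10" for z
    proof -
      have "norm z \<le> norm c + 19/10" using z norm_triangle_sub[of z c] by (simp add: dist_norm norm_minus_commute)
      moreover have "norm c \<le> 2 + t" using cmod_le[of c] t by (simp add: c_def)
      ultimately have "norm z \<le> t + 4" by simp
      moreover have "Re z \<ge> 1/20" using box[of z "19/10"] z by (simp add: c_def)
      ultimately show ?thesis using B by (meson mult_left_mono order.trans less_imp_le)
    qed
    moreover have "A \<ge> 1" using ln1 C1 by (simp add: A_def)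
    moreover have "B * (t + 4) < exp A * norm (L c)"
    proof -
      have "- prime_power_sum \<le> Re (log_series c)"
        using norm_log_series_le[of c] abs_Re_le_cmod[of "log_series c"] by (simp add: c_def)
      then have "exp (- prime_power_sum) \<le> norm (L c)"
        using exp_log_series[of c] by (metis norm_exp_eq_Re exp_le_cancel_iff c_def complex.sel(1) one_less_numeral_iff semiring_norm(76))
      then have "exp A * exp (- prime_power_sum) \<le> exp A * norm (L c)" by simp
      moreover have "exp A * exp (- prime_power_sum) = (t + 4) * exp (\<bar>ln B\<bar> + 1)"
        using t by (simp add: A_def C1_def exp_add exp_minus field_simps)
      moreover have "B < exp (\<bar>ln B\<bar> + 1)"
        using B(1) by (metis abs_ge_self exp_less_cancel_iff exp_ln less_add_one order.strict_trans1)
      ultimately show ?thesis using t by (smt (verit) mult.commute mult_strict_left_mono)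
    qed
    ultimately obtain as where as: "real (length as) \<le> 20 * A" "\<And>a. a \<in> set as \<Longrightarrow> dist c a \<le> 18/10 \<and> L a = 0"
     "\<And>z. dist c z < 17/10 \<Longrightarrow> L z \<noteq> 0 \<Longrightarrow> norm (deriv L z / L z - (\<Sum>a\<leftarrow>as. 1 / (z - a))) \<le> 2000 * A"
      by (rule log_derivative_near_zeros) blast+
    have "A \<le> (1 + C1) * ln (t + 4)"
      using ln1 C1 mult_left_mono[of 1 "ln (t + 4)" C1] by (simp add: A_def algebra_simps)
    then have A: "2000 * A \<le> 2000 * (1 + C1) * ln (t + 4)"
      unfolding mult.assoc by (rule mult_left_mono) simp
    show "\<exists>as. real (length as) \<le> 2000 * (1 + C1) * ln (t + 4) \<and>
     (\<forall>a\<in>set as. Re a \<le> 1/2 \<and> dist (Complex 2 t) a \<le> 18/10) \<and>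
     (\<forall>s. dist (Complex 2 t) s < 17/10 \<and> Re s > 1/2 \<longrightarrow>
        norm (deriv logL s - (\<Sum>a\<leftarrow>as. 1 / (s - a))) \<le> 2000 * (1 + C1) * ln (t + 4))"
    proof (intro exI[of _ as] conjI ballI allI impI)
      show "real (length as) \<le> 2000 * (1 + C1) * ln (t + 4)" using as(1) A \<open>A \<ge> 1\<close> by linarith
      show "dist (Complex 2 t) a \<le> 18/10" if "a \<in> set as" for a
        using as(2)[OF that] by (simp add: c_def)
      show "Re a \<le> 1/2" if "a \<in> set as" for a
        using as(2)[OF that] inball[of a] by (intro zero_on_left) auto
      fix s assume s: "dist (Complex 2 t) s < 17/10 \<and> Re s > 1/2"
      then have "s \<in> upper_right" using inball[of s] by (simp add: upper_right_def c_def)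
      then show "norm (deriv logL s - (\<Sum>a\<leftarrow>as. 1 / (s - a))) \<le> 2000 * (1 + C1) * ln (t + 4)"
        using as(3)[of s] s L_nonzero[of s] deriv_logL[of s] A by (simp add: c_def)
    qed
  qed
qed

text \<open>
  The three bounds, all with a constant uniform in \<open>\<sigma>\<close>, follow from the local expression
  \<open>\<Sum> 1 / (s - a)\<close>: its real part is nonnegative since \<open>Re a \<le> 1/2 < Re s\<close>; its integral
  \<open>\<Sum> Ln (s - a)\<close> has imaginary part at most \<open>\<pi>\<close> for each zero, however near; and its real part is at most
  logarithmic in \<open>\<sigma> - 1/2\<close>. The power \<open>-1/2\<close> in the last bound is a convenient integrable majorant of that
  logarithm.
\<close>
lemma logL_bounds:
  "\<exists>C\<ge>1. \<forall>t\<ge>2. \<forall>\<sigma>. 1/2 < \<sigma> \<and> \<sigma> \<le> 2 \<longrightarrow>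
     - C * ln (t + 4) \<le> Re (deriv logL (Complex \<sigma> t)) \<and>
     \<bar>Im (logL (Complex \<sigma> t))\<bar> \<le> C * ln (t + 4) \<and>
     norm (logL (Complex \<sigma> t)) \<le> C * ln (t + 4) * (1 + (\<sigma> - 1/2) powr (-1/2))"
proof -
  obtain C where C: "C \<ge> 1" and loc: "\<And>t. t \<ge> 2 \<Longrightarrow> \<exists>as. real (length as) \<le> C * ln (t + 4) \<and>
     (\<forall>a\<in>set as. Re a \<le> 1/2 \<and> dist (Complex 2 t) a \<le> 18/10) \<and>
     (\<forall>s. dist (Complex 2 t) s < 17/10 \<and> Re s > 1/2 \<longrightarrow>
        norm (deriv logL s - (\<Sum>a\<leftarrow>as. 1 / (s - a))) \<le> C * ln (t + 4))"
    using log_derivative_local by blast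
  define C' where "C' = prime_power_sum + 20 * C"
  show ?thesis
  proof (rule exI[of _ C'], intro conjI allI impI)
    show "1 \<le> C'" using C prime_power_sum_nonneg by (simp add: C'_def)
    fix t \<sigma> :: real assume t: "t \<ge> 2" and \<sigma>: "1/2 < \<sigma> \<and> \<sigma> \<le> 2"
    define \<Lambda> where "\<Lambda> = ln (t + 4)"
    have "exp 1 \<le> t + 4" using exp_le t by simp
    then have \<Lambda>: "\<Lambda> \<ge> 1" unfolding \<Lambda>_def using t by (subst ln_ge_iff) auto
    define c where "c = Complex 2 t"
    define s where "s = Complex \<sigma> t"
    obtain as where as: "real (length as) \<le> C * \<Lambda>" "\<And>a. a \<in> set as \<Longrightarrow> Re a \<le> 1/2"
      "\<And>a. a \<in> set as \<Longrightarrow> dist c a \<le> 18/10"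
      and der: "\<And>s. dist c s < 17/10 \<Longrightarrow> Re s > 1/2 \<Longrightarrow> norm (deriv logL s - (\<Sum>a\<leftarrow>as. 1 / (s - a))) \<le> C * \<Lambda>"
      using loc[OF t] unfolding c_def \<Lambda>_def by blast
    have cs: "c - s = of_real (2 - \<sigma>)" by (simp add: c_def s_def complex_eq_iff)
    have dcs: "dist c s \<le> 3/2" unfolding dist_norm cs norm_of_real using \<sigma> by simp
    define V where "V = ball c (17/10) \<inter> {z. Re z > 1/2}"
    have V: "convex V" unfolding V_def by (intro convex_Int convex_ball convex_halfspace_Re_gt)
    have inV: "s \<in> V" "c \<in> V" using dcs \<sigma> by (auto simp: V_def s_def c_def)
    have VU: "z \<in> upper_right" if "z \<in> V" for z
    proof -
      have "\<bar>Im c - Im z\<bar> < 17/10"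
        using that abs_Im_le_cmod[of "c - z"] by (auto simp: dist_norm V_def)
      then have "\<bar>t - Im z\<bar> < 17/10" by (simp only: c_def complex.sel)
      then have "Im z > 0" using t by linarith
      then show ?thesis using that by (simp add: V_def upper_right_def)
    qed
    show "- C' * ln (t + 4) \<le> Re (deriv logL (Complex \<sigma> t))"
    proof -
      have nn: "0 \<le> Re (\<Sum>a\<leftarrow>bs. 1 / (s - a))" if "set bs \<subseteq> set as" for bs
        using that
      proof (induction bs)
        case (Cons b bs)
        have "Re (1 / (s - b)) \<ge> 0" using as(2)[of b] Cons.prems \<sigma>
          by (simp add: Re_divide s_def)
        then show ?case using Cons by simp
      qed auto
      have "\<bar>Re (deriv logL s - (\<Sum>a\<leftarrow>as. 1 / (s - a)))\<bar> \<le> C * \<Lambda>"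
        using der[of s] inV abs_Re_le_cmod order.trans unfolding V_def by (metis IntD1 IntD2 mem_Collect_eq mem_ball)
      then have "- (C * \<Lambda>) \<le> Re (deriv logL s)" using nn[OF subset_refl] by (simp add: abs_le_iff)
      moreover have "C * \<Lambda> \<le> C' * \<Lambda>" using \<Lambda> C prime_power_sum_nonneg by (intro mult_right_mono) (auto simp: C'_def)
      ultimately show ?thesis by (simp add: s_def \<Lambda>_def)
    qed
    \<comment> \<open>No \<open>z - a\<close> meets the branch cut, so \<open>\<Phi>\<close> is holomorphic with derivative \<open>O(ln t)\<close>, and it can be
      compared with its value at \<open>c = 2 + it\<close>.\<close>
    define \<Phi> where "\<Phi> z = logL z - (\<Sum>a\<leftarrow>as. Ln (z - a))" for z
    have sumd: "((\<lambda>w. \<Sum>a\<leftarrow>bs. Ln (w - a)) has_field_derivative (\<Sum>a\<leftarrow>bs. 1 / (z - a))) (at z)"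
      if "set bs \<subseteq> set as" "Re z > 1/2" for bs z
      using that
    proof (induction bs)
      case (Cons b bs)
      then have "Re (z - b) > 0" using as(2)[of b] by simp
      then have "z - b \<notin> \<real>\<^sub>\<le>\<^sub>0" using complex_nonpos_Reals_iff by force
      then have "((\<lambda>w. Ln (w - b)) has_field_derivative 1 / (z - b)) (at z)"
        by (auto intro!: derivative_eq_intros simp: divide_inverse)
      then show ?case using Cons by (auto intro!: DERIV_add)
    qed auto
    have \<Phi>': "norm (\<Phi> s - \<Phi> c) \<le> C * \<Lambda> * norm (s - c)"
    proof (rule field_differentiable_bound[OF V _ _ inV])
      fix z assume z: "z \<in> V"
      have "((\<lambda>w. \<Sum>a\<leftarrow>as. Ln (w - a)) has_field_derivative (\<Sum>a\<leftarrow>as. 1 / (z - a))) (at z)"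
        by (rule sumd) (use z in \<open>auto simp: V_def\<close>)
      from DERIV_diff[OF logL_derivative[OF VU[OF z]] this]
      show "(\<Phi> has_field_derivative deriv logL z - (\<Sum>a\<leftarrow>as. 1 / (z - a))) (at z within V)"
        unfolding \<Phi>_def by (rule has_field_derivative_at_within)
      show "norm (deriv logL z - (\<Sum>a\<leftarrow>as. 1 / (z - a))) \<le> C * \<Lambda>" using der z by (auto simp: V_def)
    qed
    have Ln: "norm (Ln w) \<le> 7 + 2 * \<delta> powr (-1/2)" if w: "Re w \<ge> \<delta>" "norm w \<le> 4" "\<delta> > 0" for w \<delta>
    proof -
      have nw: "\<delta> \<le> norm w" using w complex_Re_le_cmod[of w] by simp
      then have w0: "w \<noteq> 0" using w by auto
      have "ln (norm w) \<le> 3" using ln_le_minus_one[of "norm w"] w w0 by simp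
      moreover have "- ln (norm w) \<le> 2 * \<delta> powr (-1/2)"
      proof -
        have "ln \<delta> \<le> ln (norm w)" using nw w w0 by (subst ln_le_cancel_iff) auto
        then have "- ln (norm w) \<le> - ln \<delta>" by simp
        also have "\<dots> = 2 * ln (\<delta> powr (-1/2))" using w by (simp add: ln_powr)
        also have "\<dots> \<le> 2 * \<delta> powr (-1/2)" using ln_le_minus_one[of "\<delta> powr (-1/2)"] w by simp
        finally show ?thesis .
      qed
      moreover have "\<delta> powr (-1/2) \<ge> 0" by simp
      moreover have "Re (Ln w) = ln (norm w)" using w0 by simp
      ultimately have "\<bar>Re (Ln w)\<bar> \<le> 3 + 2 * \<delta> powr (-1/2)" by linarith
      moreover have "\<bar>Im (Ln w)\<bar> \<le> 4"
        using mpi_less_Im_Ln[OF w0] Im_Ln_le_pi[OF w0] pi_less_4 by (simp add: abs_le_iff)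
      ultimately show ?thesis using cmod_le[of "Ln w"] by linarith
    qed
    have suml: "norm (\<Sum>a\<leftarrow>bs. f a) \<le> real (length bs) * K" if "\<And>a. a \<in> set bs \<Longrightarrow> norm (f a) \<le> K"
      for f :: "complex \<Rightarrow> complex" and bs K
      using that
    proof (induction bs)
      case (Cons b bs)
      have "norm (f b + (\<Sum>a\<leftarrow>bs. f a)) \<le> K + real (length bs) * K"
        using Cons by (intro norm_triangle_le add_mono) auto
      then show ?case by (simp add: algebra_simps)
    qed auto
    have sumI: "\<bar>Im (\<Sum>a\<leftarrow>bs. Ln (s - a))\<bar> \<le> real (length bs) * 4" if "set bs \<subseteq> set as" for bs
      using that
    proof (induction bs)
      case (Cons b bs)
      have "s - b \<noteq> 0" using as(2)[of b] Cons.prems \<sigma> by (auto simp: s_def)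
      then have "\<bar>Im (Ln (s - b))\<bar> \<le> 4"
        using mpi_less_Im_Ln[of "s - b"] Im_Ln_le_pi[of "s - b"] pi_less_4 by (simp add: abs_le_iff)
      then have "\<bar>Im (Ln (s - b)) + Im (\<Sum>a\<leftarrow>bs. Ln (s - a))\<bar> \<le> 4 + real (length bs) * 4"
        using Cons by (intro order.trans[OF abs_triangle_ineq] add_mono) auto
      then show ?case by simp
    qed auto
    define D where "D = (\<sigma> - 1/2) powr (-1/2)"
    have D: "D \<ge> 0" by (simp add: D_def)
    have N: "0 \<le> real (length as)" by simp
    have "norm (\<Sum>a\<leftarrow>as. Ln (c - a)) \<le> real (length as) * 9"
    proof (rule suml)
      fix a assume a: "a \<in> set as"
      have "norm (Ln (c - a)) \<le> 7 + 2 * 1 powr (-1/2)"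
        by (rule Ln) (use as(2,3)[OF a] in \<open>auto simp: c_def dist_norm\<close>)
      then show "norm (Ln (c - a)) \<le> 9" by simp
    qed
    moreover have "norm (logL c) \<le> prime_power_sum"
      using norm_log_series_le[of c] logL_eq[of c] VU[OF inV(2)] by (simp add: c_def)
    ultimately have "norm (\<Phi> c) \<le> prime_power_sum + real (length as) * 9"
      unfolding \<Phi>_def using norm_triangle_ineq4[of "logL c" "\<Sum>a\<leftarrow>as. Ln (c - a)"] by linarith
    moreover have "norm (\<Phi> s - \<Phi> c) \<le> C * \<Lambda> * (3/2)"
    proof (rule order.trans[OF \<Phi>'], rule mult_left_mono)
      show "norm (s - c) \<le> 3/2" using dcs by (simp add: dist_norm norm_minus_commute)
    qed (use C \<Lambda> in auto)
    ultimately have "norm (\<Phi> s) \<le> prime_power_sum + real (length as) * 9 + C * \<Lambda> * (3/2)"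
      using norm_triangle_sub[of "\<Phi> s" "\<Phi> c"] by linarith
    then have \<Phi>s: "norm (\<Phi> s) \<le> prime_power_sum + 11 * (C * \<Lambda>)" using as(1) C \<Lambda> by linarith
    have pp: "prime_power_sum \<le> prime_power_sum * \<Lambda>"
      using \<Lambda> prime_power_sum_nonneg mult_left_mono[of 1 \<Lambda> prime_power_sum] by simp
    have logL_s: "logL s = \<Phi> s + (\<Sum>a\<leftarrow>as. Ln (s - a))" by (simp add: \<Phi>_def)
    show "\<bar>Im (logL (Complex \<sigma> t))\<bar> \<le> C' * ln (t + 4)"
    proof -
      have "\<bar>Im (logL s)\<bar> \<le> \<bar>Im (\<Phi> s)\<bar> + \<bar>Im (\<Sum>a\<leftarrow>as. Ln (s - a))\<bar>"
        unfolding logL_s by (simp add: abs_triangle_ineq)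
      also have "\<dots> \<le> (prime_power_sum + 11 * (C * \<Lambda>)) + 4 * (C * \<Lambda>)"
        using sumI[OF subset_refl] as(1) abs_Im_le_cmod[of "\<Phi> s"] \<Phi>s by linarith
      also have "\<dots> \<le> C' * \<Lambda>"
      proof -
        have "0 \<le> C * \<Lambda>" using C \<Lambda> by simp
        moreover have "C' * \<Lambda> = prime_power_sum * \<Lambda> + 20 * (C * \<Lambda>)" by (simp add: C'_def algebra_simps)
        ultimately show ?thesis using pp by linarith
      qed
      finally show ?thesis by (simp add: s_def \<Lambda>_def)
    qed
    have "norm (\<Sum>a\<leftarrow>as. Ln (s - a)) \<le> real (length as) * (7 + 2 * D)"
    proof (rule suml)
      fix a assume a: "a \<in> set as"
      have "dist s a \<le> dist c s + dist c a" by (rule dist_triangle3)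
      then have "norm (s - a) \<le> 4" using dcs as(3)[OF a] by (simp add: dist_norm)
      then show "norm (Ln (s - a)) \<le> 7 + 2 * D"
        unfolding D_def by (intro Ln) (use as(2)[OF a] \<sigma> in \<open>auto simp: s_def\<close>)
    qed
    also have "\<dots> \<le> C * \<Lambda> * (7 + 2 * D)" using as(1) D by (intro mult_right_mono) auto
    finally have "norm (logL s) \<le> (prime_power_sum + 11 * (C * \<Lambda>)) + C * \<Lambda> * (7 + 2 * D)"
      unfolding logL_s using \<Phi>s by (intro norm_triangle_le add_mono)
    also have "\<dots> \<le> C' * \<Lambda> * (1 + D)"
    proof -
      have "0 \<le> C * \<Lambda> * (2 + 18 * D) + prime_power_sum * \<Lambda> * D"
        using C \<Lambda> D prime_power_sum_nonneg by (intro add_nonneg_nonneg mult_nonneg_nonneg) auto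
      then show ?thesis using pp by (simp add: C'_def algebra_simps)
    qed
    finally show "norm (logL (Complex \<sigma> t)) \<le> C' * ln (t + 4) * (1 + (\<sigma> - 1/2) powr (-1/2))"
      by (simp add: s_def \<Lambda>_def D_def)
  qed
qed

end

section \<open>The Fejer kernel\<close>

text \<open>
  The value 1 at 0 removes the singularity.
\<close>
definition entire_sinc :: "complex \<Rightarrow> complex" where
  "entire_sinc z = (if z = 0 then 1 else sin z / z)"

text \<open>
  Nonnegative, concentrated on \<open>\<bar>u\<bar> = O(1/\<Delta>)\<close>, and the restriction to the real line of an entire function
  of exponential type \<open>2 \<Delta>\<close>; equivalently, its Fourier transform is supported on \<open>[- 2 \<Delta>, 2 \<Delta>]\<close>. Its
  total mass is \<open>\<pi>\<close>.
\<close>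
definition fejer :: "real \<Rightarrow> real \<Rightarrow> real" where
  "fejer \<Delta> u = (if u = 0 then \<Delta> else (sin (\<Delta> * u))\<^sup>2 / (\<Delta> * u\<^sup>2))"

text \<open>
  The entire extension of \<open>fejer \<Delta>\<close>.
\<close>
definition fejer_c :: "real \<Rightarrow> complex \<Rightarrow> complex" where
  "fejer_c \<Delta> z = of_real \<Delta> * (entire_sinc (of_real \<Delta> * z))\<^sup>2"

lemma entire_sinc_holomorphic: "entire_sinc holomorphic_on UNIV"
proof -
  have "deriv sin (0::complex) = 1" using DERIV_imp_deriv[OF DERIV_sin[of "0::complex"]] by simp
  then have "entire_sinc = (\<lambda>z. if z = 0 then deriv sin 0 else (sin z - sin 0) / (z - 0))"
    by (auto simp: entire_sinc_def)
  then show ?thesis using pole_lemma_open[of sin UNIV 0] holomorphic_on_sin by simp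
qed

lemma fejer_c_holomorphic: "fejer_c \<Delta> holomorphic_on A"
proof -
  have "(entire_sinc \<circ> (\<lambda>z. of_real \<Delta> * z)) holomorphic_on A"
    by (rule holomorphic_on_compose_gen[OF _ entire_sinc_holomorphic]) (auto intro!: holomorphic_intros)
  then show ?thesis unfolding fejer_c_def o_def by (intro holomorphic_intros)
qed

lemma norm_sin_le_exp: "norm (sin z) \<le> exp \<bar>Im z\<bar>" for z :: complex
proof -
  have "norm (sin z) = norm (exp (\<i> * z) - exp (- (\<i> * z))) / 2"
    by (simp add: sin_exp_eq norm_divide norm_mult)
  also have "\<dots> \<le> (norm (exp (\<i> * z)) + norm (exp (- (\<i> * z)))) / 2"
    by (intro divide_right_mono norm_triangle_ineq4) auto
  also have "\<dots> \<le> (exp \<bar>Im z\<bar> + exp \<bar>Im z\<bar>) / 2"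
    by (intro divide_right_mono add_mono) auto
  finally show ?thesis by simp
qed

lemma norm_fejer_c:
  assumes "\<Delta> > 0" "r > 0" "norm z \<ge> r"
  shows "norm (fejer_c \<Delta> z) \<le> exp (2 * \<Delta> * \<bar>Im z\<bar>) / (\<Delta> * r\<^sup>2)"
proof -
  have z: "z \<noteq> 0" using assms by auto
  have "norm (fejer_c \<Delta> z) = norm (sin (of_real \<Delta> * z)) ^ 2 / (\<Delta> * (norm z)\<^sup>2)"
    using z assms by (simp add: fejer_c_def entire_sinc_def norm_mult norm_divide norm_power power2_eq_square)
  also have "\<dots> \<le> exp \<bar>Im (of_real \<Delta> * z)\<bar> ^ 2 / (\<Delta> * r\<^sup>2)"
    using assms by (intro frac_le power_mono norm_sin_le_exp mult_left_mono mult_pos_pos zero_less_power) auto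
  also have "exp \<bar>Im (of_real \<Delta> * z)\<bar> ^ 2 = exp (2 * \<Delta> * \<bar>Im z\<bar>)"
    using assms by (simp add: abs_mult mult.assoc flip: exp_double)
  finally show ?thesis .
qed

lemma fejer_c_of_real: "fejer_c \<Delta> (of_real u) = of_real (fejer \<Delta> u)"
  by (cases "\<Delta> = 0 \<or> u = 0")
     (auto simp: fejer_c_def fejer_def entire_sinc_def power_divide power2_eq_square simp flip: sin_of_real)

lemma fejer_nonneg: "\<Delta> > 0 \<Longrightarrow> fejer \<Delta> u \<ge> 0"
  by (simp add: fejer_def)

lemma fejer_minus: "fejer \<Delta> (-u) = fejer \<Delta> u"
  by (simp add: fejer_def)

lemma fejer_le: "\<Delta> > 0 \<Longrightarrow> fejer \<Delta> u \<le> \<Delta>"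
proof (cases "u = 0")
  case False
  assume \<Delta>: "\<Delta> > 0"
  have "\<bar>sin (\<Delta> * u)\<bar> \<le> \<bar>\<Delta> * u\<bar>" by (rule abs_sin_x_le_abs_x)
  then have "(sin (\<Delta> * u))\<^sup>2 \<le> (\<Delta> * u)\<^sup>2" by (simp add: abs_le_square_iff)
  then have "(sin (\<Delta> * u))\<^sup>2 / (\<Delta> * u\<^sup>2) \<le> (\<Delta> * u)\<^sup>2 / (\<Delta> * u\<^sup>2)"
    using \<Delta> by (intro divide_right_mono) auto
  moreover have "(\<Delta> * u)\<^sup>2 / (\<Delta> * u\<^sup>2) = \<Delta>" using \<Delta> False by (simp add: power2_eq_square)
  ultimately show ?thesis using False by (simp add: fejer_def)
qed (simp add: fejer_def)

lemma fejer_decay: "\<Delta> > 0 \<Longrightarrow> u \<noteq> 0 \<Longrightarrow> fejer \<Delta> u \<le> 1 / (\<Delta> * u\<^sup>2)"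
  by (simp add: fejer_def divide_right_mono abs_square_le_1)

lemma fejer_ge:
  assumes "\<Delta> > 0" "\<bar>u\<bar> \<le> 1 / \<Delta>"
  shows "fejer \<Delta> u \<ge> \<Delta> / 2"
proof (cases "u = 0")
  case False
  define x where "x = \<bar>\<Delta> * u\<bar>"
  have x: "0 < x" "x \<le> 1" using assms False by (auto simp: x_def abs_mult field_simps)
  have "\<bar>sin x - (\<Sum>m<3. sin_coeff m * x ^ m)\<bar> \<le> inverse (fact 3) * \<bar>x\<bar> ^ 3" by (rule Maclaurin_sin_bound)
  moreover have "(\<Sum>m<3. sin_coeff m * x ^ m) = x" by (simp add: sin_coeff_def eval_nat_numeral)
  moreover have "inverse (fact 3) * \<bar>x\<bar> ^ 3 = x ^ 3 / 6" using x by (simp add: fact_numeral)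
  ultimately have "sin x \<ge> x - x ^ 3 / 6" by linarith
  moreover have "x ^ 3 \<le> x" using x power_decreasing[of 1 3 x] by simp
  ultimately have "sin x \<ge> 5/6 * x" by linarith
  then have "(5/6 * x)\<^sup>2 \<le> (sin x)\<^sup>2" using x by (intro power_mono) auto
  also have "(sin x)\<^sup>2 = (sin (\<Delta> * u))\<^sup>2" by (cases "\<Delta> * u \<ge> 0") (auto simp: x_def)
  finally have "(25/36) * (\<Delta> * u)\<^sup>2 \<le> (sin (\<Delta> * u))\<^sup>2"
    by (simp add: x_def power_mult_distrib power_divide)
  then have "(\<Delta> * u)\<^sup>2 / 2 \<le> (sin (\<Delta> * u))\<^sup>2" using zero_le_power2[of "\<Delta> * u"] by linarith
  then have "(\<Delta> * u)\<^sup>2 / 2 / (\<Delta> * u\<^sup>2) \<le> (sin (\<Delta> * u))\<^sup>2 / (\<Delta> * u\<^sup>2)"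
    using assms by (intro divide_right_mono) auto
  moreover have "(\<Delta> * u)\<^sup>2 / 2 / (\<Delta> * u\<^sup>2) = \<Delta> / 2"
    using assms False by (simp add: power2_eq_square)
  ultimately have "\<Delta> / 2 \<le> (sin (\<Delta> * u))\<^sup>2 / (\<Delta> * u\<^sup>2)" by (simp only:)
  then show ?thesis using False by (simp add: fejer_def)
qed (use assms in \<open>simp add: fejer_def\<close>)

lemma continuous_on_fejer: "continuous_on A (fejer \<Delta>)"
proof -
  have "continuous_on A (\<lambda>u. fejer_c \<Delta> (of_real u))"
    by (rule continuous_on_compose2[OF holomorphic_on_imp_continuous_on[OF fejer_c_holomorphic[of \<Delta> UNIV]]])
       (auto intro!: continuous_intros)
  then have "continuous_on A (\<lambda>u. Re (fejer_c \<Delta> (of_real u)))" by (intro continuous_intros)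
  then show ?thesis by (simp add: fejer_c_of_real)
qed

lemma fejer_integrable: "fejer \<Delta> integrable_on {a..b}"
  by (rule integrable_continuous_real[OF continuous_on_fejer])

lemma fejer_tail:
  assumes "\<Delta> > 0" "0 < a" "a \<le> b"
  shows "integral {a..b} (fejer \<Delta>) \<le> 1 / (\<Delta> * a)" "integral {-b..-a} (fejer \<Delta>) \<le> 1 / (\<Delta> * a)"
proof -
  have "((\<lambda>u. 1 / (\<Delta> * u\<^sup>2)) has_integral (- (1 / (\<Delta> * b)) - - (1 / (\<Delta> * a)))) {a..b}"
  proof (rule fundamental_theorem_of_calculus[OF assms(3)])
    fix x assume "x \<in> {a..b}"
    then show "((\<lambda>x. - (1 / (\<Delta> * x))) has_vector_derivative 1 / (\<Delta> * x\<^sup>2)) (at x within {a..b})"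
      unfolding has_real_derivative_iff_has_vector_derivative[symmetric] using assms
      by (auto intro!: derivative_eq_intros simp: power2_eq_square field_simps)
  qed
  then have hi: "(\<lambda>u. 1 / (\<Delta> * u\<^sup>2)) integrable_on {a..b}"
    "integral {a..b} (\<lambda>u. 1 / (\<Delta> * u\<^sup>2)) = 1 / (\<Delta> * a) - 1 / (\<Delta> * b)"
    by (auto simp: has_integral_iff)
  have "integral {a..b} (fejer \<Delta>) \<le> integral {a..b} (\<lambda>u. 1 / (\<Delta> * u\<^sup>2))"
    by (intro integral_le fejer_integrable hi fejer_decay) (use assms in auto)
  also have "\<dots> \<le> 1 / (\<Delta> * a)" unfolding hi using assms by simp
  finally show 1: "integral {a..b} (fejer \<Delta>) \<le> 1 / (\<Delta> * a)" .
  have "integral {-b..-a} (\<lambda>u. fejer \<Delta> (-u)) = integral {a..b} (fejer \<Delta>)"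
    by (rule Henstock_Kurzweil_Integration.integral_reflect_real)
  then show "integral {-b..-a} (fejer \<Delta>) \<le> 1 / (\<Delta> * a)" using 1 by (simp add: fejer_minus)
qed

lemma fejer_mass_ge:
  assumes "\<Delta> > 0" "1 / \<Delta> \<le> h"
  shows "integral {-h..h} (fejer \<Delta>) \<ge> 1"
proof -
  have "1 = integral {-(1/\<Delta>)..1/\<Delta>} (\<lambda>_. \<Delta> / 2)" using assms by simp
  also have "\<dots> \<le> integral {-(1/\<Delta>)..1/\<Delta>} (fejer \<Delta>)"
    by (intro integral_le fejer_integrable fejer_ge) (use assms in auto)
  also have "\<dots> \<le> integral {-h..h} (fejer \<Delta>)"
    by (intro integral_subset_le fejer_integrable fejer_nonneg ballI) (use assms in auto)
  finally show ?thesis .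
qed

lemma fejer_mass_le:
  assumes "\<Delta> > 0" "h \<ge> 0"
  shows "integral {-h..h} (fejer \<Delta>) \<le> 2 * h * \<Delta>"
proof -
  have "integral {-h..h} (fejer \<Delta>) \<le> integral {-h..h} (\<lambda>_. \<Delta>)"
    by (intro integral_le fejer_integrable fejer_le) (use assms in auto)
  then show ?thesis using assms by simp
qed

section \<open>Smoothing turns the logarithm into a Dirichlet polynomial\<close>

definition short_prime_powers :: "real \<Rightarrow> (nat \<times> nat) set" where
  "short_prime_powers X = {(p, m) \<in> prime_power_index. real (p ^ m) \<le> X}"

lemma short_prime_powers_subset: "short_prime_powers X \<subseteq> prime_power_index"
  by (auto simp: short_prime_powers_def)

lemma finite_short_prime_powers: "finite (short_prime_powers X)"
  and card_short_prime_powers: "X \<ge> 0 \<Longrightarrow> real (card (short_prime_powers X)) \<le> X"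
proof -
  have sub: "(\<lambda>(p, m). p ^ m) ` short_prime_powers X \<subseteq> {1..nat \<lfloor>X\<rfloor>}"
  proof clarify
    fix p m assume "(p, m) \<in> short_prime_powers X"
    then have "(p, m) \<in> prime_power_index" "real (p ^ m) \<le> X" by (auto simp: short_prime_powers_def)
    then show "p ^ m \<in> {1..nat \<lfloor>X\<rfloor>}" using prime_power_ge_2[of p m] by (simp add: le_nat_floor)
  qed
  have inj: "inj_on (\<lambda>(p, m). p ^ m) (short_prime_powers X)"
    by (rule inj_on_subset[OF inj_on_prime_power short_prime_powers_subset])
  show fin: "finite (short_prime_powers X)"
    using finite_imageD[OF finite_subset[OF sub] inj] by simp
  assume X: "X \<ge> 0"
  have "card (short_prime_powers X) = card ((\<lambda>(p, m). p ^ m) ` short_prime_powers X)"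
    by (rule card_image[OF inj, symmetric])
  also have "\<dots> \<le> card {1..nat \<lfloor>X\<rfloor>}" by (rule card_mono[OF _ sub]) simp
  finally have "real (card (short_prime_powers X)) \<le> real (nat \<lfloor>X\<rfloor>)" by simp
  then show "real (card (short_prime_powers X)) \<le> X" using X by linarith
qed

context GRH_character
begin

definition log_poly :: "real \<Rightarrow> complex \<Rightarrow> complex" where
  "log_poly X s = (\<Sum>i\<in>short_prime_powers X. log_term s i)"

lemma norm_log_poly:
  assumes "X \<ge> 0" "Re s \<ge> 0"
  shows "norm (log_poly X s) \<le> X"
proof -
  have "norm (log_term s i) \<le> 1" if i: "i \<in> short_prime_powers X" for i
  proof -
    obtain p m where pm: "i = (p, m)" by force
    then have I: "(p, m) \<in> prime_power_index" using i short_prime_powers_subset by auto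
    have "norm (log_term s (p, m)) \<le> real (p ^ m) powr (- Re s)" by (rule norm_log_term[OF I])
    also have "\<dots> \<le> real (p ^ m) powr 0"
      using prime_power_ge_2[OF I] assms by (intro powr_mono) (auto simp flip: of_nat_power)
    finally show ?thesis using prime_power_ge_2[OF I] pm by (auto split: if_splits)
  qed
  then have "norm (log_poly X s) \<le> (\<Sum>i\<in>short_prime_powers X. 1)"
    unfolding log_poly_def by (intro order.trans[OF norm_sum] sum_mono)
  then show ?thesis using card_short_prime_powers[OF assms(1)] by simp
qed

text \<open>
  To the right of 2 the difference is the part of the Dirichlet series over the prime powers above \<open>X\<close>.
\<close>
lemma norm_logL_minus_poly:
  assumes s: "Re s \<ge> 2" "Im s > 0" and X: "X > 0"
  shows "norm (logL s - log_poly X s) \<le> X powr (2 - Re s) * prime_power_sum"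
proof -
  let ?J = "prime_power_index - short_prime_powers X"
  have "infsum (log_term s) (short_prime_powers X \<union> ?J) = infsum (log_term s) (short_prime_powers X) + infsum (log_term s) ?J"
  proof (rule infsum_Un_disjoint)
    show "log_term s summable_on short_prime_powers X" by (rule summable_on_finite[OF finite_short_prime_powers])
    show "log_term s summable_on ?J" by (rule abs_summable_summable[OF log_term_summable]) (use s in auto)
  qed auto
  moreover have "short_prime_powers X \<union> ?J = prime_power_index" using short_prime_powers_subset by auto
  ultimately have "log_series s = log_poly X s + infsum (log_term s) ?J"
    by (simp add: log_series_eq log_poly_def finite_short_prime_powers)
  moreover have "logL s = log_series s" using s by (intro logL_eq) (auto simp: upper_right_def)
  ultimately have "logL s - log_poly X s = infsum (log_term s) ?J" by simp
  moreover have "norm (infsum (log_term s) ?J) \<le> X powr (2 - Re s) * prime_power_sum"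
    by (rule log_term_tail_bound) (use s X in \<open>auto simp: short_prime_powers_def\<close>)
  ultimately show ?thesis by simp
qed

lemma log_poly_holomorphic: "log_poly X holomorphic_on A"
  unfolding log_poly_def using short_prime_powers_subset
  by (intro holomorphic_on_sum log_term_holomorphic) auto

text \<open>
  The integral runs over the left edge of the rectangle with real parts in \<open>[\<sigma>, \<sigma> + U]\<close> and imaginary
  parts in \<open>[t - U, t + U]\<close>, and Cauchy's theorem moves it to the other three edges, where the kernel is
  at most \<open>exp (2 \<Delta> x) / U\<^sup>2\<close> at distance \<open>x\<close> from the left edge. As soon as \<open>x \<ge> 2\<close>, the difference
  of \<open>logL\<close> and the polynomial is a tail of the Dirichlet series and decays like \<open>exp (- 2 \<Delta> x)\<close>, which
  compensates the growth of the kernel. The edges next to the critical line are controlled by the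
  hypothesis on \<open>logL\<close>.
\<close>
lemma smoothed_log_approximation:
  assumes \<Delta>: "\<Delta> \<ge> 1" and U: "U \<ge> 2" and \<sigma>: "1/2 < \<sigma>" "\<sigma> \<le> 1" and t: "t - U > 0" and B: "B \<ge> 0"
    and h: "\<And>x y. x > 1/2 \<Longrightarrow> x \<le> 4 \<Longrightarrow> \<bar>y - t\<bar> \<le> U \<Longrightarrow> norm (logL (Complex x y)) \<le> B * (1 + (x - 1/2) powr (-1/2))"
  shows "norm (integral {-U..U} (\<lambda>u. (logL (Complex \<sigma> (t + u)) - log_poly (exp (2 * \<Delta>)) (Complex \<sigma> (t + u))) * of_real (fejer \<Delta> u)))
     \<le> exp (4 * \<Delta>) / U\<^sup>2 * (12 * B + 4 * exp (2 * \<Delta>) + 4 * U * prime_power_sum)"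
proof -
  define X where "X = exp (2 * \<Delta>)"
  define s0 where "s0 = Complex \<sigma> t"
  define V where "V = {w. s0 + w \<in> upper_right}"
  have V_eq: "V = {w. Re w > 1/2 - \<sigma>} \<inter> {w. Im w > - t}" by (auto simp: V_def upper_right_def s0_def)
  have V: "open V" "convex V"
    unfolding V_eq by (intro open_Int open_halfspace_Re_gt open_halfspace_Im_gt convex_Int convex_halfspace_Re_gt convex_halfspace_Im_gt)+
  \<comment> \<open>The variable \<open>w\<close> is the displacement from \<open>\<sigma> + it\<close>; at \<open>w = iu\<close> this is the integrand of the lemma.\<close>
  define W where "W w = (logL (s0 + w) - log_poly X (s0 + w)) * fejer_c \<Delta> (- \<i> * w)" for w
  have "(logL \<circ> (\<lambda>w. s0 + w)) holomorphic_on V"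
    by (rule holomorphic_on_compose_gen[OF _ logL_holomorphic]) (auto intro!: holomorphic_intros simp: V_def)
  moreover have "(log_poly X \<circ> (\<lambda>w. s0 + w)) holomorphic_on V"
    by (rule holomorphic_on_compose_gen[OF _ log_poly_holomorphic[of X UNIV]]) (auto intro!: holomorphic_intros)
  moreover have "(fejer_c \<Delta> \<circ> (\<lambda>w. - \<i> * w)) holomorphic_on V"
    by (rule holomorphic_on_compose_gen[OF _ fejer_c_holomorphic[of \<Delta> UNIV]]) (auto intro!: holomorphic_intros)
  ultimately have "W holomorphic_on V" unfolding W_def o_def by (intro holomorphic_intros)
  then obtain F where "\<And>w. w \<in> V \<Longrightarrow> (F has_field_derivative W w) (at w within V)"
    using holomorphic_convex_primitive'[OF V(2,1)] by metis
  then have F: "(F has_field_derivative W w) (at w)" if "w \<in> V" for w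
    using that at_within_open[OF that V(1)] by metis
  have inV: "Complex x y \<in> V" if "x \<ge> 0" "\<bar>y\<bar> \<le> U" for x y
    using that t \<sigma> by (auto simp: V_eq)
  have F_y: "((\<lambda>y. F (Complex x y)) has_vector_derivative \<i> * W (Complex x y)) (at y)" if "x \<ge> 0" "\<bar>y\<bar> \<le> U" for x y
  proof -
    have "((\<lambda>y. Complex x y) has_vector_derivative \<i>) (at y)"
      unfolding Complex_eq by (auto intro!: derivative_eq_intros simp: has_vector_derivative_def scaleR_conv_of_real)
    from field_vector_diff_chain_at[OF this F[OF inV[OF that]]] show ?thesis by (simp add: o_def)
  qed
  have F_x: "((\<lambda>x. F (Complex x y)) has_vector_derivative W (Complex x y)) (at x)" if "x \<ge> 0" "\<bar>y\<bar> \<le> U" for x y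
  proof -
    have "((\<lambda>x. Complex x y) has_vector_derivative 1) (at x)"
      unfolding Complex_eq by (auto intro!: derivative_eq_intros simp: has_vector_derivative_def scaleR_conv_of_real)
    from field_vector_diff_chain_at[OF this F[OF inV[OF that]]] show ?thesis by (simp add: o_def)
  qed
  define E where "E = exp (4 * \<Delta>) / U\<^sup>2"
  have E: "E > 0" using U by (simp add: E_def)
  have pps: "prime_power_sum \<ge> 0" by (rule prime_power_sum_nonneg)
  have K: "norm (fejer_c \<Delta> (- \<i> * Complex x y)) \<le> exp (2 * \<Delta> * x) / U\<^sup>2"
    if "x \<ge> 0" "\<bar>y\<bar> = U \<or> x = U" for x y
  proof -
    have n: "norm (- \<i> * Complex x y) \<ge> U"
      using that(2) abs_Re_le_cmod[of "Complex x y"] abs_Im_le_cmod[of "Complex x y"] U by (auto simp: norm_mult)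
    have "norm (fejer_c \<Delta> (- \<i> * Complex x y)) \<le> exp (2 * \<Delta> * \<bar>Im (- \<i> * Complex x y)\<bar>) / (\<Delta> * U\<^sup>2)"
      by (rule norm_fejer_c[OF _ _ n]) (use \<Delta> U in auto)
    also have "\<dots> \<le> exp (2 * \<Delta> * x) / (1 * U\<^sup>2)"
      using that \<Delta> U by (intro frac_le mult_mono) auto
    finally show ?thesis by simp
  qed
  have far: "norm (W (Complex x y)) \<le> E * prime_power_sum"
    if x: "x \<ge> 2" and y: "\<bar>y\<bar> \<le> U" "\<bar>y\<bar> = U \<or> x = U" for x y
  proof -
    have s: "s0 + Complex x y = Complex (\<sigma> + x) (t + y)" by (simp add: s0_def complex_eq_iff)
    have "norm (logL (s0 + Complex x y) - log_poly X (s0 + Complex x y)) \<le> X powr (2 - (\<sigma> + x)) * prime_power_sum"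
      unfolding s using norm_logL_minus_poly[of "Complex (\<sigma> + x) (t + y)" X] x y \<sigma> t by (simp add: X_def)
    then have "norm (W (Complex x y)) \<le> (X powr (2 - (\<sigma> + x)) * prime_power_sum) * (exp (2 * \<Delta> * x) / U\<^sup>2)"
      unfolding W_def norm_mult using x pps by (intro mult_mono K y) auto
    also have "\<dots> = exp (2 * \<Delta> * (2 - \<sigma>)) / U\<^sup>2 * prime_power_sum"
      by (simp add: X_def powr_def mult_exp_exp algebra_simps)
    also have "\<dots> \<le> E * prime_power_sum"
      unfolding E_def using \<Delta> \<sigma> pps by (intro mult_right_mono divide_right_mono) auto
    finally show ?thesis .
  qed
  have near: "norm (W (Complex x y)) \<le> E * (B * (1 + x powr (-1/2)) + X)"
    if x: "0 < x" "x \<le> 2" and y: "\<bar>y\<bar> = U" for x y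
  proof -
    have s: "s0 + Complex x y = Complex (\<sigma> + x) (t + y)" by (simp add: s0_def complex_eq_iff)
    have "norm (logL (Complex (\<sigma> + x) (t + y))) \<le> B * (1 + (\<sigma> + x - 1/2) powr (-1/2))"
      by (rule h) (use x y \<sigma> in auto)
    also have "\<dots> \<le> B * (1 + x powr (-1/2))"
      using x \<sigma> B by (intro mult_left_mono add_left_mono powr_mono2') auto
    finally have "norm (logL (s0 + Complex x y) - log_poly X (s0 + Complex x y)) \<le> B * (1 + x powr (-1/2)) + X"
      unfolding s using norm_log_poly[of X "Complex (\<sigma> + x) (t + y)"] x \<sigma>
      by (intro order.trans[OF norm_triangle_ineq4] add_mono) (auto simp: X_def)
    then have "norm (W (Complex x y)) \<le> (B * (1 + x powr (-1/2)) + X) * (exp (2 * \<Delta> * x) / U\<^sup>2)"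
      unfolding W_def norm_mult using x y B by (intro mult_mono K) (auto simp: X_def)
    also have "\<dots> \<le> (B * (1 + x powr (-1/2)) + X) * (exp (2 * \<Delta> * 2) / U\<^sup>2)"
      using x B \<Delta> by (intro mult_left_mono divide_right_mono) (auto simp: X_def)
    finally show ?thesis by (simp add: E_def mult_ac)
  qed
  have side1: "norm (F (Complex 2 y) - F (Complex 0 y)) \<le> E * (6 * B + 2 * X)" if y: "\<bar>y\<bar> = U" for y
  proof -
    \<comment> \<open>An antiderivative of the bound \<open>near\<close>, continuous down to \<open>x = 0\<close>.\<close>
    define \<phi> where "\<phi> x = E * (B * (x + 2 * sqrt x) + X * x)" for x
    have "norm (F (Complex 2 y) - F (Complex 0 y)) \<le> \<phi> 2 - \<phi> 0"
    proof (rule differentiable_bound_general)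
      show "continuous_on {0..2} (\<lambda>x. F (Complex x y))"
        using F_x[of _ y] y by (intro continuous_at_imp_continuous_on) (auto intro!: has_vector_derivative_continuous)
      show "continuous_on {0..2} \<phi>"
        unfolding \<phi>_def by (intro continuous_intros)
      fix x :: real assume x: "0 < x" "x < 2"
      show "((\<lambda>x. F (Complex x y)) has_vector_derivative W (Complex x y)) (at x)" by (rule F_x) (use x y in auto)
      show "(\<phi> has_vector_derivative E * (B * (1 + x powr (-1/2)) + X)) (at x)"
        unfolding has_real_derivative_iff_has_vector_derivative[symmetric] \<phi>_def
        using x by (auto intro!: derivative_eq_intros simp: powr_minus powr_half_sqrt)
      show "norm (W (Complex x y)) \<le> E * (B * (1 + x powr (-1/2)) + X)" by (rule near) (use x y in auto)
    qed simp
    also have "\<dots> \<le> E * (6 * B + 2 * X)"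
    proof -
      have "sqrt 2 \<le> (2::real)" by (rule real_le_lsqrt) auto
      then have "B * (2 + 2 * sqrt 2) \<le> B * 6" using B by (intro mult_left_mono) auto
      then have "E * (B * (2 + 2 * sqrt 2) + X * 2) \<le> E * (B * 6 + X * 2)" using E by (intro mult_left_mono) auto
      then show ?thesis by (simp add: \<phi>_def mult.commute[of B] mult.commute[of X])
    qed
    finally show ?thesis .
  qed
  have side2: "norm (F (Complex U y) - F (Complex 2 y)) \<le> E * prime_power_sum * U" if y: "\<bar>y\<bar> = U" for y
  proof -
    have "norm (F (Complex U y) - F (Complex 2 y)) \<le> (E * prime_power_sum) * norm (Complex U y - Complex 2 y)"
    proof (rule field_differentiable_bound[where S = "closed_segment (Complex 2 y) (Complex U y)"])
      fix w assume "w \<in> closed_segment (Complex 2 y) (Complex U y)"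
      then have w: "w = Complex (Re w) y" "Re w \<ge> 2"
        using U by (auto simp: closed_segment_same_Im closed_segment_eq_real_ivl complex_eq_iff)
      have "w \<in> V" by (subst w(1), rule inV) (use w y in auto)
      then show "(F has_field_derivative W w) (at w within closed_segment (Complex 2 y) (Complex U y))"
        by (rule has_field_derivative_at_within[OF F])
      show "norm (W w) \<le> E * prime_power_sum" by (subst w(1), rule far) (use w y in auto)
    qed auto
    also have "Complex U y - Complex 2 y = of_real (U - 2)" by (simp add: complex_eq_iff)
    also have "(E * prime_power_sum) * norm (of_real (U - 2) :: complex) \<le> E * prime_power_sum * U"
      unfolding norm_of_real using U E pps by (intro mult_left_mono) auto
    finally show ?thesis .
  qed
  have side3: "norm (F (Complex U U) - F (Complex U (-U))) \<le> E * prime_power_sum * (2 * U)"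
  proof -
    have "norm (F (Complex U U) - F (Complex U (-U))) \<le> (E * prime_power_sum) * norm (Complex U U - Complex U (-U))"
    proof (rule field_differentiable_bound[where S = "closed_segment (Complex U (-U)) (Complex U U)"])
      fix w assume "w \<in> closed_segment (Complex U (-U)) (Complex U U)"
      then have w: "w = Complex U (Im w)" "\<bar>Im w\<bar> \<le> U"
        using U by (auto simp: closed_segment_same_Re closed_segment_eq_real_ivl complex_eq_iff)
      have "w \<in> V" by (subst w(1), rule inV) (use w U in auto)
      then show "(F has_field_derivative W w) (at w within closed_segment (Complex U (-U)) (Complex U U))"
        by (rule has_field_derivative_at_within[OF F])
      show "norm (W w) \<le> E * prime_power_sum" by (subst w(1), rule far) (use w U in auto)
    qed auto
    also have "Complex U U - Complex U (-U) = \<i> * of_real (2 * U)" by (simp add: complex_eq_iff)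
    finally show ?thesis using U by (simp add: norm_mult)
  qed
  have "((\<lambda>y. \<i> * W (Complex 0 y)) has_integral (F (Complex 0 U) - F (Complex 0 (-U)))) {-U..U}"
  proof (rule fundamental_theorem_of_calculus)
    fix y assume "y \<in> {-U..U}"
    then have "\<bar>y\<bar> \<le> U" by auto
    then have "((\<lambda>y. F (Complex 0 y)) has_vector_derivative \<i> * W (Complex 0 y)) (at y)"
      by (rule F_y[OF order.refl])
    then show "((\<lambda>y. F (Complex 0 y)) has_vector_derivative \<i> * W (Complex 0 y)) (at y within {-U..U})"
      by (rule has_vector_derivative_at_within)
  qed (use U in auto)
  then have "integral {-U..U} (\<lambda>y. \<i> * W (Complex 0 y)) = F (Complex 0 U) - F (Complex 0 (-U))"
    by (rule integral_unique)
  then have "norm (\<i> * integral {-U..U} (\<lambda>y. W (Complex 0 y))) = norm (F (Complex 0 U) - F (Complex 0 (-U)))"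
    by (simp only: integral_mult_right)
  moreover have "W (Complex 0 y) = (logL (Complex \<sigma> (t + y)) - log_poly X (Complex \<sigma> (t + y))) * of_real (fejer \<Delta> y)" for y
  proof -
    have "- \<i> * Complex 0 y = of_real y" "s0 + Complex 0 y = Complex \<sigma> (t + y)"
      by (simp_all add: complex_eq_iff s0_def)
    then show ?thesis by (simp only: W_def fejer_c_of_real)
  qed
  ultimately have eq: "norm (integral {-U..U} (\<lambda>u. (logL (Complex \<sigma> (t + u)) - log_poly X (Complex \<sigma> (t + u))) * of_real (fejer \<Delta> u)))
      = norm (F (Complex 0 U) - F (Complex 0 (-U)))"
    by (simp add: norm_mult)
  have tri: "norm (a - b) \<le> norm (a' - a) + norm (a'' - a') + norm (a'' - b'') + norm (b'' - b') + norm (b' - b)"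
    for a a' a'' b b' b'' :: complex
  proof -
    have "a - b = (a'' - b'') + (b'' - b') + (b' - b) - (a' - a) - (a'' - a')" by simp
    then show ?thesis by (smt (verit) norm_triangle_ineq norm_triangle_ineq4)
  qed
  have "norm (F (Complex 0 U) - F (Complex 0 (-U))) \<le> E * (6 * B + 2 * X) + E * prime_power_sum * U
      + E * prime_power_sum * (2 * U) + E * prime_power_sum * U + E * (6 * B + 2 * X)"
    using U by (intro order.trans[OF tri[of _ _ "F (Complex 2 U)" "F (Complex U U)" "F (Complex U (-U))" "F (Complex 2 (-U))"]]
        add_mono side1 side2 side3) auto
  also have "\<dots> = E * (12 * B + 4 * X + 4 * U * prime_power_sum)" by (simp add: algebra_simps)
  finally show ?thesis unfolding eq E_def X_def[symmetric] .
qed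

end

section \<open>Mean values of Dirichlet polynomials\<close>

lemma norm_integral_cis_le:
  assumes "\<alpha> \<noteq> 0" "A \<le> B"
  shows "norm (integral {A..B} (\<lambda>t. cis (\<alpha> * t))) \<le> 2 / \<bar>\<alpha>\<bar>"
proof -
  define F where "F t = cis (\<alpha> * t) / (\<i> * of_real \<alpha>)" for t
  have "((\<lambda>t. cis (\<alpha> * t)) has_integral (F B - F A)) {A..B}"
  proof (rule fundamental_theorem_of_calculus[OF assms(2)])
    fix t assume "t \<in> {A..B}"
    have "((\<lambda>t. exp (\<i> * of_real \<alpha> * of_real t) / (\<i> * of_real \<alpha>)) has_vector_derivative
            (exp (\<i> * of_real \<alpha> * of_real t) * (\<i> * of_real \<alpha>)) / (\<i> * of_real \<alpha>)) (at t within {A..B})"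
      by (rule has_vector_derivative_real_field) (auto intro!: derivative_eq_intros)
    moreover have "F = (\<lambda>t. exp (\<i> * of_real \<alpha> * of_real t) / (\<i> * of_real \<alpha>))"
      by (auto simp: F_def cis_conv_exp mult_ac fun_eq_iff)
    ultimately show "(F has_vector_derivative cis (\<alpha> * t)) (at t within {A..B})"
      using assms by (simp add: cis_conv_exp mult_ac)
  qed
  then have "integral {A..B} (\<lambda>t. cis (\<alpha> * t)) = F B - F A" by (rule integral_unique)
  also have "norm \<dots> \<le> norm (F B) + norm (F A)" by (rule norm_triangle_ineq4)
  also have "\<dots> = 2 / \<bar>\<alpha>\<bar>" by (simp add: F_def norm_divide norm_mult)
  finally show ?thesis .
qed

text \<open>
  Two distinct integers up to \<open>X\<close> have a ratio of at least \<open>1 + 1 / (X - 1)\<close>.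
\<close>
lemma ln_separation:
  assumes "m \<noteq> n" "1 \<le> m" "1 \<le> n" "real m \<le> X" "real n \<le> X"
  shows "1 / X \<le> \<bar>ln (real n) - ln (real m)\<bar>"
proof -
  have *: "1 / X \<le> ln (real n) - ln (real m)" if mn: "m < n" "1 \<le> m" "real n \<le> X" for m n
  proof -
    have "ln (real m) - ln (real n) = ln (real m / real n)" using mn by (simp add: ln_div)
    also have "\<dots> \<le> real m / real n - 1" using mn by (intro ln_le_minus_one) auto
    also have "\<dots> \<le> (real n - 1) / real n - 1" using mn by (intro diff_right_mono divide_right_mono) auto
    also have "\<dots> = - (1 / real n)" using mn by (simp add: field_simps)
    finally have "1 / real n \<le> ln (real n) - ln (real m)" by simp
    moreover have "1 / X \<le> 1 / real n" using mn by (intro divide_left_mono) auto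
    ultimately show ?thesis by linarith
  qed
  show ?thesis
  proof (cases "m < n")
    case True
    then show ?thesis using *[of m n] assms by simp
  next
    case False
    then show ?thesis using *[of n m] assms by simp
  qed
qed

text \<open>
  The diagonal terms give \<open>B - A\<close>. Off the diagonal the frequencies differ by at least \<open>1/X\<close>, so each
  oscillating integral is at most \<open>2 X\<close>, and the sum of the products of the coefficients is estimated by
  Cauchy--Schwarz with \<open>card N \<le> X\<close>.
\<close>
lemma dirichlet_polynomial_mean_value:
  assumes N: "finite N" "\<And>n. n \<in> N \<Longrightarrow> 1 \<le> n \<and> real n \<le> X" and X: "X \<ge> 0" and j: "j \<ge> 1" and AB: "A \<le> B"
  shows "integral {A..B} (\<lambda>t. (norm (\<Sum>n\<in>N. b n * cis (- (j * t * ln (real n)))))\<^sup>2)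
           \<le> (B - A + 2 * X\<^sup>2) * (\<Sum>n\<in>N. (norm (b n))\<^sup>2)"
proof -
  define D where "D t = (\<Sum>n\<in>N. b n * cis (- (j * t * ln (real n))))" for t
  define \<alpha> where "\<alpha> m n = j * (ln (real n) - ln (real m))" for m n :: nat
  have sq: "complex_of_real ((norm (D t))\<^sup>2) = (\<Sum>m\<in>N. \<Sum>n\<in>N. b m * cnj (b n) * cis (\<alpha> m n * t))" for t
    unfolding complex_norm_square D_def cnj_sum sum_product
    by (intro sum.cong refl) (simp add: cis_mult cis_cnj \<alpha>_def algebra_simps)
  have contD: "continuous_on {A..B} (\<lambda>t. (norm (D t))\<^sup>2)"
    unfolding D_def cis_conv_exp by (intro continuous_intros)
  have cc: "continuous_on {A..B} (\<lambda>t. cis (\<beta> * t))" for \<beta>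
    unfolding cis_conv_exp by (intro continuous_intros)
  have ci: "(\<lambda>t. c * cis (\<beta> * t)) integrable_on {A..B}" for c \<beta>
    by (intro integrable_continuous_real continuous_on_mult continuous_on_const cc)
  have "complex_of_real (integral {A..B} (\<lambda>t. (norm (D t))\<^sup>2)) = integral {A..B} (\<lambda>t. complex_of_real ((norm (D t))\<^sup>2))"
    using integral_linear[OF integrable_continuous_real[OF contD] bounded_linear_of_real[where 'a = complex]]
    by (simp add: o_def)
  also have "\<dots> = (\<Sum>m\<in>N. \<Sum>n\<in>N. b m * cnj (b n) * integral {A..B} (\<lambda>t. cis (\<alpha> m n * t)))"
    unfolding sq using N(1) ci by (simp add: integral_sum integrable_sum)
  finally have eq: "complex_of_real (integral {A..B} (\<lambda>t. (norm (D t))\<^sup>2))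
     = (\<Sum>m\<in>N. \<Sum>n\<in>N. b m * cnj (b n) * integral {A..B} (\<lambda>t. cis (\<alpha> m n * t)))" .
  have le: "norm (integral {A..B} (\<lambda>t. cis (\<alpha> m n * t))) \<le> (if m = n then B - A else 0) + 2 * X"
    if mn: "m \<in> N" "n \<in> N" for m n
  proof (cases "m = n")
    case True
    then show ?thesis using AB X by (simp add: \<alpha>_def)
  next
    case False
    have sep: "1 / X \<le> \<bar>ln (real n) - ln (real m)\<bar>"
      by (rule ln_separation) (use N(2) mn False in auto)
    have X1: "X \<ge> 1" using N(2)[OF mn(1)] by linarith
    then have pos: "0 < 1 / X" by simp
    have "1 * \<bar>ln (real n) - ln (real m)\<bar> \<le> \<bar>\<alpha> m n\<bar>"
      unfolding \<alpha>_def abs_mult using j by (intro mult_right_mono) auto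
    then have \<alpha>: "1 / X \<le> \<bar>\<alpha> m n\<bar>" using order.trans[OF sep] by simp
    then have "\<alpha> m n \<noteq> 0" using pos by auto
    then have "norm (integral {A..B} (\<lambda>t. cis (\<alpha> m n * t))) \<le> 2 / \<bar>\<alpha> m n\<bar>"
      using norm_integral_cis_le AB by blast
    also have "\<dots> \<le> 2 / (1 / X)"
      by (rule divide_left_mono[OF \<alpha>]) (use \<open>\<alpha> m n \<noteq> 0\<close> pos in \<open>auto intro: mult_pos_pos\<close>)
    finally show ?thesis using False by simp
  qed
  have "integral {A..B} (\<lambda>t. (norm (D t))\<^sup>2) \<le> norm (complex_of_real (integral {A..B} (\<lambda>t. (norm (D t))\<^sup>2)))"
    by simp
  also have "\<dots> \<le> (\<Sum>m\<in>N. \<Sum>n\<in>N. norm (b m) * norm (b n) * ((if m = n then B - A else 0) + 2 * X))"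
    unfolding eq
  proof (intro order.trans[OF norm_sum] sum_mono)
    fix m n assume mn: "m \<in> N" "n \<in> N"
    show "norm (b m * cnj (b n) * integral {A..B} (\<lambda>t. cis (\<alpha> m n * t)))
        \<le> norm (b m) * norm (b n) * ((if m = n then B - A else 0) + 2 * X)"
      unfolding norm_mult complex_mod_cnj by (rule mult_left_mono[OF le[OF mn]]) auto
  qed
  also have "\<dots> = (\<Sum>m\<in>N. (norm (b m))\<^sup>2 * (B - A)) + 2 * X * (\<Sum>m\<in>N. \<Sum>n\<in>N. norm (b m) * norm (b n))"
  proof -
    have "(\<Sum>n\<in>N. norm (b m) * norm (b n) * ((if m = n then B - A else 0) + 2 * X))
       = (norm (b m))\<^sup>2 * (B - A) + 2 * X * (\<Sum>n\<in>N. norm (b m) * norm (b n))" if "m \<in> N" for m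
    proof -
      have "(\<Sum>n\<in>N. norm (b m) * norm (b n) * ((if m = n then B - A else 0) + 2 * X))
        = (\<Sum>n\<in>N. (if m = n then norm (b m) * norm (b n) * (B - A) else 0) + 2 * X * (norm (b m) * norm (b n)))"
        by (intro sum.cong refl) (simp add: algebra_simps)
      also have "\<dots> = norm (b m) * norm (b m) * (B - A) + 2 * X * (\<Sum>n\<in>N. norm (b m) * norm (b n))"
        using that N(1) by (simp add: sum.distrib sum_distrib_left)
      finally show ?thesis by (simp add: power2_eq_square)
    qed
    then show ?thesis by (simp add: sum.distrib sum_distrib_left)
  qed
  also have "(\<Sum>m\<in>N. \<Sum>n\<in>N. norm (b m) * norm (b n)) = (\<Sum>m\<in>N. norm (b m))\<^sup>2"
    by (simp add: power2_eq_square sum_product)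
  also have "(\<Sum>m\<in>N. (norm (b m))\<^sup>2 * (B - A)) + 2 * X * (\<Sum>m\<in>N. norm (b m))\<^sup>2
      \<le> (\<Sum>m\<in>N. (norm (b m))\<^sup>2 * (B - A)) + 2 * X * (X * (\<Sum>m\<in>N. (norm (b m))\<^sup>2))"
  proof -
    have "(\<Sum>m\<in>N. norm (b m))\<^sup>2 \<le> (\<Sum>m\<in>N. (norm (b m))\<^sup>2) * card N"
      by (rule sum_squared_le_sum_of_squares)
    also have "\<dots> \<le> (\<Sum>m\<in>N. (norm (b m))\<^sup>2) * X"
    proof -
      have "N \<subseteq> {1..nat \<lfloor>X\<rfloor>}" using N(2) by (auto simp: le_nat_floor)
      then have "card N \<le> card {1..nat \<lfloor>X\<rfloor>}" by (intro card_mono) auto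
      then have "real (card N) \<le> real (nat \<lfloor>X\<rfloor>)" by simp
      then have "real (card N) \<le> X" using X by linarith
      then show ?thesis by (intro mult_left_mono sum_nonneg) auto
    qed
    finally show ?thesis using X by (intro add_left_mono mult_left_mono) (auto simp: mult.commute)
  qed
  also have "\<dots> = (B - A + 2 * X\<^sup>2) * (\<Sum>m\<in>N. (norm (b m))\<^sup>2)"
    unfolding sum_distrib_right[symmetric] by (simp add: algebra_simps power2_eq_square)
  finally show ?thesis unfolding D_def .
qed

text \<open>
  By unique factorization all these lists are permutations of a single multiset.
\<close>
lemma card_prime_lists_with_product:
  assumes S: "\<And>p. p \<in> S \<Longrightarrow> prime (p :: nat)"
  shows "finite {xs. set xs \<subseteq> S \<and> length xs = k \<and> prod_list xs = n}"
    "card {xs. set xs \<subseteq> S \<and> length xs = k \<and> prod_list xs = n} \<le> fact k"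
proof -
  let ?W = "{xs. set xs \<subseteq> S \<and> length xs = k \<and> prod_list xs = n}"
  have pf: "prime_factorization (prod_list xs) = mset xs" if "set xs \<subseteq> S" for xs
    using prime_factorization_prod_mset_primes[of "mset xs"] S that by (auto simp: prod_mset_prod_list)
  have "finite ?W \<and> card ?W \<le> fact k"
  proof (cases "?W = {}")
    case True
    then show ?thesis by (simp only:) simp
  next
    case False
    then obtain xs0 where xs0: "xs0 \<in> ?W" by blast
    have sub: "?W \<subseteq> permutations_of_multiset (mset xs0)"
    proof
      fix xs assume "xs \<in> ?W"
      then have "mset xs = mset xs0" using pf[of xs] pf[of xs0] xs0 by auto
      then show "xs \<in> permutations_of_multiset (mset xs0)" by (simp add: permutations_of_multiset_def)
    qed
    moreover have "card (permutations_of_multiset (mset xs0)) \<le> fact k"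
      unfolding card_permutations_of_multiset using xs0 by (auto intro: div_le_dividend)
    ultimately show ?thesis
      using finite_subset[OF sub] card_mono[OF _ sub] by fastforce
  qed
  then show "finite ?W" "card ?W \<le> fact k" by auto
qed

lemma sum_power_lists:
  fixes f :: "'b \<Rightarrow> 'c :: comm_semiring_1"
  assumes "finite S"
  shows "(\<Sum>p\<in>S. f p) ^ k = (\<Sum>xs | set xs \<subseteq> S \<and> length xs = k. \<Prod>p\<leftarrow>xs. f p)"
proof (induction k)
  case 0
  have "{xs. set xs \<subseteq> S \<and> length xs = 0} = {[]}" by auto
  then show ?case by simp
next
  case (Suc k)
  let ?W = "{xs. set xs \<subseteq> S \<and> length xs = k}"
  have "{xs. set xs \<subseteq> S \<and> length xs = Suc k} = (\<lambda>(p, xs). p # xs) ` (S \<times> ?W)"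
  proof (intro equalityI subsetI)
    fix xs assume "xs \<in> {xs. set xs \<subseteq> S \<and> length xs = Suc k}"
    then show "xs \<in> (\<lambda>(p, xs). p # xs) ` (S \<times> ?W)" by (cases xs) auto
  qed auto
  then have "(\<Sum>xs | set xs \<subseteq> S \<and> length xs = Suc k. \<Prod>p\<leftarrow>xs. f p)
     = (\<Sum>(p, xs)\<in>S \<times> ?W. f p * (\<Prod>p\<leftarrow>xs. f p))"
    by (simp add: sum.reindex inj_on_def case_prod_unfold)
  also have "\<dots> = (\<Sum>p\<in>S. \<Sum>xs\<in>?W. f p * (\<Prod>p\<leftarrow>xs. f p))"
    by (rule sum.cartesian_product[symmetric])
  also have "\<dots> = (\<Sum>p\<in>S. f p) * (\<Sum>p\<in>S. f p) ^ k"
    by (simp add: Suc sum_product)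
  finally show ?case by simp
qed

text \<open>
  The \<open>k\<close>-th power of the polynomial is a Dirichlet polynomial of length \<open>x\<^sup>k\<close> whose coefficient at \<open>n\<close> is
  a sum over the lists of \<open>k\<close> primes with product \<open>n\<close>. There are at most \<open>k!\<close> of them, so by
  Cauchy--Schwarz the sum of the squares of the coefficients is at most \<open>k!\<close> times the sum over all lists,
  which is again a \<open>k\<close>-th power. The parameter \<open>j\<close> makes the lemma applicable to squares of primes,
  where \<open>p\<^sup>2\<close> has the frequency \<open>2 ln p\<close>.
\<close>
theorem prime_polynomial_moment:
  assumes S: "finite S" "\<And>p. p \<in> S \<Longrightarrow> prime p \<and> real p \<le> x" and x: "x \<ge> 1" and j: "j \<ge> 1" and AB: "A \<le> B"
  shows "integral {A..B} (\<lambda>t. norm (\<Sum>p\<in>S. a p * cis (- (j * t * ln (real p)))) ^ (2 * k))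
           \<le> (B - A + 2 * x ^ (2 * k)) * (fact k * (\<Sum>p\<in>S. (norm (a p))\<^sup>2) ^ k)"
proof -
  define W where "W = {xs. set xs \<subseteq> S \<and> length xs = k}"
  have finW: "finite W" unfolding W_def using finite_lists_length_eq[OF S(1)] by simp
  define \<alpha> where "\<alpha> xs = (\<Prod>p\<leftarrow>xs. a p)" for xs
  define N where "N = prod_list ` W"
  define V where "V n = {xs. set xs \<subseteq> S \<and> length xs = k \<and> prod_list xs = n}" for n
  have VW: "V n = {xs \<in> W. prod_list xs = n}" for n by (auto simp: V_def W_def)
  define b where "b n = (\<Sum>xs\<in>V n. \<alpha> xs)" for n
  have prod_pos: "1 \<le> prod_list xs \<and> real (prod_list xs) \<le> x ^ length xs" if "set xs \<subseteq> S" for xs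
    using that
  proof (induction xs)
    case (Cons p xs)
    have "prime p" "real p \<le> x" using S(2)[of p] Cons.prems by auto
    then have "1 \<le> p" using prime_gt_0_nat[OF \<open>prime p\<close>] by simp
    moreover have xs: "1 \<le> prod_list xs" "real (prod_list xs) \<le> x ^ length xs" using Cons by auto
    ultimately have "1 * 1 \<le> p * prod_list xs" by (intro mult_mono) auto
    moreover have "real p * real (prod_list xs) \<le> x * x ^ length xs"
      using \<open>real p \<le> x\<close> xs x by (intro mult_mono) auto
    ultimately show ?case by simp
  qed auto
  have cisprod: "(\<Prod>p\<leftarrow>xs. a p * cis (- (j * t * ln (real p)))) = \<alpha> xs * cis (- (j * t * ln (real (prod_list xs))))"
    if "set xs \<subseteq> S" for xs t
    using that
  proof (induction xs)
    case (Cons p xs)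
    have "1 \<le> prod_list xs" using prod_pos[of xs] Cons.prems by simp
    moreover have "p \<noteq> 0" using S(2)[of p] prime_gt_0_nat[of p] Cons.prems by auto
    ultimately have "ln (real (prod_list (p # xs))) = ln (real p) + ln (real (prod_list xs))"
      by (simp add: ln_mult)
    then have "cis (- (j * t * ln (real (prod_list (p # xs))))) = cis (- (j * t * ln (real p))) * cis (- (j * t * ln (real (prod_list xs))))"
      unfolding cis_mult by (simp add: algebra_simps)
    then show ?case using Cons by (simp add: \<alpha>_def)
  qed (simp add: \<alpha>_def)
  have expand: "(\<Sum>p\<in>S. a p * cis (- (j * t * ln (real p)))) ^ k = (\<Sum>n\<in>N. b n * cis (- (j * t * ln (real n))))" for t
  proof -
    have "(\<Sum>p\<in>S. a p * cis (- (j * t * ln (real p)))) ^ k = (\<Sum>xs\<in>W. \<alpha> xs * cis (- (j * t * ln (real (prod_list xs)))))"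
      unfolding sum_power_lists[OF S(1)] W_def by (intro sum.cong refl cisprod) auto
    also have "\<dots> = (\<Sum>n\<in>N. \<Sum>xs\<in>{xs\<in>W. prod_list xs = n}. \<alpha> xs * cis (- (j * t * ln (real (prod_list xs)))))"
      unfolding N_def by (rule sum.image_gen[OF finW])
    also have "\<dots> = (\<Sum>n\<in>N. b n * cis (- (j * t * ln (real n))))"
      unfolding b_def VW sum_distrib_right by (intro sum.cong refl) auto
    finally show ?thesis .
  qed
  have "norm (\<Sum>p\<in>S. a p * cis (- (j * t * ln (real p)))) ^ (2 * k) = (norm (\<Sum>n\<in>N. b n * cis (- (j * t * ln (real n)))))\<^sup>2" for t
    unfolding expand[symmetric] norm_power by (simp add: power_mult[symmetric] mult.commute)
  then have "integral {A..B} (\<lambda>t. norm (\<Sum>p\<in>S. a p * cis (- (j * t * ln (real p)))) ^ (2 * k))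
      = integral {A..B} (\<lambda>t. (norm (\<Sum>n\<in>N. b n * cis (- (j * t * ln (real n)))))\<^sup>2)" by simp
  also have "\<dots> \<le> (B - A + 2 * (x ^ k)\<^sup>2) * (\<Sum>n\<in>N. (norm (b n))\<^sup>2)"
  proof (rule dirichlet_polynomial_mean_value[OF _ _ _ j AB])
    show "1 \<le> n \<and> real n \<le> x ^ k" if "n \<in> N" for n using that prod_pos by (auto simp: N_def W_def)
  qed (use finW x in \<open>auto simp: N_def\<close>)
  also have "\<dots> \<le> (B - A + 2 * (x ^ k)\<^sup>2) * (fact k * (\<Sum>p\<in>S. (norm (a p))\<^sup>2) ^ k)"
  proof (rule mult_left_mono)
    have "(norm (b n))\<^sup>2 \<le> fact k * (\<Sum>xs\<in>{xs\<in>W. prod_list xs = n}. (norm (\<alpha> xs))\<^sup>2)" for n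
    proof -
      have fin: "finite (V n)" and card: "card (V n) \<le> fact k"
        unfolding V_def using card_prime_lists_with_product[of S k n] S(2) by auto
      have "norm (b n) \<le> (\<Sum>xs\<in>V n. norm (\<alpha> xs))" unfolding b_def by (rule norm_sum)
      then have "(norm (b n))\<^sup>2 \<le> (\<Sum>xs\<in>V n. norm (\<alpha> xs))\<^sup>2" by (intro power_mono) auto
      also have "\<dots> \<le> (\<Sum>xs\<in>V n. (norm (\<alpha> xs))\<^sup>2) * card (V n)"
        by (rule sum_squared_le_sum_of_squares)
      also have "\<dots> \<le> (\<Sum>xs\<in>V n. (norm (\<alpha> xs))\<^sup>2) * fact k"
      proof (intro mult_left_mono sum_nonneg)
        have "real (card (V n)) \<le> real (fact k)" using card by (simp only: of_nat_le_iff)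
        then show "real (card (V n)) \<le> fact k" by simp
      qed auto
      finally show ?thesis unfolding VW by (simp add: mult.commute)
    qed
    then have "(\<Sum>n\<in>N. (norm (b n))\<^sup>2) \<le> (\<Sum>n\<in>N. fact k * (\<Sum>xs\<in>{xs\<in>W. prod_list xs = n}. (norm (\<alpha> xs))\<^sup>2))"
      by (intro sum_mono)
    also have "\<dots> = fact k * (\<Sum>xs\<in>W. (norm (\<alpha> xs))\<^sup>2)"
      unfolding N_def sum.image_gen[OF finW, of _ prod_list] by (rule sum_distrib_left[symmetric])
    also have "(\<Sum>xs\<in>W. (norm (\<alpha> xs))\<^sup>2) = (\<Sum>p\<in>S. (norm (a p))\<^sup>2) ^ k"
    proof -
      have "(norm (\<alpha> xs))\<^sup>2 = (\<Prod>p\<leftarrow>xs. (norm (a p))\<^sup>2)" for xs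
        unfolding \<alpha>_def by (induction xs) (auto simp: norm_mult power_mult_distrib)
      then show ?thesis unfolding sum_power_lists[OF S(1)] W_def by simp
    qed
    finally show "(\<Sum>n\<in>N. (norm (b n))\<^sup>2) \<le> fact k * (\<Sum>p\<in>S. (norm (a p))\<^sup>2) ^ k" .
  qed (use AB in auto)
  finally show ?thesis by (simp add: power_mult[symmetric] mult.commute)
qed

section \<open>The sum of the reciprocals of the primes\<close>

text \<open>
  For \<open>p \<le> x\<close> and \<open>\<epsilon> = 1 / ln x\<close> the terms \<open>1 / p\<close> and \<open>p powr (- (1 + \<epsilon>))\<close> differ by a factor of at most
  \<open>e \<le> 3\<close>, and the sum of the latter is at most \<open>ln (zeta (1 + \<epsilon>)) \<le> ln (1 / \<epsilon> + O(1))\<close>.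
\<close>
lemma prime_reciprocal_sum_le:
  assumes x: "x \<ge> 3"
  shows "(\<Sum>p | prime p \<and> real p \<le> x. 1 / real p) \<le> 3 * ln (ln x + 2 * (\<Sum>n. real (Suc n) powr (-2)))"
proof -
  define Z where "Z = (\<Sum>n. real (Suc n) powr (-2))"
  have Z: "Z \<ge> 0" unfolding Z_def by (intro suminf_nonneg summable_Suc_powr) auto
  have lnx: "ln x \<ge> 1" using x exp_le by (subst ln_ge_iff) auto
  define \<epsilon> where "\<epsilon> = 1 / ln x"
  have \<epsilon>: "0 < \<epsilon>" "\<epsilon> \<le> 1" using lnx by (auto simp: \<epsilon>_def)
  define f where "f n = 1 * of_nat n powr (- complex_of_real (1 + \<epsilon>))" for n :: nat
  have "completely_multiplicative f (Re (of_real (1 + \<epsilon>)))" unfolding f_def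
    by (rule completely_multiplicative_twist[of "\<lambda>_. 1"]) (use \<epsilon> in auto)
  then interpret completely_multiplicative f "1 + \<epsilon>" by simp
  let ?t = "\<lambda>(p, m). f p ^ m / of_nat m"
  have fp: "f p = of_real (real p powr (- (1 + \<epsilon>)))" for p
    using powr_of_real[of "real p" "-(1 + \<epsilon>)"] by (simp add: f_def)
  have "(?t has_sum log_euler f) prime_power_index"
    unfolding log_euler_def using abs_summable_summable[OF log_euler_abs_summable] by simp
  then have hs: "((\<lambda>i. Re (?t i)) has_sum Re (log_euler f)) prime_power_index" by (rule has_sum_Re)
  have tnn: "Re (?t i) \<ge> 0" for i
  proof -
    obtain p m where i: "i = (p, m)" by force
    have "?t i = of_real ((real p powr (- (1 + \<epsilon>))) ^ m / real m)" by (simp add: i fp)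
    then show ?thesis by simp
  qed
  define P where "P = {p. prime p \<and> real p \<le> x}"
  have "P \<subseteq> {..nat \<lfloor>x\<rfloor>}" by (auto simp: P_def le_nat_floor)
  then have finP: "finite P" by (rule finite_subset) simp
  have "(\<Sum>p\<in>P. real p powr (- (1 + \<epsilon>))) = (\<Sum>i\<in>(\<lambda>p. (p, 1)) ` P. Re (?t i))"
    by (subst sum.reindex) (auto simp: inj_on_def fp)
  also have "\<dots> \<le> Re (log_euler f)"
    by (rule finite_sum_le_has_sum[OF hs]) (use finP tnn in \<open>auto simp: P_def prime_power_index_def\<close>)
  also have "\<dots> = ln (norm (exp (log_euler f)))" by simp
  also have "exp (log_euler f) = zeta (of_real (1 + \<epsilon>))"
    unfolding exp_log_euler
    by (rule sums_unique2[OF sums_infsum]) (use zeta_sums[of "of_real (1 + \<epsilon>)"] \<epsilon> in \<open>simp add: f_def\<close>)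
  also have "ln (norm (zeta (of_real (1 + \<epsilon>)))) \<le> ln (ln x + 2 * Z)"
  proof -
    let ?s = "of_real (1 + \<epsilon>) :: complex"
    have "norm (zeta ?s) \<le> norm (1 / (?s - 1)) + norm (zeta ?s - 1 / (?s - 1))"
      by (rule norm_triangle_sub)
    also have "norm (zeta ?s - 1 / (?s - 1)) \<le> norm ?s * Z"
      unfolding Z_def by (rule zeta_pole_bound) (use \<epsilon> in auto)
    also have "norm ?s * Z \<le> 2 * Z" using \<epsilon> Z by (intro mult_right_mono) (auto simp del: of_real_add)
    also have "norm (1 / (?s - 1)) = ln x" using lnx x by (simp add: norm_divide \<epsilon>_def)
    finally have le: "norm (zeta ?s) \<le> ln x + 2 * Z" by simp
    have "zeta ?s \<noteq> 0" unfolding \<open>exp (log_euler f) = zeta ?s\<close>[symmetric] by simp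
    then show ?thesis using le by (subst ln_le_cancel_iff) (auto intro: order.strict_trans2[OF _ le])
  qed
  finally have main: "(\<Sum>p\<in>P. real p powr (- (1 + \<epsilon>))) \<le> ln (ln x + 2 * Z)" .
  have "(\<Sum>p\<in>P. 1 / real p) \<le> (\<Sum>p\<in>P. 3 * real p powr (- (1 + \<epsilon>)))"
  proof (rule sum_mono)
    fix p assume "p \<in> P"
    then have p: "p > 0" "real p \<le> x" using prime_gt_0_nat by (auto simp: P_def)
    have "real p powr \<epsilon> \<le> x powr \<epsilon>" using p \<epsilon> by (intro powr_mono2) auto
    also have "x powr \<epsilon> = exp 1"
    proof -
      have "x \<noteq> 0" using \<open>x \<ge> 3\<close> by linarith
      then show ?thesis using lnx by (simp add: powr_def \<epsilon>_def)
    qed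
    also have "\<dots> \<le> 3" by (rule exp_le)
    finally have le: "real p powr \<epsilon> \<le> 3" .
    have "1 / real p = real p powr \<epsilon> * real p powr (- (1 + \<epsilon>))"
      using p by (simp add: powr_minus divide_inverse flip: powr_add)
    also have "\<dots> \<le> 3 * real p powr (- (1 + \<epsilon>))" using le by (intro mult_right_mono) auto
    finally show "1 / real p \<le> 3 * real p powr (- (1 + \<epsilon>))" .
  qed
  also have "\<dots> \<le> 3 * ln (ln x + 2 * Z)" using main by (simp flip: sum_distrib_left)
  finally show ?thesis unfolding P_def Z_def .
qed

section \<open>Absorbing the tails of the smoothing kernel\<close>

text \<open>
  The graph of a power lies above its tangent at \<open>y\<close>.
\<close>
lemma tangent_power:
  fixes x y :: real
  assumes "x \<ge> 0" "y \<ge> 0"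
  shows "y ^ Suc n + real (Suc n) * y ^ n * (x - y) \<le> x ^ Suc n"
proof (induction n)
  case (Suc n)
  have "0 \<le> real (Suc n) * y ^ n * (x - y)\<^sup>2" using assms by simp
  then have "y ^ Suc (Suc n) + real (Suc (Suc n)) * y ^ Suc n * (x - y) \<le> x * (y ^ Suc n + real (Suc n) * y ^ n * (x - y))"
    by (simp add: algebra_simps power2_eq_square)
  also have "\<dots> \<le> x * x ^ Suc n" using Suc assms by (intro mult_left_mono) auto
  finally show ?case by simp
qed simp

text \<open>
  The tangent inequality at the point \<open>y = (\<integral> w G) / \<theta>\<close>, integrated against \<open>w\<close>. The weight may have
  mass less than \<open>\<theta>\<close> because the tangent is nonpositive at 0.
\<close>
lemma jensen_power_integral:
  fixes w G :: "real \<Rightarrow> real"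
  assumes w: "continuous_on {c..d} w" "\<And>u. u \<in> {c..d} \<Longrightarrow> w u \<ge> 0"
    and G: "continuous_on {c..d} G" "\<And>u. u \<in> {c..d} \<Longrightarrow> G u \<ge> 0"
    and \<theta>: "\<theta> > 0" "integral {c..d} w \<le> \<theta>"
  shows "(integral {c..d} (\<lambda>u. w u * G u)) ^ Suc n \<le> \<theta> ^ n * integral {c..d} (\<lambda>u. w u * G u ^ Suc n)"
proof -
  define I where "I = integral {c..d} (\<lambda>u. w u * G u)"
  have wi: "w integrable_on {c..d}" by (rule integrable_continuous_real[OF w(1)])
  have wG: "(\<lambda>u. w u * G u) integrable_on {c..d}" by (intro integrable_continuous_real continuous_intros w G)
  have wGn: "(\<lambda>u. w u * G u ^ Suc n) integrable_on {c..d}" by (intro integrable_continuous_real continuous_intros w G)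
  have "I \<ge> 0" unfolding I_def using w G by (intro integral_nonneg wG) auto
  define y where "y = I / \<theta>"
  have y: "y \<ge> 0" "I = y * \<theta>" using \<open>I \<ge> 0\<close> \<theta> by (auto simp: y_def)
  define c1 where "c1 = real (Suc n) * y ^ n"
  have c1: "c1 \<ge> 0" using y by (simp add: c1_def)
  have "y ^ Suc n * \<theta> \<le> y ^ Suc n * \<theta> + (c1 * y - y ^ Suc n) * (\<theta> - integral {c..d} w)"
  proof -
    have "c1 * y - y ^ Suc n = real n * y ^ Suc n" by (simp add: c1_def algebra_simps)
    then show ?thesis using \<theta> y by simp
  qed
  also have "\<dots> = (y ^ Suc n - c1 * y) * integral {c..d} w + c1 * I"
    by (simp add: y(2) algebra_simps)
  also have "\<dots> = integral {c..d} (\<lambda>u. (y ^ Suc n - c1 * y) * w u + c1 * (w u * G u))"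
  proof (rule integral_unique[symmetric])
    show "((\<lambda>u. (y ^ Suc n - c1 * y) * w u + c1 * (w u * G u)) has_integral
        (y ^ Suc n - c1 * y) * integral {c..d} w + c1 * I) {c..d}"
      unfolding I_def by (intro has_integral_add has_integral_mult_right integrable_integral wi wG)
  qed
  also have "\<dots> \<le> integral {c..d} (\<lambda>u. w u * G u ^ Suc n)"
  proof (rule integral_le)
    show "(\<lambda>u. (y ^ Suc n - c1 * y) * w u + c1 * (w u * G u)) integrable_on {c..d}"
      by (intro integrable_continuous_real continuous_intros w G)
    fix u assume u: "u \<in> {c..d}"
    have "w u * (y ^ Suc n + c1 * (G u - y)) \<le> w u * G u ^ Suc n"
      unfolding c1_def using tangent_power[of "G u" y n] w(2)[OF u] G(2)[OF u] y by (intro mult_left_mono) auto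
    then show "(y ^ Suc n - c1 * y) * w u + c1 * (w u * G u) \<le> w u * G u ^ Suc n" by (simp add: algebra_simps)
  qed (rule wGn)
  finally have "y ^ Suc n * \<theta> \<le> integral {c..d} (\<lambda>u. w u * G u ^ Suc n)" .
  then have "\<theta> ^ n * (y ^ Suc n * \<theta>) \<le> \<theta> ^ n * integral {c..d} (\<lambda>u. w u * G u ^ Suc n)"
    using \<theta> by (intro mult_left_mono) auto
  moreover have "\<theta> ^ n * (y ^ Suc n * \<theta>) = I ^ Suc n" unfolding y(2) by (simp add: power_mult_distrib mult_ac)
  ultimately show ?thesis unfolding I_def by simp
qed

text \<open>
  The part of the convolution with the kernel in which \<open>Y\<close> is estimated by its own size. The tails
  start at \<open>16/\<Delta>\<close>, so that each has mass at most \<open>1/16\<close>. They are cut at distance 1: beyond it the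
  mass is at most \<open>1/\<Delta>\<close> on each side and the bound \<open>\<bar>Y\<bar> \<le> M\<close> suffices, and the cut confines the values
  of \<open>Y\<close> to a bounded neighbourhood of \<open>t\<close>.
\<close>
definition fejer_tail_mean :: "real \<Rightarrow> (real \<Rightarrow> real) \<Rightarrow> real \<Rightarrow> real" where
  "fejer_tail_mean \<Delta> Y t = integral {16 / \<Delta>..1} (\<lambda>u. fejer \<Delta> u * (\<bar>Y (t + u)\<bar> + \<bar>Y (t - u)\<bar>))"

lemma fejer_tail_mean_nonneg: "\<Delta> > 0 \<Longrightarrow> 0 \<le> fejer_tail_mean \<Delta> Y s"
  unfolding fejer_tail_mean_def
  by (cases "(\<lambda>u. fejer \<Delta> u * (\<bar>Y (s + u)\<bar> + \<bar>Y (s - u)\<bar>)) integrable_on {16 / \<Delta>..1}")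
     (auto intro!: integral_nonneg mult_nonneg_nonneg fejer_nonneg simp: not_integrable_integral)

text \<open>
  If \<open>Y t\<close> is large, then \<open>Y\<close> is still at least \<open>Y t - 2 h M\<close> on \<open>[t, t + 2 h]\<close>, which is the central part
  of the kernel placed at \<open>s = t + h\<close>. The loss is \<open>2 h M\<close> times the central mass, at most \<open>32\<close>, which
  makes \<open>1024 M / \<Delta>\<close>; the two parts beyond distance 1 add \<open>2 M / \<Delta>\<close>.
\<close>
lemma quasi_monotone_upper_bound:
  assumes \<Delta>: "\<Delta> \<ge> 16" and h: "h = 16 / \<Delta>" and U: "U \<ge> 1" and s: "s = t + h"
    and cont: "continuous_on {s - U..s + U} Y"
    and bd: "\<And>x. x \<in> {s - U..s + U} \<Longrightarrow> \<bar>Y x\<bar> \<le> M"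
    and mono: "\<And>x y. x \<in> {s - U..s + U} \<Longrightarrow> y \<in> {s - U..s + U} \<Longrightarrow> x \<le> y \<Longrightarrow> Y x - M * (y - x) \<le> Y y"
  shows "integral {-h..h} (fejer \<Delta>) * Y t
     \<le> integral {-U..U} (\<lambda>u. Y (s + u) * fejer \<Delta> u) + fejer_tail_mean \<Delta> Y s + 1026 * M / \<Delta>"
proof -
  have h01: "0 < h" "h \<le> 1" using \<Delta> by (auto simp: h field_simps)
  have \<Delta>0: "\<Delta> > 0" using \<Delta> by simp
  have M0: "M \<ge> 0" using bd[of s] U by (auto intro: order.trans[OF abs_ge_zero])
  define g where "g u = Y (s + u) * fejer \<Delta> u" for u
  have Ys: "continuous_on {a..b} (\<lambda>u. Y (s + u))" if "-U \<le> a" "b \<le> U" for a b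
    by (rule continuous_on_compose2[OF cont]) (use that in \<open>auto intro!: continuous_intros\<close>)
  have Ys': "continuous_on {a..b} (\<lambda>u. Y (s - u))" if "-U \<le> a" "b \<le> U" for a b
    by (rule continuous_on_compose2[OF cont]) (use that in \<open>auto intro!: continuous_intros\<close>)
  have gi: "g integrable_on {a..b}" if "-U \<le> a" "b \<le> U" for a b
    unfolding g_def by (intro integrable_continuous_real continuous_intros Ys continuous_on_fejer that)
  have split: "integral {a..c} g + integral {c..b} g = integral {a..b} g" if "-U \<le> a" "a \<le> c" "c \<le> b" "b \<le> U" for a b c
    by (rule Henstock_Kurzweil_Integration.integral_combine) (use that gi in auto)
  have tot: "integral {-U..U} g = integral {-U..-1} g + integral {-1..-h} g + integral {-h..h} g + integral {h..1} g + integral {1..U} g"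
    using split[of "-U" "-1" U] split[of "-1" "-h" U] split[of "-h" h U] split[of h 1 U] h01 U by linarith
  have far: "- (M / \<Delta>) \<le> integral {a..b} g" if ab: "-U \<le> a" "b \<le> U" "integral {a..b} (fejer \<Delta>) \<le> 1 / (\<Delta> * 1)" for a b
  proof -
    have "M * integral {a..b} (fejer \<Delta>) \<le> M / \<Delta>"
      using mult_left_mono[OF ab(3) M0] by simp
    then have "- (M / \<Delta>) \<le> integral {a..b} (\<lambda>u. - M * fejer \<Delta> u)"
      by (simp only: integral_mult_right)
    also have "\<dots> \<le> integral {a..b} g"
    proof (rule integral_le)
      show "(\<lambda>u. - M * fejer \<Delta> u) integrable_on {a..b}"
        by (intro integrable_continuous_real continuous_intros continuous_on_fejer)
      show "- M * fejer \<Delta> u \<le> g u" if "u \<in> {a..b}" for u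
        unfolding g_def using bd[of "s + u"] that ab by (intro mult_right_mono fejer_nonneg \<Delta>0) auto
    qed (rule gi[OF ab(1,2)])
    finally show ?thesis .
  qed
  have far1: "- (M / \<Delta>) \<le> integral {1..U} g"
    by (rule far) (use fejer_tail(1)[of \<Delta> 1 U] \<Delta> U in auto)
  have far2: "- (M / \<Delta>) \<le> integral {-U..-1} g"
    by (rule far) (use fejer_tail(2)[of \<Delta> 1 U] \<Delta> U in auto)
  have near: "- fejer_tail_mean \<Delta> Y s \<le> integral {h..1} g + integral {-1..-h} g"
  proof -
    have "integral {-1..-h} (\<lambda>u. g (- (- u))) = integral {h..1} (\<lambda>u. g (- u))"
      by (rule Henstock_Kurzweil_Integration.integral_reflect_real)
    moreover have "(\<lambda>u. g (- (- u))) = g" "(\<lambda>u. g (- u)) = (\<lambda>u. Y (s - u) * fejer \<Delta> u)"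
      by (simp_all add: g_def fejer_minus fun_eq_iff)
    ultimately have r: "integral {-1..-h} g = integral {h..1} (\<lambda>u. Y (s - u) * fejer \<Delta> u)"
      by (simp only:)
    have "- fejer_tail_mean \<Delta> Y s = integral {h..1} (\<lambda>u. - (fejer \<Delta> u * (\<bar>Y (s + u)\<bar> + \<bar>Y (s - u)\<bar>)))"
      by (simp add: fejer_tail_mean_def h)
    also have "\<dots> \<le> integral {h..1} (\<lambda>u. g u + Y (s - u) * fejer \<Delta> u)"
    proof (rule integral_le)
      show "(\<lambda>u. - (fejer \<Delta> u * (\<bar>Y (s + u)\<bar> + \<bar>Y (s - u)\<bar>))) integrable_on {h..1}"
        by (intro integrable_continuous_real continuous_intros continuous_on_fejer Ys Ys') (use h01 U in auto)
      show "(\<lambda>u. g u + Y (s - u) * fejer \<Delta> u) integrable_on {h..1}"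
        unfolding g_def by (intro integrable_continuous_real continuous_intros continuous_on_fejer Ys Ys') (use h01 U in auto)
      fix u assume "u \<in> {h..1}"
      have "fejer \<Delta> u * (- \<bar>Y (s + u)\<bar> - \<bar>Y (s - u)\<bar>) \<le> fejer \<Delta> u * (Y (s + u) + Y (s - u))"
        using fejer_nonneg[OF \<Delta>0, of u] by (intro mult_left_mono) auto
      then show "- (fejer \<Delta> u * (\<bar>Y (s + u)\<bar> + \<bar>Y (s - u)\<bar>)) \<le> g u + Y (s - u) * fejer \<Delta> u"
        by (simp add: g_def algebra_simps)
    qed
    also have "\<dots> = integral {h..1} g + integral {h..1} (\<lambda>u. Y (s - u) * fejer \<Delta> u)"
      by (intro integral_add gi integrable_continuous_real continuous_intros continuous_on_fejer Ys') (use h01 U in auto)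
    finally show ?thesis unfolding r .
  qed
  have center: "(Y t - 2 * h * M) * integral {-h..h} (fejer \<Delta>) \<le> integral {-h..h} g"
  proof -
    have "(Y t - 2 * h * M) * integral {-h..h} (fejer \<Delta>) = integral {-h..h} (\<lambda>u. (Y t - 2 * h * M) * fejer \<Delta> u)"
      by (simp only: integral_mult_right)
    also have "\<dots> \<le> integral {-h..h} g"
    proof (rule integral_le)
      show "(\<lambda>u. (Y t - 2 * h * M) * fejer \<Delta> u) integrable_on {-h..h}"
        by (intro integrable_continuous_real continuous_intros continuous_on_fejer)
      show "g integrable_on {-h..h}" by (rule gi) (use h01 U in auto)
      fix u assume u: "u \<in> {-h..h}"
      have "Y t - M * (s + u - t) \<le> Y (s + u)"
        by (rule mono) (use u h01 U in \<open>auto simp: s\<close>)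
      moreover have "M * (s + u - t) \<le> M * (2 * h)" using u M0 by (intro mult_left_mono) (auto simp: s)
      ultimately have "Y t - 2 * h * M \<le> Y (s + u)" by (simp add: mult_ac)
      then show "(Y t - 2 * h * M) * fejer \<Delta> u \<le> g u"
        unfolding g_def by (intro mult_right_mono fejer_nonneg \<Delta>0)
    qed
    finally show ?thesis .
  qed
  have "2 * h * M * integral {-h..h} (fejer \<Delta>) \<le> 2 * h * M * 32"
    using fejer_mass_le[OF \<Delta>0, of h] h01 M0 \<Delta>0 by (intro mult_left_mono) (auto simp: h)
  also have "\<dots> = 1024 * M / \<Delta>" by (simp add: h)
  finally have "2 * h * M * integral {-h..h} (fejer \<Delta>) \<le> 1024 * M / \<Delta>" .
  moreover have "1026 * M / \<Delta> = 1024 * M / \<Delta> + 2 * (M / \<Delta>)" by (simp add: field_simps)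
  ultimately have "integral {-h..h} (fejer \<Delta>) * Y t \<le> integral {-U..U} g + fejer_tail_mean \<Delta> Y s + 1026 * M / \<Delta>"
    using center near far1 far2 tot by (simp only: left_diff_distrib mult.commute[of "integral {-h..h} (fejer \<Delta>)"])
  then show ?thesis unfolding g_def .
qed

lemma quasi_monotone_abs_bound:
  assumes \<Delta>: "\<Delta> \<ge> 16" and h: "h = 16 / \<Delta>" and U: "U \<ge> 1"
    and cont: "continuous_on {t - h - U..t + h + U} Y"
    and bd: "\<And>x. x \<in> {t - h - U..t + h + U} \<Longrightarrow> \<bar>Y x\<bar> \<le> M"
    and mono: "\<And>x y. x \<in> {t - h - U..t + h + U} \<Longrightarrow> y \<in> {t - h - U..t + h + U} \<Longrightarrow> x \<le> y \<Longrightarrow> Y x - M * (y - x) \<le> Y y"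
  shows "\<bar>Y t\<bar> \<le> \<bar>integral {-U..U} (\<lambda>u. Y (t + h + u) * fejer \<Delta> u)\<bar> + \<bar>integral {-U..U} (\<lambda>u. Y (t - h + u) * fejer \<Delta> u)\<bar>
     + (fejer_tail_mean \<Delta> Y (t + h) + fejer_tail_mean \<Delta> Y (t - h)) + 1026 * M / \<Delta>"
proof -
  have h01: "0 < h" "h \<le> 1" "1 / \<Delta> \<le> h" using \<Delta> by (auto simp: h field_simps)
  have \<Delta>0: "\<Delta> > 0" using \<Delta> by simp
  have M0: "M \<ge> 0" using bd[of t] U h01 by (auto intro: order.trans[OF abs_ge_zero])
  define m where "m = integral {-h..h} (fejer \<Delta>)"
  have m: "m \<ge> 1" unfolding m_def by (rule fejer_mass_ge[OF \<Delta>0 h01(3)])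
  note tail_nn = fejer_tail_mean_nonneg[OF \<Delta>0, of Y]
  have 1: "m * Y t \<le> integral {-U..U} (\<lambda>u. Y (t + h + u) * fejer \<Delta> u) + fejer_tail_mean \<Delta> Y (t + h) + 1026 * M / \<Delta>"
    unfolding m_def
    by (rule quasi_monotone_upper_bound[OF \<Delta> h U refl continuous_on_subset[OF cont]])
       (use h01 in \<open>auto intro!: bd mono\<close>)
  \<comment> \<open>The point reflection about \<open>t\<close> preserves the hypotheses and exchanges the two sides.\<close>
  define Y' where "Y' x = - Y (2 * t - x)" for x
  have 2: "m * Y' t \<le> integral {-U..U} (\<lambda>u. Y' (t + h + u) * fejer \<Delta> u) + fejer_tail_mean \<Delta> Y' (t + h) + 1026 * M / \<Delta>"
    unfolding m_def
  proof (rule quasi_monotone_upper_bound[OF \<Delta> h U refl])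
    show "continuous_on {t + h - U..t + h + U} Y'"
      unfolding Y'_def
      by (intro continuous_on_minus continuous_on_compose2[OF cont]) (use h01 in \<open>auto intro!: continuous_intros\<close>)
    show "\<bar>Y' x\<bar> \<le> M" if "x \<in> {t + h - U..t + h + U}" for x
      unfolding Y'_def using that h01 by (auto intro!: bd)
    show "Y' x - M * (y - x) \<le> Y' y" if "x \<in> {t + h - U..t + h + U}" "y \<in> {t + h - U..t + h + U}" "x \<le> y" for x y
      unfolding Y'_def using mono[of "2 * t - y" "2 * t - x"] that h01 by auto
  qed
  have "integral {-U..- (-U)} (\<lambda>u. Y (t - h - (- u)) * fejer \<Delta> (- u)) = integral {-U..U} (\<lambda>u. Y (t - h - u) * fejer \<Delta> u)"
    using Henstock_Kurzweil_Integration.integral_reflect_real[of U "-U" "\<lambda>u. Y (t - h - u) * fejer \<Delta> u"] by simp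
  then have "integral {-U..U} (\<lambda>u. Y' (t + h + u) * fejer \<Delta> u) = - integral {-U..U} (\<lambda>u. Y (t - h + u) * fejer \<Delta> u)"
    by (simp add: Y'_def fejer_minus algebra_simps)
  moreover have "fejer_tail_mean \<Delta> Y' (t + h) = fejer_tail_mean \<Delta> Y (t - h)"
    unfolding fejer_tail_mean_def Y'_def by (rule integral_cong) (simp add: algebra_simps)
  ultimately have "m * - Y t \<le> - integral {-U..U} (\<lambda>u. Y (t - h + u) * fejer \<Delta> u) + fejer_tail_mean \<Delta> Y (t - h) + 1026 * M / \<Delta>"
    using 2 by (simp add: Y'_def)
  then have "\<bar>m * Y t\<bar> \<le> \<bar>integral {-U..U} (\<lambda>u. Y (t + h + u) * fejer \<Delta> u)\<bar> + \<bar>integral {-U..U} (\<lambda>u. Y (t - h + u) * fejer \<Delta> u)\<bar>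
     + (fejer_tail_mean \<Delta> Y (t + h) + fejer_tail_mean \<Delta> Y (t - h)) + 1026 * M / \<Delta>"
    using 1 tail_nn[of "t + h"] tail_nn[of "t - h"] by (simp add: abs_le_iff) linarith
  moreover have "\<bar>Y t\<bar> \<le> \<bar>m * Y t\<bar>" using m by (simp add: abs_mult mult_le_cancel_right1)
  ultimately show ?thesis by linarith
qed

text \<open>
  The inequality between the arithmetic mean and the power mean.
\<close>
lemma sum_list_power_le:
  fixes xs :: "real list"
  assumes "\<And>x. x \<in> set xs \<Longrightarrow> x \<ge> 0"
  shows "sum_list xs ^ Suc n \<le> real (length xs) ^ n * (\<Sum>x\<leftarrow>xs. x ^ Suc n)"
proof (cases "xs = []")
  case False
  define l where "l = real (length xs)"
  have l: "l > 0" using False by (simp add: l_def)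
  define y where "y = sum_list xs / l"
  have "sum_list xs \<ge> 0" using assms by (rule sum_list_nonneg)
  then have y: "y \<ge> 0" "sum_list xs = l * y" using l by (auto simp: y_def)
  have "(\<Sum>x\<leftarrow>xs. y ^ Suc n + real (Suc n) * y ^ n * (x - y)) \<le> (\<Sum>x\<leftarrow>xs. x ^ Suc n)"
    using assms y by (intro sum_list_mono tangent_power) auto
  moreover have "(\<Sum>x\<leftarrow>zs. y ^ Suc n + real (Suc n) * y ^ n * (x - y))
      = real (length zs) * y ^ Suc n + real (Suc n) * y ^ n * (sum_list zs - real (length zs) * y)" for zs
    by (induction zs) (simp_all add: algebra_simps)
  ultimately have "l * y ^ Suc n \<le> (\<Sum>x\<leftarrow>xs. x ^ Suc n)"
    using y(2) by (simp add: l_def)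
  then have "l ^ n * (l * y ^ Suc n) \<le> l ^ n * (\<Sum>x\<leftarrow>xs. x ^ Suc n)"
    using l by (intro mult_left_mono) auto
  then show ?thesis unfolding y(2) l_def[symmetric] by (simp add: power_mult_distrib mult_ac)
qed auto

lemma integral_subinterval_le:
  fixes f :: "real \<Rightarrow> real"
  assumes "continuous_on {a..b} f" "\<And>x. x \<in> {a..b} \<Longrightarrow> f x \<ge> 0" "a \<le> c" "d \<le> b"
  shows "integral {c..d} f \<le> integral {a..b} f"
  by (intro integral_subset_le integrable_continuous_real continuous_on_subset[OF assms(1)]) (use assms in auto)

lemma integral_shift_real:
  fixes f :: "real \<Rightarrow> real"
  assumes "continuous_on {a + c..b + c} f"
  shows "integral {a..b} (\<lambda>x. f (x + c)) = integral {a + c..b + c} f"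
proof (cases "a \<le> b")
  case True
  have "(f has_integral integral {a + c..b + c} f) (cbox (a + c) (b + c))"
    using integrable_continuous_real[OF assms] by (simp add: integrable_integral)
  then have "((\<lambda>x. f (1 * x + c)) has_integral integral {a + c..b + c} f /\<^sub>R \<bar>1\<bar> ^ DIM(real)) (cbox a b)"
    using has_integral_affinity'[of f "integral {a + c..b + c} f" "a + c" "b + c" 1 c] True by (simp add: algebra_simps)
  then show ?thesis by (simp add: integral_unique)
qed auto

text \<open>
  The sum of the two tail means is an average over four translates of \<open>\<bar>Y\<bar>\<close> with a weight of mass at most
  \<open>1/16\<close>. By \<open>jensen_power_integral\<close> and \<open>sum_list_power_le\<close> its \<open>(n + 1)\<close>-st power gains a factor
  \<open>(4/16)\<^sup>n\<close>, the integration over \<open>t\<close> gains another \<open>4/16\<close>, and the factor \<open>2\<close> costs \<open>2 ^ Suc n\<close>. The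
  product is \<open>1/4\<close> for \<open>n = 1\<close> and smaller for larger \<open>n\<close>.
\<close>
lemma tail_mean_power_integral:
  assumes \<Delta>: "\<Delta> \<ge> 16" and h: "h = 16 / \<Delta>" and ab: "a \<le> b" and n: "n \<ge> 1"
    and Y: "continuous_on {a - 2..b + 2} Y"
  shows "(\<lambda>t. (2 * (fejer_tail_mean \<Delta> Y (t + h) + fejer_tail_mean \<Delta> Y (t - h))) ^ Suc n) integrable_on {a..b}"
    "integral {a..b} (\<lambda>t. (2 * (fejer_tail_mean \<Delta> Y (t + h) + fejer_tail_mean \<Delta> Y (t - h))) ^ Suc n)
     \<le> 1/4 * integral {a - 2..b + 2} (\<lambda>t. \<bar>Y t\<bar> ^ Suc n)"
proof -
  have h01: "0 < h" "h \<le> 1" using \<Delta> by (auto simp: h field_simps)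
  have \<Delta>0: "\<Delta> > 0" using \<Delta> by simp
  define I where "I = integral {a - 2..b + 2} (\<lambda>t. \<bar>Y t\<bar> ^ Suc n)"
  have mass: "integral {h..1} (fejer \<Delta>) \<le> 1/16"
    using fejer_tail(1)[of \<Delta> h 1] \<Delta>0 h01 by (simp add: h)
  have contY: "continuous_on A (\<lambda>x. Y (f x))" if "continuous_on A f" "f ` A \<subseteq> {a - 2..b + 2}" for A :: "'z::topological_space set" and f
    by (rule continuous_on_compose2[OF Y that])
  define G where "G t u = \<bar>Y (t + h + u)\<bar> + \<bar>Y (t + h - u)\<bar> + \<bar>Y (t - h + u)\<bar> + \<bar>Y (t - h - u)\<bar>" for t u
  define S where "S t u = \<bar>Y (t + h + u)\<bar> ^ Suc n + \<bar>Y (t + h - u)\<bar> ^ Suc n + \<bar>Y (t - h + u)\<bar> ^ Suc n + \<bar>Y (t - h - u)\<bar> ^ Suc n" for t u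
  have Gc: "continuous_on {h..1} (G t)" if "t \<in> {a..b}" for t
    unfolding G_def by (intro continuous_intros contY) (use that h01 in auto)
  have G2c: "continuous_on (cbox (a, h) (b, 1)) (\<lambda>(t, u). fejer \<Delta> u * G t u)"
    unfolding G_def case_prod_unfold
    by (intro continuous_intros contY continuous_on_compose2[OF continuous_on_fejer[of UNIV]]) (use h01 in auto)
  have S2c: "continuous_on (cbox (a, h) (b, 1)) (\<lambda>(t, u). fejer \<Delta> u * S t u)"
    unfolding S_def case_prod_unfold
    by (intro continuous_intros contY continuous_on_compose2[OF continuous_on_fejer[of UNIV]]) (use h01 in auto)
  have tail: "fejer_tail_mean \<Delta> Y (t + h) + fejer_tail_mean \<Delta> Y (t - h) = integral {h..1} (\<lambda>u. fejer \<Delta> u * G t u)"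
    if "t \<in> {a..b}" for t
    unfolding fejer_tail_mean_def h[symmetric] G_def
    by (subst integral_add[symmetric])
       (use that h01 in \<open>auto intro!: integrable_continuous_real continuous_intros continuous_on_fejer contY integral_cong simp: algebra_simps\<close>)
  have Tc: "continuous_on {a..b} (\<lambda>t. integral {h..1} (\<lambda>u. fejer \<Delta> u * G t u))"
    using integral_continuous_on_param[of "{a..b}" h 1 "\<lambda>t u. fejer \<Delta> u * G t u"] G2c by (simp add: cbox_Pair_eq)
  have Sc: "continuous_on {a..b} (\<lambda>t. integral {h..1} (\<lambda>u. fejer \<Delta> u * S t u))"
    using integral_continuous_on_param[of "{a..b}" h 1 "\<lambda>t u. fejer \<Delta> u * S t u"] S2c by (simp add: cbox_Pair_eq)
  have "continuous_on {a..b} (\<lambda>t. (2 * (fejer_tail_mean \<Delta> Y (t + h) + fejer_tail_mean \<Delta> Y (t - h))) ^ Suc n)"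
    by (rule continuous_on_eq[of _ "\<lambda>t. (2 * integral {h..1} (\<lambda>u. fejer \<Delta> u * G t u)) ^ Suc n"])
       (use tail in \<open>auto intro!: continuous_intros Tc\<close>)
  then show int: "(\<lambda>t. (2 * (fejer_tail_mean \<Delta> Y (t + h) + fejer_tail_mean \<Delta> Y (t - h))) ^ Suc n) integrable_on {a..b}"
    by (rule integrable_continuous_real)
  have pt: "(2 * (fejer_tail_mean \<Delta> Y (t + h) + fejer_tail_mean \<Delta> Y (t - h))) ^ Suc n
      \<le> integral {h..1} (\<lambda>u. fejer \<Delta> u * S t u)" if t: "t \<in> {a..b}" for t
  proof -
    have Sct: "continuous_on {h..1} (S t)"
      unfolding S_def by (intro continuous_intros contY) (use t h01 in auto)
    have four: "(x1 + x2 + x3 + x4) ^ Suc n \<le> 4 ^ n * (x1 ^ Suc n + x2 ^ Suc n + x3 ^ Suc n + x4 ^ Suc n)"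
      if nn: "x1 \<ge> 0" "x2 \<ge> 0" "x3 \<ge> 0" "x4 \<ge> 0" for x1 x2 x3 x4 :: real
    proof -
      have "x \<ge> 0" if "x \<in> set [x1, x2, x3, x4]" for x using that nn by auto
      from sum_list_power_le[of "[x1, x2, x3, x4]" n, OF this] show ?thesis by (simp add: add.assoc del: power_Suc)
    qed
    have "(2 * (fejer_tail_mean \<Delta> Y (t + h) + fejer_tail_mean \<Delta> Y (t - h))) ^ Suc n
        = 2 ^ Suc n * (integral {h..1} (\<lambda>u. fejer \<Delta> u * G t u)) ^ Suc n"
      unfolding tail[OF t] by (rule power_mult_distrib)
    also have "\<dots> \<le> 2 ^ Suc n * ((1/16) ^ n * integral {h..1} (\<lambda>u. fejer \<Delta> u * G t u ^ Suc n))"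
      by (intro mult_left_mono jensen_power_integral continuous_on_fejer fejer_nonneg \<Delta>0 Gc t mass) (auto simp: G_def)
    also have "\<dots> \<le> 2 ^ Suc n * ((1/16) ^ n * integral {h..1} (\<lambda>u. 4 ^ n * (fejer \<Delta> u * S t u)))"
    proof (intro mult_left_mono integral_le)
      show "(\<lambda>u. fejer \<Delta> u * G t u ^ Suc n) integrable_on {h..1}"
        by (intro integrable_continuous_real continuous_intros continuous_on_fejer Gc t)
      show "(\<lambda>u. 4 ^ n * (fejer \<Delta> u * S t u)) integrable_on {h..1}"
        by (intro integrable_continuous_real continuous_intros continuous_on_fejer Sct)
      fix u
      have "G t u ^ Suc n \<le> 4 ^ n * S t u" unfolding G_def S_def
        by (rule four) auto
      then have "fejer \<Delta> u * G t u ^ Suc n \<le> fejer \<Delta> u * (4 ^ n * S t u)"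
        by (intro mult_left_mono fejer_nonneg \<Delta>0)
      then show "fejer \<Delta> u * G t u ^ Suc n \<le> 4 ^ n * (fejer \<Delta> u * S t u)" by (simp add: mult_ac)
    qed auto
    also have "\<dots> = 2 * (1/2) ^ n * integral {h..1} (\<lambda>u. fejer \<Delta> u * S t u)"
    proof -
      have "2 ^ Suc n * ((1/16) ^ n * (4 ^ n * x)) = 2 * (2 * (1/16) * 4) ^ n * x" for x :: real
        unfolding power_mult_distrib by simp
      then show ?thesis by (simp only: integral_mult_right) simp
    qed
    also have "\<dots> \<le> 1 * integral {h..1} (\<lambda>u. fejer \<Delta> u * S t u)"
    proof (intro mult_right_mono integral_nonneg)
      have "(1/2::real) ^ n \<le> (1/2) ^ 1" using n by (intro power_decreasing) auto
      then show "2 * (1/2::real) ^ n \<le> 1" by simp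
      show "(\<lambda>u. fejer \<Delta> u * S t u) integrable_on {h..1}"
        by (intro integrable_continuous_real continuous_intros continuous_on_fejer Sct)
      show "0 \<le> fejer \<Delta> u * S t u" for u by (intro mult_nonneg_nonneg fejer_nonneg \<Delta>0) (auto simp: S_def)
    qed
    finally show ?thesis by simp
  qed
  have "integral {a..b} (\<lambda>t. (2 * (fejer_tail_mean \<Delta> Y (t + h) + fejer_tail_mean \<Delta> Y (t - h))) ^ Suc n)
      \<le> integral {a..b} (\<lambda>t. integral {h..1} (\<lambda>u. fejer \<Delta> u * S t u))"
    by (intro integral_le int integrable_continuous_real Sc pt)
  also have "\<dots> = integral {h..1} (\<lambda>u. integral {a..b} (\<lambda>t. fejer \<Delta> u * S t u))"
    using integral_swap_continuous[of a h b 1 "\<lambda>t u. fejer \<Delta> u * S t u"] S2c by simp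
  also have "\<dots> \<le> integral {h..1} (\<lambda>u. fejer \<Delta> u * (4 * I))"
  proof (rule integral_le)
    have "continuous_on (cbox (h, a) (1, b)) (\<lambda>(u, t). fejer \<Delta> u * S t u)"
      unfolding S_def case_prod_unfold
      by (intro continuous_intros contY continuous_on_compose2[OF continuous_on_fejer[of UNIV]]) (use h01 in auto)
    then have "continuous_on {h..1} (\<lambda>u. integral {a..b} (\<lambda>t. fejer \<Delta> u * S t u))"
      using integral_continuous_on_param[of "{h..1}" a b "\<lambda>u t. fejer \<Delta> u * S t u"] by (simp add: cbox_Pair_eq)
    then show "(\<lambda>u. integral {a..b} (\<lambda>t. fejer \<Delta> u * S t u)) integrable_on {h..1}"
      by (rule integrable_continuous_real)
    show "(\<lambda>u. fejer \<Delta> u * (4 * I)) integrable_on {h..1}"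
      by (intro integrable_continuous_real continuous_intros continuous_on_fejer)
    fix u assume u: "u \<in> {h..1}"
    have sh: "integral {a..b} (\<lambda>t. \<bar>Y (t + c)\<bar> ^ Suc n) \<le> I" "(\<lambda>t. \<bar>Y (t + c)\<bar> ^ Suc n) integrable_on {a..b}"
      if c: "\<bar>c\<bar> \<le> 2" for c
    proof -
      have "integral {a..b} (\<lambda>t. \<bar>Y (t + c)\<bar> ^ Suc n) = integral {a + c..b + c} (\<lambda>t. \<bar>Y t\<bar> ^ Suc n)"
        by (rule integral_shift_real) (use c in \<open>auto intro!: continuous_intros contY\<close>)
      also have "\<dots> \<le> I" unfolding I_def
        by (rule integral_subinterval_le) (use c in \<open>auto intro!: continuous_intros Y\<close>)
      finally show "integral {a..b} (\<lambda>t. \<bar>Y (t + c)\<bar> ^ Suc n) \<le> I" .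
      show "(\<lambda>t. \<bar>Y (t + c)\<bar> ^ Suc n) integrable_on {a..b}"
        by (intro integrable_continuous_real continuous_intros contY) (use c in auto)
    qed
    have Seq: "(\<lambda>t. S t u) = (\<lambda>t. ((\<bar>Y (t + (h + u))\<bar> ^ Suc n + \<bar>Y (t + (h - u))\<bar> ^ Suc n) + \<bar>Y (t + (u - h))\<bar> ^ Suc n) + \<bar>Y (t + (- h - u))\<bar> ^ Suc n)"
      by (simp add: S_def fun_eq_iff algebra_simps)
    have "integral {a..b} (\<lambda>t. S t u) = integral {a..b} (\<lambda>t. \<bar>Y (t + (h + u))\<bar> ^ Suc n) + integral {a..b} (\<lambda>t. \<bar>Y (t + (h - u))\<bar> ^ Suc n)
      + integral {a..b} (\<lambda>t. \<bar>Y (t + (u - h))\<bar> ^ Suc n) + integral {a..b} (\<lambda>t. \<bar>Y (t + (- h - u))\<bar> ^ Suc n)"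
      unfolding Seq by (subst integral_add, (intro integrable_add sh; use u h01 in auto)+)+ simp
    also have "\<dots> \<le> I + I + I + I"
      by (intro add_mono sh) (use u h01 in auto)
    finally have "integral {a..b} (\<lambda>t. S t u) \<le> 4 * I" by simp
    then have "fejer \<Delta> u * integral {a..b} (\<lambda>t. S t u) \<le> fejer \<Delta> u * (4 * I)"
      by (intro mult_left_mono fejer_nonneg \<Delta>0)
    then show "integral {a..b} (\<lambda>t. fejer \<Delta> u * S t u) \<le> fejer \<Delta> u * (4 * I)"
      by (simp only: integral_mult_right)
  qed
  also have "\<dots> = integral {h..1} (fejer \<Delta>) * (4 * I)" by (rule integral_mult_left)
  also have "\<dots> \<le> 1/16 * (4 * I)"
  proof (rule mult_right_mono[OF mass])
    have "I \<ge> 0" unfolding I_def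
      by (intro integral_nonneg integrable_continuous_real continuous_intros Y) auto
    then show "0 \<le> 4 * I" by simp
  qed
  finally show "integral {a..b} (\<lambda>t. (2 * (fejer_tail_mean \<Delta> Y (t + h) + fejer_tail_mean \<Delta> Y (t - h))) ^ Suc n)
     \<le> 1/4 * integral {a - 2..b + 2} (\<lambda>t. \<bar>Y t\<bar> ^ Suc n)" by (simp add: I_def)
qed

text \<open>
  By convexity the moment of \<open>Y\<close> is at most the mean of the moments of \<open>2 A\<close> and of twice the tail terms.
  The latter is at most a quarter of the moment of \<open>Y\<close> over the interval enlarged by 2 at both ends;
  the two added pieces are bounded trivially and the rest is moved to the left hand side.
\<close>
theorem moment_from_pointwise_bound:
  assumes \<Delta>: "\<Delta> \<ge> 16" and h: "h = 16 / \<Delta>" and ab: "a \<le> b" and n: "n \<ge> 1"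
    and Y: "continuous_on {a - 2..b + 2} Y" and bd: "\<And>x. x \<in> {a - 2..b + 2} \<Longrightarrow> \<bar>Y x\<bar> \<le> M"
    and A: "continuous_on {a..b} A" "\<And>t. t \<in> {a..b} \<Longrightarrow> A t \<ge> 0"
    and le: "\<And>t. t \<in> {a..b} \<Longrightarrow> \<bar>Y t\<bar> \<le> A t + (fejer_tail_mean \<Delta> Y (t + h) + fejer_tail_mean \<Delta> Y (t - h))"
  shows "integral {a..b} (\<lambda>t. \<bar>Y t\<bar> ^ Suc n) \<le> 2 ^ Suc n * integral {a..b} (\<lambda>t. A t ^ Suc n) + M ^ Suc n"
proof -
  define B where "B t = fejer_tail_mean \<Delta> Y (t + h) + fejer_tail_mean \<Delta> Y (t - h)" for t
  define I where "I = integral {a..b} (\<lambda>t. \<bar>Y t\<bar> ^ Suc n)"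
  have \<Delta>0: "\<Delta> > 0" using \<Delta> by simp
  have M0: "M \<ge> 0" using bd[of a] ab by (auto intro: order.trans[OF abs_ge_zero])
  note tail_nn = fejer_tail_mean_nonneg[OF \<Delta>0, of Y]
  have Yi: "(\<lambda>t. \<bar>Y t\<bar> ^ Suc n) integrable_on {c..d}" if "a - 2 \<le> c" "d \<le> b + 2" for c d
    by (intro integrable_continuous_real continuous_intros continuous_on_subset[OF Y]) (use that in auto)
  have two: "(x + y) ^ Suc n \<le> 1/2 * (2 * x) ^ Suc n + 1/2 * (2 * y) ^ Suc n" if "x \<ge> 0" "y \<ge> 0" for x y :: real
    using tangent_power[of "2 * x" "x + y" n] tangent_power[of "2 * y" "x + y" n] that
    by (simp add: algebra_simps del: power_Suc)
  have "I \<le> integral {a..b} (\<lambda>t. 1/2 * (2 * A t) ^ Suc n + 1/2 * (2 * B t) ^ Suc n)"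
    unfolding I_def
  proof (rule integral_le)
    show "(\<lambda>t. \<bar>Y t\<bar> ^ Suc n) integrable_on {a..b}" by (rule Yi) auto
    show "(\<lambda>t. 1/2 * (2 * A t) ^ Suc n + 1/2 * (2 * B t) ^ Suc n) integrable_on {a..b}"
      unfolding B_def
      by (intro integrable_add integrable_on_mult_right tail_mean_power_integral[OF \<Delta> h ab n Y] integrable_continuous_real continuous_intros A)
    fix t assume t: "t \<in> {a..b}"
    have "\<bar>Y t\<bar> ^ Suc n \<le> (A t + B t) ^ Suc n"
      using le[OF t] by (intro power_mono) (auto simp: B_def)
    also have "\<dots> \<le> 1/2 * (2 * A t) ^ Suc n + 1/2 * (2 * B t) ^ Suc n"
      using A(2)[OF t] tail_nn by (intro two) (auto simp: B_def)
    finally show "\<bar>Y t\<bar> ^ Suc n \<le> 1/2 * (2 * A t) ^ Suc n + 1/2 * (2 * B t) ^ Suc n" .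
  qed
  also have "\<dots> = 1/2 * integral {a..b} (\<lambda>t. (2 * A t) ^ Suc n) + 1/2 * integral {a..b} (\<lambda>t. (2 * B t) ^ Suc n)"
    unfolding B_def
    by (subst integral_add)
       (intro integrable_on_mult_right tail_mean_power_integral[OF \<Delta> h ab n Y] integrable_continuous_real continuous_intros A
         | simp only: integral_mult_right)+
  also have "integral {a..b} (\<lambda>t. (2 * A t) ^ Suc n) = 2 ^ Suc n * integral {a..b} (\<lambda>t. A t ^ Suc n)"
    by (simp only: power_mult_distrib integral_mult_right)
  also have "integral {a..b} (\<lambda>t. (2 * B t) ^ Suc n) \<le> 1/4 * integral {a - 2..b + 2} (\<lambda>t. \<bar>Y t\<bar> ^ Suc n)"
    unfolding B_def by (rule tail_mean_power_integral[OF \<Delta> h ab n Y])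
  also have "integral {a - 2..b + 2} (\<lambda>t. \<bar>Y t\<bar> ^ Suc n) \<le> I + 4 * M ^ Suc n"
  proof -
    have edge: "integral {c..d} (\<lambda>t. \<bar>Y t\<bar> ^ Suc n) \<le> 2 * M ^ Suc n" if cd: "a - 2 \<le> c" "d \<le> b + 2" "d = c + 2" for c d
    proof -
      have "integral {c..d} (\<lambda>t. \<bar>Y t\<bar> ^ Suc n) \<le> integral {c..d} (\<lambda>t. M ^ Suc n)"
        using cd by (intro integral_le Yi power_mono bd) auto
      then show ?thesis using cd by simp
    qed
    have "integral {a - 2..b + 2} (\<lambda>t. \<bar>Y t\<bar> ^ Suc n)
       = integral {a - 2..a} (\<lambda>t. \<bar>Y t\<bar> ^ Suc n) + (I + integral {b..b + 2} (\<lambda>t. \<bar>Y t\<bar> ^ Suc n))"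
      using Henstock_Kurzweil_Integration.integral_combine[of "a - 2" a "b + 2" "\<lambda>t. \<bar>Y t\<bar> ^ Suc n"]
        Henstock_Kurzweil_Integration.integral_combine[of a b "b + 2" "\<lambda>t. \<bar>Y t\<bar> ^ Suc n"] Yi[of "a - 2" "b + 2"] Yi[of a "b + 2"] ab
      by (simp add: I_def del: power_Suc)
    then show ?thesis using edge[of "a - 2" a] edge[of b "b + 2"] ab by (simp del: power_Suc)
  qed
  finally have "I \<le> 1/2 * (2 ^ Suc n * integral {a..b} (\<lambda>t. A t ^ Suc n)) + 1/2 * (1/4 * (I + 4 * M ^ Suc n))"
    by simp
  moreover have "0 \<le> 2 ^ Suc n * integral {a..b} (\<lambda>t. A t ^ Suc n)"
    by (intro mult_nonneg_nonneg integral_nonneg integrable_continuous_real continuous_intros A zero_le_power) auto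
  moreover have "0 \<le> M ^ Suc n" using M0 by simp
  moreover have "I \<le> P + Q" if "I \<le> 1/2 * P + 1/2 * (1/4 * (I + 4 * Q))" "0 \<le> P" "0 \<le> Q" for P Q :: real
  proof -
    have "8 * I \<le> 4 * P + I + 4 * Q" using that(1) by (simp add: field_simps)
    then show ?thesis using that(2,3) by simp
  qed
  ultimately show ?thesis unfolding I_def[symmetric] by blast
qed

section \<open>Moments of the smoothed Dirichlet polynomial\<close>

text \<open>
  The central part up to \<open>16/\<Delta>\<close> has mass at most 32 and each tail at most \<open>1/16\<close>; a crude bound in place
  of \<open>\<pi>\<close>.
\<close>
lemma fejer_mass_total:
  assumes \<Delta>: "\<Delta> \<ge> 16" and U: "U \<ge> 1"
  shows "integral {-U..U} (fejer \<Delta>) \<le> 33"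
proof -
  define h where "h = 16 / \<Delta>"
  have h: "0 < h" "h \<le> 1" using \<Delta> by (auto simp: h_def field_simps)
  have "integral {-U..-h} (fejer \<Delta>) + integral {-h..U} (fejer \<Delta>) = integral {-U..U} (fejer \<Delta>)"
    by (rule Henstock_Kurzweil_Integration.integral_combine[OF _ _ fejer_integrable]) (use h U in auto)
  moreover have "integral {-h..h} (fejer \<Delta>) + integral {h..U} (fejer \<Delta>) = integral {-h..U} (fejer \<Delta>)"
    by (rule Henstock_Kurzweil_Integration.integral_combine[OF _ _ fejer_integrable]) (use h U in auto)
  moreover have "integral {-U..-h} (fejer \<Delta>) \<le> 1/16" "integral {h..U} (fejer \<Delta>) \<le> 1/16"
  proof -
    have "\<Delta> * h = 16" using \<Delta> by (simp add: h_def)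
    then show "integral {-U..-h} (fejer \<Delta>) \<le> 1/16" "integral {h..U} (fejer \<Delta>) \<le> 1/16"
      using fejer_tail[of \<Delta> h U] \<Delta> h U by auto
  qed
  moreover have "integral {-h..h} (fejer \<Delta>) \<le> 32"
    using fejer_mass_le[of \<Delta> h] \<Delta> h by (simp add: h_def)
  ultimately show ?thesis by linarith
qed

text \<open>
  The Fourier transform of the kernel, truncated to \<open>[- U, U]\<close>.
\<close>
definition kernel_coeff :: "real \<Rightarrow> real \<Rightarrow> real \<Rightarrow> complex" where
  "kernel_coeff \<Delta> U \<omega> = integral {-U..U} (\<lambda>u. cis (- (\<omega> * u)) * of_real (fejer \<Delta> u))"

lemma continuous_on_cis_linear: "continuous_on A (\<lambda>u. cis (- (c * u)))"
  unfolding cis_conv_exp by (intro continuous_intros)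

lemma norm_kernel_coeff:
  assumes "\<Delta> \<ge> 16" "U \<ge> 1"
  shows "norm (kernel_coeff \<Delta> U \<omega>) \<le> 33"
proof -
  have "norm (kernel_coeff \<Delta> U \<omega>) \<le> integral {-U..U} (fejer \<Delta>)"
    unfolding kernel_coeff_def
  proof (rule integral_norm_bound_integral)
    show "(\<lambda>u. cis (- (\<omega> * u)) * of_real (fejer \<Delta> u)) integrable_on {-U..U}"
      by (intro integrable_continuous_real continuous_intros continuous_on_cis_linear continuous_on_fejer)
    show "norm (cis (- (\<omega> * u)) * of_real (fejer \<Delta> u)) \<le> fejer \<Delta> u" for u
      using fejer_nonneg[of \<Delta> u] assms by (simp add: norm_mult)
  qed (rule fejer_integrable)
  then show ?thesis using fejer_mass_total[OF assms] by simp
qed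

lemma nat_powr_Complex:
  assumes "p > 0"
  shows "of_nat p powr (- Complex \<sigma> \<tau>) = of_real (real p powr (-\<sigma>)) * cis (- (\<tau> * ln (real p)))"
proof -
  have "- Complex \<sigma> \<tau> * of_real (ln (real p)) = of_real (- \<sigma> * ln (real p)) + \<i> * of_real (- (\<tau> * ln (real p)))"
    by (simp add: complex_eq_iff)
  then have "of_nat p powr (- Complex \<sigma> \<tau>) = exp (of_real (- \<sigma> * ln (real p)) + \<i> * of_real (- (\<tau> * ln (real p))))"
    using assms by (simp add: powr_def Ln_of_nat)
  also have "\<dots> = of_real (exp (- \<sigma> * ln (real p))) * cis (- (\<tau> * ln (real p)))"
    unfolding exp_add cis_conv_exp exp_of_real ..
  finally show ?thesis using assms by (simp add: powr_def)
qed

text \<open>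
  The three ranges behave differently on the critical line: the primes have \<open>\<Sum> 1/p\<close> as mean square,
  the squares of primes have a bounded mean square, and the higher powers converge absolutely.
\<close>
lemma sum_short_prime_powers:
  fixes f :: "nat \<times> nat \<Rightarrow> complex"
  shows "(\<Sum>i\<in>short_prime_powers X. f i) = (\<Sum>p | prime p \<and> real p \<le> X. f (p, 1))
      + (\<Sum>p | prime p \<and> real (p\<^sup>2) \<le> X. f (p, 2)) + (\<Sum>i\<in>{i \<in> short_prime_powers X. snd i \<ge> 3}. f i)"
proof -
  let ?S = "short_prime_powers X"
  have "?S = {i \<in> ?S. snd i = 1} \<union> ({i \<in> ?S. snd i = 2} \<union> {i \<in> ?S. snd i \<ge> 3})"
    by (auto simp: short_prime_powers_def prime_power_index_def)
  then have "(\<Sum>i\<in>?S. f i) = (\<Sum>i\<in>{i \<in> ?S. snd i = 1} \<union> ({i \<in> ?S. snd i = 2} \<union> {i \<in> ?S. snd i \<ge> 3}). f i)" by simp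
  also have "\<dots> = (\<Sum>i\<in>{i \<in> ?S. snd i = 1}. f i) + ((\<Sum>i\<in>{i \<in> ?S. snd i = 2}. f i) + (\<Sum>i\<in>{i \<in> ?S. snd i \<ge> 3}. f i))"
    by (subst sum.union_disjoint, (auto simp: finite_short_prime_powers)[3], subst sum.union_disjoint)
       (auto simp: finite_short_prime_powers)
  also have "{i \<in> ?S. snd i = 1} = (\<lambda>p. (p, 1)) ` {p. prime p \<and> real p \<le> X}"
    by (auto simp: short_prime_powers_def prime_power_index_def image_iff)
  also have "(\<Sum>i\<in>(\<lambda>p. (p, 1)) ` {p. prime p \<and> real p \<le> X}. f i) = (\<Sum>p | prime p \<and> real p \<le> X. f (p, 1))"
    by (subst sum.reindex) (auto simp: inj_on_def)
  also have "{i \<in> ?S. snd i = 2} = (\<lambda>p. (p, 2)) ` {p. prime p \<and> real (p\<^sup>2) \<le> X}"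
    by (auto simp: short_prime_powers_def prime_power_index_def image_iff)
  also have "(\<Sum>i\<in>(\<lambda>p. (p, 2)) ` {p. prime p \<and> real (p\<^sup>2) \<le> X}. f i) = (\<Sum>p | prime p \<and> real (p\<^sup>2) \<le> X. f (p, 2))"
    by (subst sum.reindex) (auto simp: inj_on_def)
  finally show ?thesis by (simp add: add_ac)
qed

lemma sum_powr_primes_le:
  assumes "x > 1" "finite S" "\<And>p. p \<in> S \<Longrightarrow> p > (0 :: nat)"
  shows "(\<Sum>p\<in>S. real p powr (-x)) \<le> (\<Sum>n. real (Suc n) powr (-x))"
proof -
  have "(\<Sum>p\<in>S. real p powr (-x)) = (\<Sum>n\<in>(\<lambda>p. p - 1) ` S. real (Suc n) powr (-x))"
  proof (subst sum.reindex)
    show "inj_on (\<lambda>p. p - 1) S"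
      by (rule inj_onI) (metis assms(3) Suc_pred One_nat_def)
    show "(\<Sum>p\<in>S. real p powr (-x)) = sum ((\<lambda>n. real (Suc n) powr (-x)) \<circ> (\<lambda>p. p - 1)) S"
    proof (rule sum.cong)
      fix p assume "p \<in> S"
      then have "Suc (p - 1) = p" using assms(3)[of p] by simp
      then show "real p powr (-x) = ((\<lambda>n. real (Suc n) powr (-x)) \<circ> (\<lambda>p. p - 1)) p" by (simp only: o_def)
    qed simp
  qed
  also have "\<dots> \<le> (\<Sum>n. real (Suc n) powr (-x))"
    by (intro sum_le_suminf summable_Suc_powr assms) (use assms in auto)
  finally show ?thesis .
qed

text \<open>
  For \<open>m \<ge> 3\<close> and \<open>p \<ge> 2\<close> one has
  \<open>p powr (- m/2) \<le> p powr (- 3/2) * 2 powr (- (m - 3)/2)\<close>, and \<open>2 powr (3/2) \<le> 3\<close>; this is the sum of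
  the resulting majorant over all \<open>p\<close> and \<open>m\<close>.
\<close>
definition high_power_sum :: real where
  "high_power_sum = 3 * (\<Sum>n. real (Suc n) powr (-(3/2))) * (\<Sum>m. (2 powr (-1/2)) ^ m)"

lemma high_prime_powers_sum_le:
  "(\<Sum>(p, m)\<in>{i \<in> short_prime_powers X. snd i \<ge> 3}. real p powr (- real m / 2)) \<le> high_power_sum"
proof -
  let ?S = "{i \<in> short_prime_powers X. snd i \<ge> 3}"
  have fin: "finite ?S" using finite_short_prime_powers by simp
  define r :: real where "r = 2 powr (-1/2)"
  have r: "0 \<le> r" "r < 1" unfolding r_def using powr_less_mono[of "-1/2" 0 2] by auto
  have sub: "?S \<subseteq> fst ` ?S \<times> snd ` ?S" by (auto simp: image_iff)
  have pos: "p > 0" if "p \<in> fst ` ?S" for p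
    using that prime_gt_0_nat by (auto simp: short_prime_powers_def prime_power_index_def)
  have "(\<Sum>(p, m)\<in>?S. real p powr (- real m / 2)) \<le> (\<Sum>(p, m)\<in>?S. 3 * (real p powr (-(3/2)) * r ^ m))"
  proof (rule sum_mono, clarify)
    fix p m assume "(p, m) \<in> short_prime_powers X" "3 \<le> snd (p, m)"
    then have p: "p \<ge> 2" and m: "m \<ge> 3" by (auto simp: short_prime_powers_def prime_power_index_def prime_ge_2_nat)
    have "real p powr (- real m / 2) = real p powr (-(3/2)) * real p powr (- (real m - 3) / 2)"
      by (simp add: powr_add[symmetric] field_simps)
    also have "\<dots> \<le> real p powr (-(3/2)) * 2 powr (- (real m - 3) / 2)"
      using p m by (intro mult_left_mono powr_mono2') auto
    also have "(2::real) powr (- (real m - 3) / 2) = 2 powr (3/2) * 2 powr (- real m / 2)"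
      by (simp add: powr_add[symmetric] field_simps)
    also have "(2::real) powr (- real m / 2) = r ^ m"
      unfolding r_def by (simp add: powr_realpow[symmetric] powr_powr)
    also have "real p powr (-(3/2)) * (2 powr (3/2) * r ^ m) \<le> real p powr (-(3/2)) * (3 * r ^ m)"
    proof (intro mult_left_mono mult_right_mono)
      have "((2::real) powr (3/2))\<^sup>2 \<le> 3\<^sup>2" by (simp add: powr_power)
      then show "(2::real) powr (3/2) \<le> 3" by (rule power2_le_imp_le) simp
    qed (use r in auto)
    finally show "real p powr (- real m / 2) \<le> 3 * (real p powr (-(3/2)) * r ^ m)" by (simp add: mult_ac)
  qed
  also have "\<dots> \<le> (\<Sum>(p, m)\<in>fst ` ?S \<times> snd ` ?S. 3 * (real p powr (-(3/2)) * r ^ m))"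
    by (rule sum_mono2[OF _ sub]) (use fin r in auto)
  also have "\<dots> = 3 * ((\<Sum>p\<in>fst ` ?S. real p powr (-(3/2))) * (\<Sum>m\<in>snd ` ?S. r ^ m))"
    by (subst sum_product, subst sum.cartesian_product) (simp add: sum_distrib_left case_prod_unfold)
  also have "\<dots> \<le> 3 * ((\<Sum>n. real (Suc n) powr (-(3/2))) * (\<Sum>m. r ^ m))"
  proof (intro mult_left_mono mult_mono)
    show "(\<Sum>p\<in>fst ` ?S. real p powr (-(3/2))) \<le> (\<Sum>n. real (Suc n) powr (-(3/2)))"
      by (rule sum_powr_primes_le) (use fin pos in auto)
    show "(\<Sum>m\<in>snd ` ?S. r ^ m) \<le> (\<Sum>m. r ^ m)"
      by (intro sum_le_suminf summable_geometric) (use fin r in auto)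
    show "0 \<le> (\<Sum>n. real (Suc n) powr (-(3/2)))" by (intro suminf_nonneg summable_Suc_powr) auto
    show "0 \<le> (\<Sum>m\<in>snd ` ?S. r ^ m)" using r by (intro sum_nonneg) auto
  qed auto
  finally show ?thesis by (simp add: high_power_sum_def r_def mult.assoc)
qed

context GRH_character
begin

definition smoothed_coeff :: "real \<Rightarrow> real \<Rightarrow> real \<Rightarrow> nat \<times> nat \<Rightarrow> complex" where
  "smoothed_coeff \<Delta> U \<sigma> = (\<lambda>(p, m). chi p ^ m * of_real ((real p powr (-\<sigma>)) ^ m) / of_nat m
      * kernel_coeff \<Delta> U (real m * ln (real p)))"

text \<open>
  Smoothing multiplies the term with frequency \<open>\<omega> = m ln p\<close> by the Fourier transform at \<open>\<omega>\<close>, which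
  leaves a Dirichlet polynomial in \<open>s\<close>.
\<close>
lemma smoothed_log_poly:
  "integral {-U..U} (\<lambda>u. log_poly X (Complex \<sigma> (s + u)) * of_real (fejer \<Delta> u))
     = (\<Sum>i\<in>short_prime_powers X. smoothed_coeff \<Delta> U \<sigma> i * cis (- (real (snd i) * s * ln (real (fst i)))))"
proof -
  define c where "c i = chi (fst i) ^ snd i * of_real ((real (fst i) powr (-\<sigma>)) ^ snd i) / of_nat (snd i)
      * cis (- (real (snd i) * s * ln (real (fst i))))" for i :: "nat \<times> nat"
  have t: "log_term (Complex \<sigma> (s + u)) i = c i * cis (- (real (snd i) * ln (real (fst i)) * u))"
    if i: "i \<in> short_prime_powers X" for i u
  proof -
    obtain p m where pm: "i = (p, m)" by force
    have p: "p > 0" using i prime_gt_0_nat by (auto simp: pm short_prime_powers_def prime_power_index_def)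
    have "cis (- ((s + u) * ln (real p))) ^ m = cis (- (real m * s * ln (real p))) * cis (- (real m * ln (real p) * u))"
    proof -
      have "real m * - ((s + u) * ln (real p)) = - (real m * s * ln (real p)) + - (real m * ln (real p) * u)"
        by (simp add: algebra_simps)
      then show ?thesis unfolding Complex.DeMoivre cis_mult by (rule arg_cong)
    qed
    then show ?thesis
      by (simp add: pm log_term_def c_def nat_powr_Complex[OF p] power_mult_distrib mult_ac)
  qed
  have int: "(\<lambda>u. c i * (cis (- (real (snd i) * ln (real (fst i)) * u)) * of_real (fejer \<Delta> u))) integrable_on {-U..U}" for i
    by (intro integrable_continuous_real continuous_intros continuous_on_cis_linear continuous_on_fejer)
  have "integral {-U..U} (\<lambda>u. log_poly X (Complex \<sigma> (s + u)) * of_real (fejer \<Delta> u))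
      = integral {-U..U} (\<lambda>u. \<Sum>i\<in>short_prime_powers X. c i * (cis (- (real (snd i) * ln (real (fst i)) * u)) * of_real (fejer \<Delta> u)))"
    unfolding log_poly_def sum_distrib_right by (intro integral_cong sum.cong refl) (simp add: t mult.assoc)
  also have "\<dots> = (\<Sum>i\<in>short_prime_powers X. integral {-U..U} (\<lambda>u. c i * (cis (- (real (snd i) * ln (real (fst i)) * u)) * of_real (fejer \<Delta> u))))"
    by (rule integral_sum[OF finite_short_prime_powers int])
  also have "\<dots> = (\<Sum>i\<in>short_prime_powers X. smoothed_coeff \<Delta> U \<sigma> i * cis (- (real (snd i) * s * ln (real (fst i)))))"
    by (intro sum.cong refl) (simp only: integral_mult_right kernel_coeff_def[symmetric], simp add: c_def smoothed_coeff_def case_prod_unfold)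
  finally show ?thesis .
qed

lemma norm_smoothed_coeff:
  assumes "\<Delta> \<ge> 16" "U \<ge> 1" "\<sigma> > 1/2" "p > 0" "m \<ge> 1"
  shows "norm (smoothed_coeff \<Delta> U \<sigma> (p, m)) \<le> 33 * real p powr (- real m / 2)"
proof -
  have "(real p powr (-\<sigma>)) ^ m = real p powr (- \<sigma> * real m)"
    using assms by (simp add: powr_realpow[symmetric] powr_powr)
  also have "\<dots> \<le> real p powr (- real m / 2)"
    using assms mult_right_mono[of "1/2" \<sigma> "real m"] by (intro powr_mono) auto
  finally have 1: "(real p powr (-\<sigma>)) ^ m \<le> real p powr (- real m / 2)" .
  have "norm (chi p ^ m / of_nat m) \<le> 1 / 1"
    unfolding norm_divide norm_power using norm_chi_le[of p] assms by (intro frac_le power_le_one) auto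
  then have 2: "norm (chi p ^ m / of_nat m) \<le> 1" by simp
  have "norm (smoothed_coeff \<Delta> U \<sigma> (p, m))
     = norm (chi p ^ m / of_nat m) * (real p powr (-\<sigma>)) ^ m * norm (kernel_coeff \<Delta> U (real m * ln (real p)))"
    by (simp add: smoothed_coeff_def norm_mult norm_divide norm_power)
  also have "\<dots> \<le> 1 * real p powr (- real m / 2) * 33"
    by (intro mult_mono 1 2 norm_kernel_coeff assms) auto
  finally show ?thesis by simp
qed

text \<open>
  Here \<open>D\<^sub>1\<close> is the part over the primes, \<open>D\<^sub>2\<close> the part over the squares of primes, and the constant
  bounds the higher powers. The constant is uniform in \<open>\<sigma> > 1/2\<close>, where
  \<open>p powr (- \<sigma>) \<le> p powr (- 1/2)\<close>.
\<close>
theorem smoothed_poly_moments: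
  "\<exists>C\<ge>1. \<forall>\<Delta>\<ge>16. \<forall>U\<ge>1. \<forall>\<sigma>>1/2. \<forall>X\<ge>3. \<exists>(D\<^sub>1 :: real \<Rightarrow> complex) (D\<^sub>2 :: real \<Rightarrow> complex).
     continuous_on UNIV D\<^sub>1 \<and> continuous_on UNIV D\<^sub>2 \<and>
     (\<forall>s. norm (integral {-U..U} (\<lambda>u. log_poly X (Complex \<sigma> (s + u)) * of_real (fejer \<Delta> u)))
           \<le> norm (D\<^sub>1 s) + norm (D\<^sub>2 s) + C) \<and>
     (\<forall>A B k. A \<le> B \<longrightarrow>
        integral {A..B} (\<lambda>s. norm (D\<^sub>1 s) ^ (2 * k)) \<le> (B - A + 2 * X ^ (2 * k)) * (fact k * (C * ln (ln X + C)) ^ k) \<and>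
        integral {A..B} (\<lambda>s. norm (D\<^sub>2 s) ^ (2 * k)) \<le> (B - A + 2 * X ^ (2 * k)) * (fact k * C ^ k))"
proof -
  define Z where "Z = (\<Sum>n. real (Suc n) powr (-2))"
  have Z: "Z \<ge> 0" unfolding Z_def by (intro suminf_nonneg summable_Suc_powr) auto
  have hps: "high_power_sum \<ge> 0" using high_prime_powers_sum_le[of 0] sum_nonneg[of "{i \<in> short_prime_powers 0. snd i \<ge> 3}" "\<lambda>(p, m). real p powr (- real m / 2)"] by force
  define C where "C = 1089 * 3 + 1089 * Z + 2 * Z + 33 * high_power_sum"
  have C: "C \<ge> 1" "C \<ge> 2 * Z" "C \<ge> 1089 * Z" "C \<ge> 33 * high_power_sum" "C \<ge> 1089 * 3"
    using Z hps by (auto simp: C_def)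
  show ?thesis
  proof (intro exI[of _ C] conjI allI impI C(1))
    fix \<Delta> U \<sigma> X :: real assume \<Delta>: "\<Delta> \<ge> 16" and U: "U \<ge> 1" and \<sigma>: "\<sigma> > 1/2" and X: "X \<ge> 3"
    let ?c = "smoothed_coeff \<Delta> U \<sigma>"
    define P1 where "P1 = {p. prime p \<and> real p \<le> X}"
    define P2 where "P2 = {p. prime p \<and> real (p\<^sup>2) \<le> X}"
    have P1: "finite P1" "\<And>p. p \<in> P1 \<Longrightarrow> prime p \<and> real p \<le> X"
    proof -
      have "P1 \<subseteq> {..nat \<lfloor>X\<rfloor>}" by (auto simp: P1_def le_nat_floor)
      then show "finite P1" by (rule finite_subset) simp
    qed (auto simp: P1_def)
    have P2: "finite P2" "\<And>p. p \<in> P2 \<Longrightarrow> prime p \<and> real p \<le> X"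
    proof -
      show *: "prime p \<and> real p \<le> X" if "p \<in> P2" for p
      proof -
        have "p > 0" using that prime_gt_0_nat by (auto simp: P2_def)
        then have "p \<le> p\<^sup>2" by (simp add: power2_eq_square)
        then have "real p \<le> real (p\<^sup>2)" by (simp only: of_nat_le_iff)
        moreover have "prime p" "real (p\<^sup>2) \<le> X" using that by (auto simp only: P2_def mem_Collect_eq)
        ultimately show ?thesis by linarith
      qed
      then have "P2 \<subseteq> P1" by (auto simp: P1_def)
      then show "finite P2" by (rule finite_subset) (rule P1)
    qed
    define D1 where "D1 s = (\<Sum>p\<in>P1. ?c (p, 1) * cis (- (1 * s * ln (real p))))" for s
    define D2 where "D2 s = (\<Sum>p\<in>P2. ?c (p, 2) * cis (- (2 * s * ln (real p))))" for s
    have cont: "continuous_on UNIV (\<lambda>s. cis (- (c * s * d)))" for c d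
      unfolding cis_conv_exp by (intro continuous_intros)
    show "\<exists>(D\<^sub>1 :: real \<Rightarrow> complex) (D\<^sub>2 :: real \<Rightarrow> complex).
     continuous_on UNIV D\<^sub>1 \<and> continuous_on UNIV D\<^sub>2 \<and>
     (\<forall>s. norm (integral {-U..U} (\<lambda>u. log_poly X (Complex \<sigma> (s + u)) * of_real (fejer \<Delta> u)))
           \<le> norm (D\<^sub>1 s) + norm (D\<^sub>2 s) + C) \<and>
     (\<forall>A B k. A \<le> B \<longrightarrow>
        integral {A..B} (\<lambda>s. norm (D\<^sub>1 s) ^ (2 * k)) \<le> (B - A + 2 * X ^ (2 * k)) * (fact k * (C * ln (ln X + C)) ^ k) \<and>
        integral {A..B} (\<lambda>s. norm (D\<^sub>2 s) ^ (2 * k)) \<le> (B - A + 2 * X ^ (2 * k)) * (fact k * C ^ k))"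
    proof (rule exI[of _ D1], rule exI[of _ D2], intro conjI allI impI)
      show "continuous_on UNIV D1" unfolding D1_def by (intro continuous_intros cont)
      show "continuous_on UNIV D2" unfolding D2_def by (intro continuous_intros cont)
    next
      fix s
      define f where "f i = ?c i * cis (- (real (snd i) * s * ln (real (fst i))))" for i
      have "integral {-U..U} (\<lambda>u. log_poly X (Complex \<sigma> (s + u)) * of_real (fejer \<Delta> u))
          = D1 s + D2 s + (\<Sum>i\<in>{i \<in> short_prime_powers X. snd i \<ge> 3}. f i)"
        unfolding smoothed_log_poly f_def[symmetric] sum_short_prime_powers
        by (simp add: D1_def D2_def P1_def P2_def f_def)
      also have "norm \<dots> \<le> norm (D1 s) + norm (D2 s) + norm (\<Sum>i\<in>{i \<in> short_prime_powers X. snd i \<ge> 3}. f i)"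
        by (intro norm_triangle_le add_mono norm_triangle_ineq order.refl)
      also have "norm (\<Sum>i\<in>{i \<in> short_prime_powers X. snd i \<ge> 3}. f i)
          \<le> (\<Sum>(p, m)\<in>{i \<in> short_prime_powers X. snd i \<ge> 3}. 33 * real p powr (- real m / 2))"
      proof (intro order.trans[OF norm_sum] sum_mono)
        fix i assume i: "i \<in> {i \<in> short_prime_powers X. snd i \<ge> 3}"
        obtain p m where pm: "i = (p, m)" by force
        have "p > 0" "m \<ge> 1" using i prime_gt_0_nat by (auto simp: pm short_prime_powers_def prime_power_index_def)
        then show "norm (f i) \<le> (case i of (p, m) \<Rightarrow> 33 * real p powr (- real m / 2))"
          using norm_smoothed_coeff[OF \<Delta> U \<sigma>, of p m] by (simp add: pm f_def norm_mult)
      qed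
      also have "\<dots> = 33 * (\<Sum>(p, m)\<in>{i \<in> short_prime_powers X. snd i \<ge> 3}. real p powr (- real m / 2))"
        by (simp add: sum_distrib_left case_prod_unfold)
      also have "\<dots> \<le> C" using high_prime_powers_sum_le[of X] C(4) by linarith
      finally show "norm (integral {-U..U} (\<lambda>u. log_poly X (Complex \<sigma> (s + u)) * of_real (fejer \<Delta> u)))
           \<le> norm (D1 s) + norm (D2 s) + C" by simp
    next
      fix A B :: real and k assume AB: "A \<le> B"
      have lnX: "ln X \<ge> 1" using X exp_le by (subst ln_ge_iff) auto
      have c1: "(\<Sum>p\<in>P1. (norm (?c (p, 1)))\<^sup>2) \<le> C * ln (ln X + C)"
      proof -
        have "(\<Sum>p\<in>P1. (norm (?c (p, 1)))\<^sup>2) \<le> (\<Sum>p\<in>P1. 1089 * (1 / real p))"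
        proof (rule sum_mono)
          fix p assume "p \<in> P1"
          then have p: "p > 0" using P1(2) prime_gt_0_nat by blast
          have "(norm (?c (p, 1)))\<^sup>2 \<le> (33 * real p powr (- real 1 / 2))\<^sup>2"
            by (intro power_mono norm_smoothed_coeff \<Delta> U \<sigma> p) auto
          also have "\<dots> = 1089 * (1 / real p)"
          proof -
            have "real p powr (- real 1 / 2) * real p powr (- real 1 / 2) = real p powr (-1)"
              unfolding powr_add[symmetric] by simp
            also have "\<dots> = 1 / real p" using p by (simp add: powr_minus_divide)
            finally show ?thesis by (simp add: power2_eq_square)
          qed
          finally show "(norm (?c (p, 1)))\<^sup>2 \<le> 1089 * (1 / real p)" .
        qed
        also have "\<dots> = 1089 * (\<Sum>p\<in>P1. 1 / real p)" by (rule sum_distrib_left[symmetric])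
        also have "\<dots> \<le> 1089 * (3 * ln (ln X + 2 * Z))"
          using prime_reciprocal_sum_le[OF X] unfolding P1_def Z_def by (intro mult_left_mono) auto
        also have "\<dots> \<le> 1089 * (3 * ln (ln X + C))"
          using lnX Z C by (intro mult_left_mono ln_mono) auto
        also have "\<dots> = (1089 * 3) * ln (ln X + C)" by simp
        also have "\<dots> \<le> C * ln (ln X + C)"
          using C lnX by (intro mult_right_mono) auto
        finally show ?thesis .
      qed
      have c2: "(\<Sum>p\<in>P2. (norm (?c (p, 2)))\<^sup>2) \<le> C"
      proof -
        have "(\<Sum>p\<in>P2. (norm (?c (p, 2)))\<^sup>2) \<le> (\<Sum>p\<in>P2. 1089 * (real p powr (-2)))"
        proof (rule sum_mono)
          fix p assume "p \<in> P2"
          then have p: "p > 0" using P2(2) prime_gt_0_nat by blast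
          have "(norm (?c (p, 2)))\<^sup>2 \<le> (33 * real p powr (- real 2 / 2))\<^sup>2"
            by (intro power_mono norm_smoothed_coeff \<Delta> U \<sigma> p) auto
          also have "\<dots> = 1089 * (real p powr (-2))"
          proof -
            have "real p powr (- real 2 / 2) * real p powr (- real 2 / 2) = real p powr (-2)"
              unfolding powr_add[symmetric] by simp
            then show ?thesis by (simp add: power2_eq_square)
          qed
          finally show "(norm (?c (p, 2)))\<^sup>2 \<le> 1089 * (real p powr (-2))" .
        qed
        also have "\<dots> = 1089 * (\<Sum>p\<in>P2. real p powr (-2))" by (rule sum_distrib_left[symmetric])
        also have "\<dots> \<le> 1089 * Z"
          unfolding Z_def using P2 prime_gt_0_nat by (intro mult_left_mono sum_powr_primes_le) auto
        finally show ?thesis using C by linarith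
      qed
      have w: "0 \<le> B - A + 2 * X ^ (2 * k)" using AB X by simp
      have "integral {A..B} (\<lambda>s. norm (D1 s) ^ (2 * k)) \<le> (B - A + 2 * X ^ (2 * k)) * (fact k * (\<Sum>p\<in>P1. (norm (?c (p, 1)))\<^sup>2) ^ k)"
        unfolding D1_def by (rule prime_polynomial_moment[OF P1]) (use X AB in auto)
      also have "\<dots> \<le> (B - A + 2 * X ^ (2 * k)) * (fact k * (C * ln (ln X + C)) ^ k)"
        by (intro mult_left_mono power_mono c1 sum_nonneg w) auto
      finally show "integral {A..B} (\<lambda>s. norm (D1 s) ^ (2 * k)) \<le> (B - A + 2 * X ^ (2 * k)) * (fact k * (C * ln (ln X + C)) ^ k)" .
      have "integral {A..B} (\<lambda>s. norm (D2 s) ^ (2 * k)) \<le> (B - A + 2 * X ^ (2 * k)) * (fact k * (\<Sum>p\<in>P2. (norm (?c (p, 2)))\<^sup>2) ^ k)"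
        unfolding D2_def by (rule prime_polynomial_moment[OF P2]) (use X AB in auto)
      also have "\<dots> \<le> (B - A + 2 * X ^ (2 * k)) * (fact k * C ^ k)"
        by (intro mult_left_mono power_mono c2 sum_nonneg w) auto
      finally show "integral {A..B} (\<lambda>s. norm (D2 s) ^ (2 * k)) \<le> (B - A + 2 * X ^ (2 * k)) * (fact k * C ^ k)" .
    qed
  qed
qed

end

section \<open>The moments on a line to the right of the critical line\<close>

text \<open>
  The requirements on \<open>T\<close>, in order: \<open>L = log log (q T) \<ge> 1\<close>; the kernel parameter \<open>log T / (8 k)\<close> is at
  least 16 when \<open>k \<le> K L\<close>; the \<open>2k\<close>-th power of the trivial bound for \<open>\<bar>Y\<bar>\<close> is at most \<open>T\<close>; the error of
  \<open>smoothed_log_approximation\<close> is at most 1 with \<open>U = T/2\<close>; and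
  \<open>ln (ln X + C\<^sub>2)\<close> is at most \<open>2 L\<close>, where \<open>ln X \<le> ln T\<close>.
\<close>
lemma eventually_parameters:
  fixes q K C\<^sub>1 C\<^sub>2 S :: real
  assumes q: "q \<ge> 1" and K: "K > 0" and C1: "C\<^sub>1 \<ge> 1"
  shows "\<forall>\<^sub>F T in at_top. T \<ge> 100 \<and> ln (ln (q * T)) \<ge> 1 \<and> 128 * (K * ln (ln (q * T))) \<le> ln T
      \<and> 2 * K * ln (ln (q * T)) * ln (C\<^sub>1 * ln (4 * T)) \<le> ln T
      \<and> sqrt T / (T / 2)\<^sup>2 * (12 * (C\<^sub>1 * ln (4 * T)) + 4 * sqrt T + 4 * (T / 2) * S) \<le> 1
      \<and> ln T + C\<^sub>2 \<le> (ln T)\<^sup>2"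
proof (intro eventually_conj)
  have le1: "\<forall>\<^sub>F T in at_top. f T \<le> 1" if "(f \<longlongrightarrow> 0) at_top" for f :: "real \<Rightarrow> real"
    using order_tendstoD(2)[OF that, of 1] by (auto elim: eventually_mono)
  show "\<forall>\<^sub>F T in at_top. (T::real) \<ge> 100" by (rule eventually_ge_at_top)
  have "filterlim (\<lambda>T. ln (ln (q * T))) at_top at_top" using q by real_asymp
  then show "\<forall>\<^sub>F T in at_top. ln (ln (q * T)) \<ge> 1" by (simp add: filterlim_at_top)
  have pos: "\<forall>\<^sub>F T in at_top. ln T > (0::real)" by real_asymp
  have "((\<lambda>T. 128 * (K * ln (ln (q * T))) / ln T) \<longlongrightarrow> 0) at_top" using q K by real_asymp
  from le1[OF this] pos show "\<forall>\<^sub>F T in at_top. 128 * (K * ln (ln (q * T))) \<le> ln T"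
    by eventually_elim (simp add: field_simps)
  have "((\<lambda>T. 2 * K * ln (ln (q * T)) * ln (C\<^sub>1 * ln (4 * T)) / ln T) \<longlongrightarrow> 0) at_top" using q K C1 by real_asymp
  from le1[OF this] pos show "\<forall>\<^sub>F T in at_top. 2 * K * ln (ln (q * T)) * ln (C\<^sub>1 * ln (4 * T)) \<le> ln T"
    by eventually_elim (simp add: field_simps)
  have "((\<lambda>T. sqrt T / (T / 2)\<^sup>2 * (12 * (C\<^sub>1 * ln (4 * T)) + 4 * sqrt T + 4 * (T / 2) * S)) \<longlongrightarrow> 0) at_top"
  proof -
    have 1: "((\<lambda>T. sqrt T / (T / 2)\<^sup>2 * (12 * (C\<^sub>1 * ln (4 * T)) + 4 * sqrt T)) \<longlongrightarrow> 0) at_top" using C1 by real_asymp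
    have 2: "((\<lambda>T. S * (sqrt T / (T / 2)\<^sup>2 * (4 * (T / 2)))) \<longlongrightarrow> 0) at_top"
      by (rule tendsto_mult_right_zero) real_asymp
    from tendsto_add[OF 1 2] show ?thesis by (simp add: algebra_simps)
  qed
  from le1[OF this] show "\<forall>\<^sub>F T in at_top. sqrt T / (T / 2)\<^sup>2 * (12 * (C\<^sub>1 * ln (4 * T)) + 4 * sqrt T + 4 * (T / 2) * S) \<le> 1" .
  have "\<forall>\<^sub>F T in at_top. ln T \<ge> max 2 (\<bar>C\<^sub>2\<bar>)"
    using filterlim_at_top[THEN iffD1, OF ln_at_top] by blast
  then show "\<forall>\<^sub>F T in at_top. ln T + C\<^sub>2 \<le> (ln T)\<^sup>2"
  proof eventually_elim
    case (elim T)
    have e: "2 \<le> ln T" "\<bar>C\<^sub>2\<bar> \<le> ln T" using elim by auto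
    then have "2 * ln T \<le> ln T * ln T" by (intro mult_right_mono) auto
    then show ?case using e unfolding power2_eq_square by linarith
  qed
qed

lemma fact_le_power_real: "(fact k :: real) \<le> real k ^ k"
  for k :: nat
  using fact_le_power[of k, where 'a = real] by simp

text \<open>
  Superadditivity of the power, which collects the contributions into the single constant of the theorem.
\<close>
lemma power_add_le:
  fixes a b :: real
  assumes "a \<ge> 0" "b \<ge> 0" "k \<ge> 1"
  shows "a ^ k + b ^ k \<le> (a + b) ^ k"
proof -
  obtain n where n: "k = Suc n" using assms(3) by (cases k) auto
  have "a * a ^ n \<le> a * (a + b) ^ n" "b * b ^ n \<le> b * (a + b) ^ n"
    using assms by (auto intro!: mult_left_mono power_mono)
  then show ?thesis by (simp add: n distrib_right)
qed

context GRH_character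
begin

text \<open>
  Up to the tail means, which are absorbed, \<open>\<bar>Y t\<bar>\<close> is at most the sum of the Dirichlet polynomials at
  \<open>t + h\<close> and \<open>t - h\<close> and of an error \<open>C\<^sub>4 k\<close>. The moments of the polynomials are at most a constant to the power \<open>k\<close> times
  \<open>T k\<^sup>k L\<^sup>k\<close>, and \<open>(C\<^sub>4 k)\<^sup>2 \<le> C\<^sub>4\<^sup>2 K k L\<close>. All constants are independent of \<open>\<sigma>\<close>, which permits the limit
  at \<open>1/2\<close>; the bound uniform in \<open>t\<close> is recorded for the same purpose.
\<close>
theorem moment_right_of_critical_line:
  assumes K: "K > 0"
  shows "\<exists>C>0. \<exists>T\<^sub>0\<ge>3. \<exists>C\<^sub>1. \<forall>T\<ge>T\<^sub>0. \<forall>\<sigma>. 1/2 < \<sigma> \<and> \<sigma> \<le> 1 \<longrightarrow>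
     (\<forall>t\<in>{T..2 * T}. \<bar>Im (logL (Complex \<sigma> t))\<bar> \<le> C\<^sub>1 * ln (4 * T)) \<and>
     (\<forall>k. 1 \<le> k \<and> real k \<le> K * loglog q T \<longrightarrow>
       integral {T..2 * T} (\<lambda>t. \<bar>Im (logL (Complex \<sigma> t))\<bar> ^ (2 * k)) \<le> T * (C * real k * loglog q T) ^ k)"
proof -
  obtain C\<^sub>0 where C0: "C\<^sub>0 \<ge> 1" and bounds: "\<And>t \<sigma>. t \<ge> 2 \<Longrightarrow> 1/2 < \<sigma> \<and> \<sigma> \<le> 2 \<Longrightarrow>
     - C\<^sub>0 * ln (t + 4) \<le> Re (deriv logL (Complex \<sigma> t)) \<and>
     \<bar>Im (logL (Complex \<sigma> t))\<bar> \<le> C\<^sub>0 * ln (t + 4) \<and>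
     norm (logL (Complex \<sigma> t)) \<le> C\<^sub>0 * ln (t + 4) * (1 + (\<sigma> - 1/2) powr (-1/2))"
    using logL_bounds by blast
  obtain C\<^sub>2 where C2: "C\<^sub>2 \<ge> 1" and polys: "\<forall>\<Delta>\<ge>16. \<forall>U\<ge>1. \<forall>\<sigma>>1/2. \<forall>X\<ge>3.
     \<exists>(D\<^sub>1 :: real \<Rightarrow> complex) (D\<^sub>2 :: real \<Rightarrow> complex). continuous_on UNIV D\<^sub>1 \<and> continuous_on UNIV D\<^sub>2 \<and>
     (\<forall>s. norm (integral {-U..U} (\<lambda>u. log_poly X (Complex \<sigma> (s + u)) * of_real (fejer \<Delta> u)))
           \<le> norm (D\<^sub>1 s) + norm (D\<^sub>2 s) + C\<^sub>2) \<and>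
     (\<forall>A B k. A \<le> B \<longrightarrow>
        integral {A..B} (\<lambda>s. norm (D\<^sub>1 s) ^ (2 * k)) \<le> (B - A + 2 * X ^ (2 * k)) * (fact k * (C\<^sub>2 * ln (ln X + C\<^sub>2)) ^ k) \<and>
        integral {A..B} (\<lambda>s. norm (D\<^sub>2 s) ^ (2 * k)) \<le> (B - A + 2 * X ^ (2 * k)) * (fact k * C\<^sub>2 ^ k))"
    using smoothed_poly_moments by (elim exE conjE)
  define C\<^sub>1 where "C\<^sub>1 = C\<^sub>0 + prime_power_sum"
  have C1: "C\<^sub>1 \<ge> 1" "C\<^sub>1 \<ge> C\<^sub>0" "C\<^sub>1 \<ge> prime_power_sum" using C0 prime_power_sum_nonneg by (auto simp: C\<^sub>1_def)
  define C\<^sub>4 where "C\<^sub>4 = 2 + 2 * C\<^sub>2 + 16416 * C\<^sub>1"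
  have C4: "C\<^sub>4 \<ge> 0" using C1 C2 by (simp add: C\<^sub>4_def)
  define C where "C = 100 * (24 * C\<^sub>2 + C\<^sub>4\<^sup>2 * K) + 1"
  have C: "C > 0" unfolding C_def using C2 K by (intro add_nonneg_pos mult_nonneg_nonneg add_nonneg_nonneg) auto
  have q1: "real q \<ge> 1" using q_pos by simp
  obtain T\<^sub>1 where T1: "\<And>T. T \<ge> T\<^sub>1 \<Longrightarrow> T \<ge> 100 \<and> ln (ln (real q * T)) \<ge> 1 \<and> 128 * (K * ln (ln (real q * T))) \<le> ln T
      \<and> 2 * K * ln (ln (real q * T)) * ln (C\<^sub>1 * ln (4 * T)) \<le> ln T
      \<and> sqrt T / (T / 2)\<^sup>2 * (12 * (C\<^sub>1 * ln (4 * T)) + 4 * sqrt T + 4 * (T / 2) * prime_power_sum) \<le> 1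
      \<and> ln T + C\<^sub>2 \<le> (ln T)\<^sup>2"
    using eventually_parameters[OF q1 K C1(1), of prime_power_sum C\<^sub>2] unfolding eventually_at_top_linorder by blast
  show ?thesis
  proof (rule exI[of _ C], rule conjI[OF C], rule exI[of _ "max 3 T\<^sub>1"], rule conjI[OF max.cobounded1],
      rule exI[of _ C\<^sub>1], intro allI impI conjI ballI)
    fix T \<sigma> :: real assume T0: "max 3 T\<^sub>1 \<le> T" and \<sigma>: "1/2 < \<sigma> \<and> \<sigma> \<le> 1"
    define L where "L = loglog q T"
    have T: "T \<ge> 100" and L1: "L \<ge> 1" and p3: "128 * (K * L) \<le> ln T" and p4: "2 * K * L * ln (C\<^sub>1 * ln (4 * T)) \<le> ln T"
      and p5: "sqrt T / (T / 2)\<^sup>2 * (12 * (C\<^sub>1 * ln (4 * T)) + 4 * sqrt T + 4 * (T / 2) * prime_power_sum) \<le> 1"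
      and p6: "ln T + C\<^sub>2 \<le> (ln T)\<^sup>2"
      using T1[of T] T0 by (auto simp: L_def loglog_def)
    define M where "M = C\<^sub>1 * ln (4 * T)"
    have lnT: "ln T \<ge> 1" using T exp_le by (subst ln_ge_iff) auto
    have ln4T: "1 \<le> ln (4 * T)" "ln (4 * T) \<le> 2 * ln T"
    proof -
      have "ln T \<le> ln (4 * T)" using T by simp
      then show "1 \<le> ln (4 * T)" using lnT by linarith
      have "ln (4 * T) = ln 4 + ln T" using T by (simp add: ln_mult)
      moreover have "ln 4 \<le> ln T" using T by simp
      ultimately show "ln (4 * T) \<le> 2 * ln T" by linarith
    qed
    have M: "M \<ge> 1" using mult_mono[of 1 C\<^sub>1 1 "ln (4 * T)"] C1 ln4T by (simp add: M_def)
    have heights: "C\<^sub>0 * ln (y + 4) \<le> M" if "2 \<le> y" "y \<le> 4 * T - 4" for y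
      unfolding M_def using that T C0 C1 by (intro mult_mono) auto
    define Y where "Y t = Im (logL (Complex \<sigma> t))" for t
    have up: "Complex x y \<in> upper_right" if "x > 1/2" "y > 0" for x y using that by (simp add: upper_right_def)
    have Yd: "(Y has_real_derivative Re (deriv logL (Complex \<sigma> t))) (at t)" if "t > 0" for t
    proof -
      have "((\<lambda>t. Complex \<sigma> t) has_vector_derivative \<i>) (at t)"
        unfolding Complex_eq by (auto intro!: derivative_eq_intros simp: has_vector_derivative_def scaleR_conv_of_real)
      from field_vector_diff_chain_at[OF this logL_derivative[OF up]] \<sigma> that
      have "((\<lambda>t. logL (Complex \<sigma> t)) has_vector_derivative \<i> * deriv logL (Complex \<sigma> t)) (at t)"
        by (simp add: o_def)
      from bounded_linear.has_vector_derivative[OF bounded_linear_Im this]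
      show ?thesis unfolding Y_def by (simp add: has_real_derivative_iff_has_vector_derivative)
    qed
    have Yc: "continuous_on A Y" if "A \<subseteq> {0<..}" for A
      by (intro continuous_at_imp_continuous_on ballI DERIV_isCont[OF Yd]) (use that in auto)
    have Ybd: "\<bar>Y y\<bar> \<le> M" if "2 \<le> y" "y \<le> 4 * T - 4" for y
      using bounds[of y \<sigma>] heights[OF that] that \<sigma> unfolding Y_def by linarith
    have Ymono: "Y x - M * (y - x) \<le> Y y" if xy: "2 \<le> x" "x \<le> y" "y \<le> 4 * T - 4" for x y
    proof -
      have "Y x + M * x \<le> Y y + M * y"
      proof (rule DERIV_nonneg_imp_nondecreasing[OF xy(2)])
        fix z assume z: "x \<le> z" "z \<le> y"
        have "((\<lambda>z. Y z + M * z) has_real_derivative Re (deriv logL (Complex \<sigma> z)) + M * 1) (at z)"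
          by (intro DERIV_add Yd DERIV_cmult DERIV_ident) (use z xy in auto)
        moreover have "0 \<le> Re (deriv logL (Complex \<sigma> z)) + M * 1"
          using bounds[of z \<sigma>] heights[of z] z xy \<sigma> by simp
        ultimately show "\<exists>d. ((\<lambda>z. Y z + M * z) has_real_derivative d) (at z) \<and> 0 \<le> d" by blast
      qed
      then show ?thesis by (simp add: algebra_simps)
    qed
    show "\<bar>Im (logL (Complex \<sigma> t))\<bar> \<le> C\<^sub>1 * ln (4 * T)" if "t \<in> {T..2 * T}" for t
      using Ybd[of t] that T by (auto simp: Y_def M_def)
    fix k assume k: "1 \<le> k \<and> real k \<le> K * loglog q T"
    then have k1: "real k \<ge> 1" and kL: "real k \<le> K * L" by (auto simp: L_def)
    \<comment> \<open>The length of the Dirichlet polynomial: its \<open>2k\<close>-th power has length \<open>sqrt T\<close>.\<close>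
    define \<Delta> where "\<Delta> = ln T / (8 * real k)"
    have \<Delta>: "\<Delta> \<ge> 16" using p3 kL k1 by (simp add: \<Delta>_def field_simps)
    define h where "h = 16 / \<Delta>"
    have h: "0 < h" "h \<le> 1" using \<Delta> by (auto simp: h_def field_simps)
    \<comment> \<open>The contour extends over heights between \<open>T/2 - 1\<close> and \<open>5 T/2 + 1\<close>, where all bounds for \<open>logL\<close> are
      \<open>O(log T)\<close>, and the factor \<open>1 / U\<^sup>2\<close> makes its error small.\<close>
    define U where "U = T / 2"
    define X where "X = exp (2 * \<Delta>)"
    have sqrtT: "sqrt T = exp (ln T / 2)" using T by (simp add: powr_half_sqrt[symmetric] powr_def)
    have X2k: "X ^ (2 * k) = sqrt T"
      unfolding X_def sqrtT exp_of_nat_mult[symmetric] using k1 by (simp add: \<Delta>_def field_simps)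
    have "X \<ge> 2 * \<Delta> + 1" unfolding X_def using exp_ge_add_one_self[of "2 * \<Delta>"] by linarith
    then have X3: "X \<ge> 3" using \<Delta> by simp
    have "2 * \<Delta> * 2 \<le> ln T / 2" using k1 lnT by (simp add: \<Delta>_def field_simps)
    then have e4: "exp (4 * \<Delta>) \<le> sqrt T" unfolding sqrtT by simp
    have XT: "X \<le> sqrt T"
    proof -
      have "X \<le> exp (4 * \<Delta>)" unfolding X_def using \<Delta> by simp
      then show ?thesis using e4 by linarith
    qed
    have lnX: "ln X \<le> ln T" using k1 lnT by (simp add: X_def \<Delta>_def field_simps)
    obtain D\<^sub>1 D\<^sub>2 :: "real \<Rightarrow> complex" where Dc: "continuous_on UNIV D\<^sub>1" "continuous_on UNIV D\<^sub>2"
      and Dle: "\<And>s. norm (integral {-U..U} (\<lambda>u. log_poly X (Complex \<sigma> (s + u)) * of_real (fejer \<Delta> u)))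
           \<le> norm (D\<^sub>1 s) + norm (D\<^sub>2 s) + C\<^sub>2"
      and Dm: "\<And>A B. A \<le> B \<Longrightarrow>
        integral {A..B} (\<lambda>s. norm (D\<^sub>1 s) ^ (2 * k)) \<le> (B - A + 2 * X ^ (2 * k)) * (fact k * (C\<^sub>2 * ln (ln X + C\<^sub>2)) ^ k) \<and>
        integral {A..B} (\<lambda>s. norm (D\<^sub>2 s) ^ (2 * k)) \<le> (B - A + 2 * X ^ (2 * k)) * (fact k * C\<^sub>2 ^ k)"
    proof -
      have "U \<ge> 1" "\<sigma> > 1/2" using T \<sigma> by (auto simp: U_def)
      from polys[rule_format, OF \<Delta> this X3] show ?thesis using that by blast
    qed
    have J: "\<bar>integral {-U..U} (\<lambda>u. Y (s + u) * fejer \<Delta> u)\<bar> \<le> norm (D\<^sub>1 s) + norm (D\<^sub>2 s) + (C\<^sub>2 + 1)"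
      if s: "T - 1 \<le> s" "s \<le> 2 * T + 1" for s
    proof -
      define E where "E = integral {-U..U} (\<lambda>u. (logL (Complex \<sigma> (s + u)) - log_poly X (Complex \<sigma> (s + u))) * of_real (fejer \<Delta> u))"
      have "norm E \<le> exp (4 * \<Delta>) / U\<^sup>2 * (12 * M + 4 * exp (2 * \<Delta>) + 4 * U * prime_power_sum)"
        unfolding E_def X_def
      proof (rule smoothed_log_approximation)
        fix x y :: real assume x: "1/2 < x" "x \<le> 4" and y: "\<bar>y - s\<bar> \<le> U"
        have y2: "2 \<le> y" "y \<le> 4 * T - 4" using y s T unfolding U_def by linarith+
        show "norm (logL (Complex x y)) \<le> M * (1 + (x - 1/2) powr (-1/2))"
        proof (cases "x \<le> 2")
          case True
          have "norm (logL (Complex x y)) \<le> C\<^sub>0 * ln (y + 4) * (1 + (x - 1/2) powr (-1/2))"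
            using bounds[of y x] y2 x True by blast
          also have "\<dots> \<le> M * (1 + (x - 1/2) powr (-1/2))"
            using heights[OF y2] by (intro mult_right_mono) auto
          finally show ?thesis .
        next
          case False
          have "norm (logL (Complex x y)) \<le> prime_power_sum"
            using norm_log_series_le[of "Complex x y"] logL_eq[OF up, of x y] x y2 False by simp
          also have "\<dots> \<le> M * 1"
            unfolding M_def using C1 ln4T mult_mono[of prime_power_sum C\<^sub>1 1 "ln (4 * T)"] prime_power_sum_nonneg by simp
          also have "\<dots> \<le> M * (1 + (x - 1/2) powr (-1/2))" using M by (intro mult_left_mono) auto
          finally show ?thesis .
        qed
      qed (use \<Delta> T \<sigma> s M in \<open>auto simp: U_def\<close>)
      also have "\<dots> \<le> sqrt T / U\<^sup>2 * (12 * M + 4 * sqrt T + 4 * U * prime_power_sum)"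
        using e4 XT M T prime_power_sum_nonneg
        by (intro mult_mono divide_right_mono add_mono) (auto simp: X_def U_def)
      also have "\<dots> \<le> 1" using p5 by (simp add: U_def M_def)
      finally have E1: "norm E \<le> 1" .
      have fc: "continuous_on {-U..U} (\<lambda>u. complex_of_real (fejer \<Delta> u))"
        by (intro continuous_intros continuous_on_fejer)
      have Cc: "continuous_on {-U..U} (\<lambda>u. Complex \<sigma> (s + u))"
        unfolding Complex_eq by (intro continuous_intros)
      have lc: "continuous_on {-U..U} (\<lambda>u. logL (Complex \<sigma> (s + u)))"
        by (rule continuous_on_compose2[OF holomorphic_on_imp_continuous_on[OF logL_holomorphic] Cc])
           (use s T \<sigma> in \<open>auto simp: upper_right_def U_def\<close>)
      have pc: "continuous_on {-U..U} (\<lambda>u. log_poly X (Complex \<sigma> (s + u)))"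
        by (rule continuous_on_compose2[OF holomorphic_on_imp_continuous_on[OF log_poly_holomorphic[of X UNIV]] Cc]) auto
      have "integral {-U..U} (\<lambda>u. logL (Complex \<sigma> (s + u)) * of_real (fejer \<Delta> u))
          = integral {-U..U} (\<lambda>u. (logL (Complex \<sigma> (s + u)) - log_poly X (Complex \<sigma> (s + u))) * of_real (fejer \<Delta> u)
              + log_poly X (Complex \<sigma> (s + u)) * of_real (fejer \<Delta> u))"
        by (simp add: algebra_simps)
      also have "\<dots> = E + integral {-U..U} (\<lambda>u. log_poly X (Complex \<sigma> (s + u)) * of_real (fejer \<Delta> u))"
        unfolding E_def by (intro integral_add integrable_continuous_real continuous_intros lc pc fc)
      finally have eq: "integral {-U..U} (\<lambda>u. logL (Complex \<sigma> (s + u)) * of_real (fejer \<Delta> u))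
          = E + integral {-U..U} (\<lambda>u. log_poly X (Complex \<sigma> (s + u)) * of_real (fejer \<Delta> u))" .
      have tot: "norm (integral {-U..U} (\<lambda>u. logL (Complex \<sigma> (s + u)) * of_real (fejer \<Delta> u))) \<le> norm (D\<^sub>1 s) + norm (D\<^sub>2 s) + (C\<^sub>2 + 1)"
        unfolding eq using E1 Dle[of s] norm_triangle_ineq[of E "integral {-U..U} (\<lambda>u. log_poly X (Complex \<sigma> (s + u)) * of_real (fejer \<Delta> u))"]
        by linarith
      have "integral {-U..U} (\<lambda>u. Im (logL (Complex \<sigma> (s + u)) * of_real (fejer \<Delta> u)))
          = Im (integral {-U..U} (\<lambda>u. logL (Complex \<sigma> (s + u)) * of_real (fejer \<Delta> u)))"
        using integral_linear[OF integrable_continuous_real[OF continuous_on_mult[OF lc fc]] bounded_linear_Im]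
        by (simp add: o_def)
      then have "integral {-U..U} (\<lambda>u. Y (s + u) * fejer \<Delta> u)
          = Im (integral {-U..U} (\<lambda>u. logL (Complex \<sigma> (s + u)) * of_real (fejer \<Delta> u)))"
        by (simp add: Y_def)
      then show ?thesis
        using order.trans[OF abs_Im_le_cmod tot] by simp
    qed
    define A where "A t = norm (D\<^sub>1 (t + h)) + norm (D\<^sub>1 (t - h)) + norm (D\<^sub>2 (t + h)) + norm (D\<^sub>2 (t - h)) + C\<^sub>4 * real k" for t
    have Dc': "continuous_on B (\<lambda>t. D\<^sub>1 (t + c))" "continuous_on B (\<lambda>t. D\<^sub>2 (t + c))" for B c
      by (rule continuous_on_compose2[OF Dc(1)] continuous_on_compose2[OF Dc(2)]; auto intro!: continuous_intros)+
    note Dc'' = Dc'[of _ "- h", unfolded add_uminus_conv_diff]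
    define n where "n = 2 * k - 1"
    have n: "Suc n = 2 * k" "n \<ge> 1" using k by (auto simp: n_def)
    have pointwise: "\<bar>Y t\<bar> \<le> A t + (fejer_tail_mean \<Delta> Y (t + h) + fejer_tail_mean \<Delta> Y (t - h))"
      if t: "t \<in> {T..2 * T}" for t
    proof -
      have combine: "y \<le> a1 + a2 + b1 + b2 + e + f" if "y \<le> i1 + i2 + f + m" "m \<le> p" "2 * c + 2 \<le> r" "e = r + p"
        "i1 \<le> a1 + b1 + (c + 1)" "i2 \<le> a2 + b2 + (c + 1)" for y a1 a2 b1 b2 c e f i1 i2 m p r :: real
        using that by linarith
      have "\<bar>Y t\<bar> \<le> \<bar>integral {-U..U} (\<lambda>u. Y (t + h + u) * fejer \<Delta> u)\<bar> + \<bar>integral {-U..U} (\<lambda>u. Y (t - h + u) * fejer \<Delta> u)\<bar>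
     + (fejer_tail_mean \<Delta> Y (t + h) + fejer_tail_mean \<Delta> Y (t - h)) + 1026 * M / \<Delta>"
      proof (rule quasi_monotone_abs_bound[OF \<Delta> h_def])
        show "continuous_on {t - h - U..t + h + U} Y" by (rule Yc) (use t h T in \<open>auto simp: U_def\<close>)
      qed (use t h T in \<open>auto simp: U_def intro!: Ybd Ymono\<close>)
      \<comment> \<open>Here \<open>M = O(log T)\<close> and \<open>\<Delta> = log T / (8 k)\<close>, so the quotient is \<open>O(k)\<close>; \<open>16416 = 1026 * 2 * 8\<close>.\<close>
      moreover have "1026 * M / \<Delta> \<le> 16416 * C\<^sub>1 * real k"
      proof -
        have "M \<le> C\<^sub>1 * (2 * ln T)" unfolding M_def using ln4T C1 by (intro mult_left_mono) auto
        then have "1026 * M / \<Delta> \<le> 1026 * (C\<^sub>1 * (2 * ln T)) / \<Delta>" using \<Delta> by (intro divide_right_mono mult_left_mono) auto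
        also have "\<dots> = 16416 * C\<^sub>1 * real k" using lnT k1 by (simp add: \<Delta>_def field_simps)
        finally show ?thesis .
      qed
      moreover have "2 * C\<^sub>2 + 2 \<le> (2 + 2 * C\<^sub>2) * real k"
      proof -
        have "(2 + 2 * C\<^sub>2) * 1 \<le> (2 + 2 * C\<^sub>2) * real k" by (rule mult_left_mono[OF k1]) (use C2 in auto)
        then show ?thesis by simp
      qed
      moreover have "C\<^sub>4 * real k = (2 + 2 * C\<^sub>2) * real k + 16416 * C\<^sub>1 * real k"
        by (simp add: C\<^sub>4_def algebra_simps)
      moreover have "\<bar>integral {-U..U} (\<lambda>u. Y (t + h + u) * fejer \<Delta> u)\<bar> \<le> norm (D\<^sub>1 (t + h)) + norm (D\<^sub>2 (t + h)) + (C\<^sub>2 + 1)"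
        by (rule J) (use t h in auto)
      moreover have "\<bar>integral {-U..U} (\<lambda>u. Y (t - h + u) * fejer \<Delta> u)\<bar> \<le> norm (D\<^sub>1 (t - h)) + norm (D\<^sub>2 (t - h)) + (C\<^sub>2 + 1)"
        by (rule J) (use t h in auto)
      ultimately show ?thesis unfolding A_def by (rule combine)
    qed
    have main: "integral {T..2 * T} (\<lambda>t. \<bar>Y t\<bar> ^ Suc n) \<le> 2 ^ Suc n * integral {T..2 * T} (\<lambda>t. A t ^ Suc n) + M ^ Suc n"
    proof (rule moment_from_pointwise_bound[OF \<Delta> h_def _ n(2) _ _ _ _ pointwise])
      show "continuous_on {T - 2..2 * T + 2} Y" by (rule Yc) (use T in auto)
      show "\<bar>Y x\<bar> \<le> M" if "x \<in> {T - 2..2 * T + 2}" for x using that T by (intro Ybd) auto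
      show "continuous_on {T..2 * T} A" unfolding A_def by (intro continuous_intros Dc' Dc'')
      show "0 \<le> A t" for t unfolding A_def using C4 by (intro add_nonneg_nonneg) auto
    qed (use T in auto)
    define B where "B = (2 * C\<^sub>2 * real k * L) ^ k"
    have B: "B \<ge> 0" unfolding B_def using C2 k1 L1 by simp
    have pow5: "A t ^ Suc n \<le> 5 ^ Suc n * (norm (D\<^sub>1 (t + h)) ^ Suc n + norm (D\<^sub>1 (t - h)) ^ Suc n + norm (D\<^sub>2 (t + h)) ^ Suc n
        + norm (D\<^sub>2 (t - h)) ^ Suc n + (C\<^sub>4 * real k) ^ Suc n)" for t
    proof -
      define xs where "xs = [norm (D\<^sub>1 (t + h)), norm (D\<^sub>1 (t - h)), norm (D\<^sub>2 (t + h)), norm (D\<^sub>2 (t - h)), C\<^sub>4 * real k]"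
      have nn: "x \<ge> 0" if "x \<in> set xs" for x using that C4 by (auto simp: xs_def)
      have "A t ^ Suc n = sum_list xs ^ Suc n" by (simp add: A_def xs_def add.assoc)
      also have "\<dots> \<le> real (length xs) ^ n * (\<Sum>x\<leftarrow>xs. x ^ Suc n)" by (rule sum_list_power_le[OF nn])
      also have "\<dots> \<le> 5 ^ Suc n * (\<Sum>x\<leftarrow>xs. x ^ Suc n)"
      proof (rule mult_right_mono)
        show "0 \<le> (\<Sum>x\<leftarrow>xs. x ^ Suc n)"
        proof (rule sum_list_nonneg)
          fix y assume "y \<in> set (map (\<lambda>x. x ^ Suc n) xs)"
          then obtain x where "x \<in> set xs" "y = x ^ Suc n" by auto
          then show "0 \<le> y" using nn[of x] by simp
        qed
      qed (simp add: xs_def)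
      finally show ?thesis by (simp add: xs_def add.assoc del: power_Suc)
    qed
    have kk: "fact k \<le> real k ^ k" by (rule fact_le_power_real)
    have w: "2 * T + c - (T + c) + 2 * X ^ (2 * k) \<le> 3 * T" for c
    proof -
      have "sqrt T \<le> T" using T by (intro real_le_lsqrt) (auto simp: power2_eq_square)
      then show ?thesis using X2k by simp
    qed
    have lnlnX: "ln (ln X + C\<^sub>2) \<le> 2 * L" "0 \<le> ln (ln X + C\<^sub>2)"
    proof -
      have lX: "ln X \<ge> 1" using X3 exp_le by (subst ln_ge_iff) auto
      have lnqT: "ln T \<le> ln (real q * T)" using T q1 mult_right_mono[of 1 "real q" T] by (intro ln_mono) auto
      have "ln (ln X + C\<^sub>2) \<le> ln ((ln T)\<^sup>2)" by (rule ln_mono) (use lnX p6 lX C2 in auto)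
      also have "\<dots> = 2 * ln (ln T)" using lnT by (simp add: ln_realpow)
      also have "ln (ln T) \<le> L" unfolding L_def loglog_def by (rule ln_mono) (use lnqT lnT in auto)
      finally show "ln (ln X + C\<^sub>2) \<le> 2 * L" by simp
      show "0 \<le> ln (ln X + C\<^sub>2)" using lX C2 by (intro ln_ge_zero) auto
    qed
    have D1m: "integral {T..2 * T} (\<lambda>t. norm (D\<^sub>1 (t + c)) ^ Suc n) \<le> 3 * T * B" for c
    proof -
      have "integral {T..2 * T} (\<lambda>t. norm (D\<^sub>1 (t + c)) ^ Suc n) = integral {T + c..2 * T + c} (\<lambda>t. norm (D\<^sub>1 t) ^ Suc n)"
        by (rule integral_shift_real) (intro continuous_intros continuous_on_subset[OF Dc(1)], auto)
      also have "\<dots> \<le> (2 * T + c - (T + c) + 2 * X ^ (2 * k)) * (fact k * (C\<^sub>2 * ln (ln X + C\<^sub>2)) ^ k)"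
        unfolding n using Dm[of "T + c" "2 * T + c"] T by simp
      also have "\<dots> \<le> (3 * T) * (real k ^ k * (C\<^sub>2 * (2 * L)) ^ k)"
        using C2 lnlnX T L1 kk X3 by (intro mult_mono w kk power_mono mult_left_mono) auto
      also have "real k ^ k * (C\<^sub>2 * (2 * L)) ^ k = B" unfolding B_def power_mult_distrib[symmetric] by (simp add: mult_ac)
      finally show ?thesis .
    qed
    have D2m: "integral {T..2 * T} (\<lambda>t. norm (D\<^sub>2 (t + c)) ^ Suc n) \<le> 3 * T * B" for c
    proof -
      have "integral {T..2 * T} (\<lambda>t. norm (D\<^sub>2 (t + c)) ^ Suc n) = integral {T + c..2 * T + c} (\<lambda>t. norm (D\<^sub>2 t) ^ Suc n)"
        by (rule integral_shift_real) (intro continuous_intros continuous_on_subset[OF Dc(2)], auto)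
      also have "\<dots> \<le> (2 * T + c - (T + c) + 2 * X ^ (2 * k)) * (fact k * C\<^sub>2 ^ k)"
        unfolding n using Dm[of "T + c" "2 * T + c"] T by simp
      also have "\<dots> \<le> (3 * T) * (real k ^ k * (C\<^sub>2 * (2 * L)) ^ k)"
        using C2 T L1 kk X3 mult_left_mono[of 1 "2 * L" C\<^sub>2] by (intro mult_mono w kk power_mono) auto
      also have "real k ^ k * (C\<^sub>2 * (2 * L)) ^ k = B" unfolding B_def power_mult_distrib[symmetric] by (simp add: mult_ac)
      finally show ?thesis .
    qed
    have Di: "(\<lambda>t. norm (D\<^sub>1 (t + c)) ^ Suc n) integrable_on {T..2 * T}" "(\<lambda>t. norm (D\<^sub>2 (t + c)) ^ Suc n) integrable_on {T..2 * T}" for c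
      by (intro integrable_continuous_real continuous_intros Dc')+
    have "integral {T..2 * T} (\<lambda>t. A t ^ Suc n)
       \<le> integral {T..2 * T} (\<lambda>t. 5 ^ Suc n * (norm (D\<^sub>1 (t + h)) ^ Suc n + norm (D\<^sub>1 (t + (- h))) ^ Suc n + norm (D\<^sub>2 (t + h)) ^ Suc n
        + norm (D\<^sub>2 (t + (- h))) ^ Suc n + (C\<^sub>4 * real k) ^ Suc n))"
    proof (rule integral_le)
      show "(\<lambda>t. A t ^ Suc n) integrable_on {T..2 * T}"
        unfolding A_def by (intro integrable_continuous_real continuous_intros Dc' Dc'')
      show "(\<lambda>t. 5 ^ Suc n * (norm (D\<^sub>1 (t + h)) ^ Suc n + norm (D\<^sub>1 (t + (- h))) ^ Suc n + norm (D\<^sub>2 (t + h)) ^ Suc n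
        + norm (D\<^sub>2 (t + (- h))) ^ Suc n + (C\<^sub>4 * real k) ^ Suc n)) integrable_on {T..2 * T}"
        by (intro integrable_continuous_real continuous_intros Dc')
      show "A t ^ Suc n \<le> 5 ^ Suc n * (norm (D\<^sub>1 (t + h)) ^ Suc n + norm (D\<^sub>1 (t + (- h))) ^ Suc n + norm (D\<^sub>2 (t + h)) ^ Suc n
        + norm (D\<^sub>2 (t + (- h))) ^ Suc n + (C\<^sub>4 * real k) ^ Suc n)" for t
        using pow5[of t] by (simp only: add_uminus_conv_diff)
    qed
    also have "\<dots> = 5 ^ Suc n * (integral {T..2 * T} (\<lambda>t. norm (D\<^sub>1 (t + h)) ^ Suc n) + integral {T..2 * T} (\<lambda>t. norm (D\<^sub>1 (t + (- h))) ^ Suc n)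
        + integral {T..2 * T} (\<lambda>t. norm (D\<^sub>2 (t + h)) ^ Suc n) + integral {T..2 * T} (\<lambda>t. norm (D\<^sub>2 (t + (- h))) ^ Suc n)
        + T * (C\<^sub>4 * real k) ^ Suc n)"
    proof (rule integral_unique)
      have hc: "((\<lambda>t. (C\<^sub>4 * real k) ^ Suc n) has_integral T * (C\<^sub>4 * real k) ^ Suc n) {T..2 * T}"
        using has_integral_const_real[of "(C\<^sub>4 * real k) ^ Suc n" T "2 * T"] T by simp
      show "((\<lambda>t. 5 ^ Suc n * (norm (D\<^sub>1 (t + h)) ^ Suc n + norm (D\<^sub>1 (t + (- h))) ^ Suc n + norm (D\<^sub>2 (t + h)) ^ Suc n
        + norm (D\<^sub>2 (t + (- h))) ^ Suc n + (C\<^sub>4 * real k) ^ Suc n)) has_integral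
        5 ^ Suc n * (integral {T..2 * T} (\<lambda>t. norm (D\<^sub>1 (t + h)) ^ Suc n) + integral {T..2 * T} (\<lambda>t. norm (D\<^sub>1 (t + (- h))) ^ Suc n)
        + integral {T..2 * T} (\<lambda>t. norm (D\<^sub>2 (t + h)) ^ Suc n) + integral {T..2 * T} (\<lambda>t. norm (D\<^sub>2 (t + (- h))) ^ Suc n)
        + T * (C\<^sub>4 * real k) ^ Suc n)) {T..2 * T}"
        by (intro has_integral_mult_right has_integral_add integrable_integral Di hc)
    qed
    also have "\<dots> \<le> 5 ^ Suc n * (3 * T * B + 3 * T * B + 3 * T * B + 3 * T * B + T * (C\<^sub>4\<^sup>2 * K * real k * L) ^ k)"
    proof (intro mult_left_mono add_mono D1m D2m)
      have "(C\<^sub>4 * real k)\<^sup>2 \<le> C\<^sub>4\<^sup>2 * K * real k * L"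
      proof -
        have "C\<^sub>4\<^sup>2 * real k * real k \<le> C\<^sub>4\<^sup>2 * real k * (K * L)" by (rule mult_left_mono[OF kL]) auto
        then show ?thesis by (simp add: power_mult_distrib power2_eq_square mult_ac)
      qed
      then have "((C\<^sub>4 * real k)\<^sup>2) ^ k \<le> (C\<^sub>4\<^sup>2 * K * real k * L) ^ k" by (intro power_mono) auto
      then show "(C\<^sub>4 * real k) ^ Suc n \<le> (C\<^sub>4\<^sup>2 * K * real k * L) ^ k" unfolding n by (simp add: power_mult)
    qed (use T in auto)
    also have "\<dots> = 25 ^ k * (T * (12 * B + (C\<^sub>4\<^sup>2 * K * real k * L) ^ k))"
    proof -
      have "(5::real) ^ Suc n = 25 ^ k" unfolding n by (simp add: power_mult)
      then show ?thesis by (simp only:) (simp add: algebra_simps)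
    qed
    finally have Aint: "integral {T..2 * T} (\<lambda>t. A t ^ Suc n) \<le> 25 ^ k * (T * (12 * B + (C\<^sub>4\<^sup>2 * K * real k * L) ^ k))" .
    \<comment> \<open>The trivial bound at the two ends of the interval: \<open>M\<close> is a power of \<open>log T\<close> and \<open>k = O(log log T)\<close>.\<close>
    have Mpow: "M ^ Suc n \<le> T * (real k * L) ^ k"
    proof -
      have lnM: "0 \<le> ln M" using M by simp
      have "M ^ Suc n = exp (real (2 * k) * ln M)" unfolding n exp_of_nat_mult using M by simp
      also have "\<dots> \<le> exp (ln T)"
      proof -
        have "real (2 * k) * ln M \<le> 2 * (K * L) * ln M" using kL lnM by (intro mult_right_mono) auto
        also have "\<dots> \<le> ln T" using p4 by (simp add: M_def mult_ac)
        finally show ?thesis by simp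
      qed
      also have "\<dots> = T * 1" using T by simp
      also have "\<dots> \<le> T * (real k * L) ^ k"
        using T mult_mono[of 1 "real k" 1 L] k1 L1 by (intro mult_left_mono one_le_power) auto
      finally show ?thesis .
    qed
    have "integral {T..2 * T} (\<lambda>t. \<bar>Y t\<bar> ^ (2 * k)) \<le> 2 ^ Suc n * (25 ^ k * (T * (12 * B + (C\<^sub>4\<^sup>2 * K * real k * L) ^ k))) + T * (real k * L) ^ k"
    proof -
      have "2 ^ Suc n * integral {T..2 * T} (\<lambda>t. A t ^ Suc n) \<le> 2 ^ Suc n * (25 ^ k * (T * (12 * B + (C\<^sub>4\<^sup>2 * K * real k * L) ^ k)))"
        by (intro mult_left_mono Aint) auto
      then show ?thesis using main Mpow unfolding n(1)[symmetric] by linarith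
    qed
    also have "\<dots> = T * (100 ^ k * (12 * B + (C\<^sub>4\<^sup>2 * K * real k * L) ^ k) + (real k * L) ^ k)"
    proof -
      have "(2::real) ^ Suc n * 25 ^ k = 100 ^ k" unfolding n by (simp add: power_mult power_mult_distrib[symmetric])
      moreover have "2 ^ Suc n * (25 ^ k * (T * x)) + T * y = T * ((2 ^ Suc n * 25 ^ k) * x + y)" for x y :: real
        by (simp add: algebra_simps)
      ultimately show ?thesis by (simp only:)
    qed
    also have "\<dots> \<le> T * (C * real k * L) ^ k"
    proof (rule mult_left_mono)
      define R where "R = real k * L"
      have R: "R \<ge> 0" using k1 L1 by (simp add: R_def)
      have k': "k \<ge> 1" using k by simp
      have "12 * B \<le> 12 ^ k * B" using self_le_power[of "12::real" k] k B by (intro mult_right_mono) auto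
      also have "\<dots> = (24 * C\<^sub>2 * R) ^ k" unfolding B_def R_def power_mult_distrib[symmetric] by (simp add: mult_ac)
      finally have "12 * B + (C\<^sub>4\<^sup>2 * K * real k * L) ^ k \<le> (24 * C\<^sub>2 * R) ^ k + (C\<^sub>4\<^sup>2 * K * R) ^ k"
        by (simp add: R_def mult_ac)
      also have "\<dots> \<le> (24 * C\<^sub>2 * R + C\<^sub>4\<^sup>2 * K * R) ^ k"
        using C2 K R by (intro power_add_le k') auto
      finally have "100 ^ k * (12 * B + (C\<^sub>4\<^sup>2 * K * real k * L) ^ k) \<le> 100 ^ k * (24 * C\<^sub>2 * R + C\<^sub>4\<^sup>2 * K * R) ^ k"
        by (intro mult_left_mono) auto
      also have "\<dots> = (100 * (24 * C\<^sub>2 + C\<^sub>4\<^sup>2 * K) * R) ^ k"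
        unfolding power_mult_distrib[symmetric] by (simp add: algebra_simps)
      finally have "100 ^ k * (12 * B + (C\<^sub>4\<^sup>2 * K * real k * L) ^ k) + R ^ k \<le> (100 * (24 * C\<^sub>2 + C\<^sub>4\<^sup>2 * K) * R) ^ k + R ^ k"
        by simp
      also have "\<dots> \<le> (100 * (24 * C\<^sub>2 + C\<^sub>4\<^sup>2 * K) * R + R) ^ k"
        using C2 K R by (intro power_add_le k' mult_nonneg_nonneg add_nonneg_nonneg) auto
      also have "100 * (24 * C\<^sub>2 + C\<^sub>4\<^sup>2 * K) * R + R = C * real k * L" by (simp add: C_def R_def algebra_simps)
      finally show "100 ^ k * (12 * B + (C\<^sub>4\<^sup>2 * K * real k * L) ^ k) + (real k * L) ^ k \<le> (C * real k * L) ^ k"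
        by (simp add: R_def)
    qed (use T in auto)
    finally show "integral {T..2 * T} (\<lambda>t. \<bar>Im (logL (Complex \<sigma> t))\<bar> ^ (2 * k)) \<le> T * (C * real k * loglog q T) ^ k"
      by (simp add: Y_def L_def)
  qed
qed

end

section \<open>The limit at the critical line\<close>

context GRH_character
begin

lemma finite_zeros_on_line: "finite {t \<in> {a..b}. L (Complex (1/2) t) = 0}"
proof -
  define Kc where "Kc = (\<lambda>t. Complex (1/2) t) ` {a..b}"
  have "continuous_on {a..b} (\<lambda>t. Complex (1/2) t)" unfolding Complex_eq by (intro continuous_intros)
  then have "compact Kc" unfolding Kc_def by (intro compact_continuous_image) auto
  have nz: "L (Complex 2 1) \<noteq> 0" using exp_log_series[of "Complex 2 1"] exp_not_eq_zero[of "log_series (Complex 2 1)"] by simp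
  show ?thesis
  proof (cases "L constant_on {s. Re s > 0}")
    case True
    then have "L (Complex (1/2) t) = L (Complex 2 1)" for t by (auto simp: constant_on_def)
    then show ?thesis using nz by simp
  next
    case False
    have "finite {z \<in> Kc. L z = 0}"
      by (rule holomorphic_compact_finite_zeros[OF L_holomorphic _ _ \<open>compact Kc\<close> _ False])
         (auto simp: Kc_def open_halfspace_Re_gt intro!: convex_connected convex_halfspace_Re_gt)
    then have "finite (Im ` {z \<in> Kc. L z = 0})" by (rule finite_imageI)
    moreover have "{t \<in> {a..b}. L (Complex (1/2) t) = 0} \<subseteq> Im ` {z \<in> Kc. L z = 0}"
      by (force simp: Kc_def image_iff)
    ultimately show ?thesis by (rule finite_subset[rotated])
  qed
qed

text \<open>
  Dominated convergence along a sequence \<open>\<sigma>\<close> decreasing to \<open>1/2\<close>, with the constant majorant \<open>M\<^sup>m\<close>.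
  Pointwise convergence can fail only on the finite set of zeros, where the value of \<open>X_arg\<close> is unspecified.
\<close>
lemma moment_on_critical_line:
  assumes T: "T > 0" "T \<le> T'"
    and M: "\<And>\<sigma> t. 1/2 < \<sigma> \<Longrightarrow> \<sigma> \<le> 1 \<Longrightarrow> t \<in> {T..T'} \<Longrightarrow> \<bar>Im (logL (Complex \<sigma> t))\<bar> \<le> M"
    and I: "\<And>\<sigma>. 1/2 < \<sigma> \<Longrightarrow> \<sigma> \<le> 1 \<Longrightarrow> integral {T..T'} (\<lambda>t. \<bar>Im (logL (Complex \<sigma> t))\<bar> ^ m) \<le> I"
  shows "set_integrable lborel {T..T'} (\<lambda>t. \<bar>X_arg chi t\<bar> ^ m)"
    "(LBINT t:{T..T'}. \<bar>X_arg chi t\<bar> ^ m) \<le> I"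
proof -
  define \<sigma> where "\<sigma> n = 1/2 + 1 / (real n + 2)" for n :: nat
  have \<sigma>: "1/2 < \<sigma> n" "\<sigma> n \<le> 1" for n by (auto simp: \<sigma>_def field_simps)
  have \<sigma>_lim: "filterlim \<sigma> (at_right (1/2)) sequentially"
    unfolding \<sigma>_def by real_asymp
  define f where "f n t = \<bar>Im (logL (Complex (\<sigma> n) t))\<bar> ^ m" for n t
  have fc: "continuous_on {T..T'} (f n)" for n
  proof -
    have "continuous_on {T..T'} (\<lambda>t. Complex (\<sigma> n) t)" unfolding Complex_eq by (intro continuous_intros)
    then have "continuous_on {T..T'} (\<lambda>t. logL (Complex (\<sigma> n) t))"
      by (rule continuous_on_compose2[OF holomorphic_on_imp_continuous_on[OF logL_holomorphic]])
         (use T \<sigma>[of n] in \<open>auto simp: upper_right_def\<close>)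
    then show ?thesis unfolding f_def by (intro continuous_intros)
  qed
  have f_int: "set_integrable lborel {T..T'} (f n)" for n
    by (rule borel_integrable_atLeastAtMost'[OF fc])
  define Z where "Z = {t \<in> {T..T'}. L (Complex (1/2) t) = 0}"
  have finZ: "finite Z" unfolding Z_def by (rule finite_zeros_on_line)
  define s where "s n t = indicator {T..T'} t *\<^sub>R f n t" for n t
  define G where "G t = indicator {T..T'} t *\<^sub>R (\<bar>X_arg chi t\<bar> ^ m)" for t
  have s_meas: "s n \<in> borel_measurable lborel" for n
    using f_int[of n] unfolding set_integrable_def s_def by (rule borel_measurable_integrable)
  have lim: "(\<lambda>n. s n t) \<longlonglongrightarrow> G t" if "t \<notin> Z" for t
  proof (cases "t \<in> {T..T'}")
    case True
    then have "((\<lambda>\<sigma>. Im (logL (Complex \<sigma> t))) \<longlongrightarrow> X_arg chi t) (at_right (1/2))"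
      using that T by (intro X_arg_tendsto) (auto simp: Z_def)
    then have "(\<lambda>n. Im (logL (Complex (\<sigma> n) t))) \<longlonglongrightarrow> X_arg chi t"
      by (rule filterlim_compose[OF _ \<sigma>_lim])
    then have "(\<lambda>n. f n t) \<longlonglongrightarrow> \<bar>X_arg chi t\<bar> ^ m" unfolding f_def by (intro tendsto_intros)
    then show ?thesis using True by (simp add: s_def G_def)
  qed (simp add: s_def G_def)
  have G_meas: "G \<in> borel_measurable lborel"
  proof (rule measurable_discrete_difference)
    show "(\<lambda>t. if t \<in> Z then 0 else G t) \<in> borel_measurable lborel"
    proof (rule borel_measurable_LIMSEQ_metric)
      show "(\<lambda>t. if t \<in> Z then 0 else s n t) \<in> borel_measurable lborel" for n
        by (rule measurable_discrete_difference[OF s_meas[of n] countable_finite[OF finZ]]) auto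
      show "(\<lambda>n. if t \<in> Z then 0 else s n t) \<longlonglongrightarrow> (if t \<in> Z then 0 else G t)" for t
        using lim[of t] by auto
    qed
  qed (use countable_finite[OF finZ] in auto)
  have AE_Z: "AE t in lborel. t \<notin> Z"
    by (intro AE_not_in countable_imp_null_set_lborel countable_finite finZ)
  have w_int: "integrable lborel (\<lambda>t. indicator {T..T'} t *\<^sub>R M ^ m)"
    using borel_integrable_atLeastAtMost'[of T T' "\<lambda>_. M ^ m"] by (simp add: set_integrable_def)
  have lim_AE: "AE t in lborel. (\<lambda>n. s n t) \<longlonglongrightarrow> G t"
    using AE_Z by eventually_elim (rule lim)
  have dom: "AE t in lborel. norm (s n t) \<le> indicator {T..T'} t *\<^sub>R M ^ m" for n
  proof (rule AE_I2)
    fix t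
    show "norm (s n t) \<le> indicator {T..T'} t *\<^sub>R M ^ m"
    proof (cases "t \<in> {T..T'}")
      case True
      have "\<bar>Im (logL (Complex (\<sigma> n) t))\<bar> ^ m \<le> M ^ m" by (rule power_mono[OF M[OF \<sigma> True]]) auto
      then show ?thesis using True by (simp add: s_def f_def power_abs)
    qed (simp add: s_def)
  qed
  have G_int: "integrable lborel G"
    by (rule integrable_dominated_convergence[OF G_meas s_meas w_int lim_AE dom])
  have conv: "(\<lambda>n. integral\<^sup>L lborel (s n)) \<longlonglongrightarrow> integral\<^sup>L lborel G"
    by (rule integral_dominated_convergence[OF G_meas s_meas w_int lim_AE dom])
  have "integral\<^sup>L lborel (s n) \<le> I" for n
  proof -
    have "integral\<^sup>L lborel (s n) = (LINT t:{T..T'}|lborel. f n t)"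
      by (simp add: set_lebesgue_integral_def s_def[abs_def])
    also have "\<dots> = integral {T..T'} (f n)" by (rule set_borel_integral_eq_integral[OF f_int])
    also have "\<dots> \<le> I" unfolding f_def by (rule I[OF \<sigma>])
    finally show ?thesis .
  qed
  then have "integral\<^sup>L lborel G \<le> I" by (intro LIMSEQ_le_const2[OF conv]) auto
  then show "(LBINT t:{T..T'}. \<bar>X_arg chi t\<bar> ^ m) \<le> I"
    by (simp add: set_lebesgue_integral_def G_def[abs_def])
  show "set_integrable lborel {T..T'} (\<lambda>t. \<bar>X_arg chi t\<bar> ^ m)"
    using G_int by (simp add: set_integrable_def G_def[abs_def])
qed

end

theorem theorem1p1:
  fixes q :: nat and chi :: "nat \<Rightarrow> complex"
  assumes "q \<ge> 3" and "squarefree q" and "odd q"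
    and "primitive_character q chi" and "chi \<noteq> principal_character q"
    and "GRH chi"
  shows "\<forall>K::real. K > 0 \<longrightarrow>
    (\<exists>C T\<^sub>0::real. C > 0 \<and> T\<^sub>0 \<ge> 3 \<and>
      (\<forall>T\<ge>T\<^sub>0. \<forall>k::nat. 1 \<le> k \<and> real k \<le> K * loglog q T \<longrightarrow>
        set_integrable lborel {T..2*T} (\<lambda>t. \<bar>X_arg chi t\<bar> ^ (2 * k)) \<and>
        1 / T * (LBINT t:{T..2*T}. \<bar>X_arg chi t\<bar> ^ (2 * k)) \<le> (C * real k * loglog q T) ^ k))"
proof (intro allI impI)
  fix K :: real assume K: "K > 0"
  interpret GRH_character q chi
    using assms by unfold_locales (auto simp: primitive_character_def)
  obtain C T\<^sub>0 C\<^sub>1 where C: "C > 0" and T0: "T\<^sub>0 \<ge> 3"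
    and sup: "\<And>T \<sigma> t. T \<ge> T\<^sub>0 \<Longrightarrow> 1/2 < \<sigma> \<Longrightarrow> \<sigma> \<le> 1 \<Longrightarrow> t \<in> {T..2 * T} \<Longrightarrow> \<bar>Im (logL (Complex \<sigma> t))\<bar> \<le> C\<^sub>1 * ln (4 * T)"
    and mom: "\<And>T \<sigma> k. T \<ge> T\<^sub>0 \<Longrightarrow> 1/2 < \<sigma> \<Longrightarrow> \<sigma> \<le> 1 \<Longrightarrow> 1 \<le> k \<Longrightarrow> real k \<le> K * loglog q T \<Longrightarrow>
       integral {T..2 * T} (\<lambda>t. \<bar>Im (logL (Complex \<sigma> t))\<bar> ^ (2 * k)) \<le> T * (C * real k * loglog q T) ^ k"
    using moment_right_of_critical_line[OF K] by metis
  show "\<exists>C T\<^sub>0::real. C > 0 \<and> T\<^sub>0 \<ge> 3 \<and>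
      (\<forall>T\<ge>T\<^sub>0. \<forall>k::nat. 1 \<le> k \<and> real k \<le> K * loglog q T \<longrightarrow>
        set_integrable lborel {T..2*T} (\<lambda>t. \<bar>X_arg chi t\<bar> ^ (2 * k)) \<and>
        1 / T * (LBINT t:{T..2*T}. \<bar>X_arg chi t\<bar> ^ (2 * k)) \<le> (C * real k * loglog q T) ^ k)"
  proof (rule exI[of _ C], rule exI[of _ T\<^sub>0], intro conjI allI impI C T0)
    fix T :: real and k :: nat assume T: "T\<^sub>0 \<le> T" and k: "1 \<le> k \<and> real k \<le> K * loglog q T"
    have T': "T > 0" "T \<le> 2 * T" using T T0 by auto
    note moment = moment_on_critical_line[OF T' sup[OF T] mom[OF T]]
    show "set_integrable lborel {T..2*T} (\<lambda>t. \<bar>X_arg chi t\<bar> ^ (2 * k))"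
      by (rule moment(1)) (use k in auto)
    have "(LBINT t:{T..2*T}. \<bar>X_arg chi t\<bar> ^ (2 * k)) \<le> T * (C * real k * loglog q T) ^ k"
      by (rule moment(2)) (use k in auto)
    then show "1 / T * (LBINT t:{T..2*T}. \<bar>X_arg chi t\<bar> ^ (2 * k)) \<le> (C * real k * loglog q T) ^ k"
      using T' by (simp add: field_simps)
  qed
qed

end
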